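(* Consider a linear time-varying dHDAE initial value problem $$E\dot z=(J-R-EK)z,\qquad z(t_0)=z_0,$$ on $\mathbb T=[t_0,t_{\mathrm f}]$, whose (sufficiently smooth) coefficients are in the block normal form $$E=\begin{bmatrix}E_{11}&E_{12}&0&0&0\\ E_{21}&E_{22}&0&0&0\\0&0&0&0&0\\0&0&0&0&0\\0&0&0&0&0\end{bmatrix},\quad J-R=\begin{bmatrix}J_{11}-R_{11}&J_{12}-R_{12}&J_{13}-R_{13}&J_{14}&0\\ J_{21}-R_{21}&J_{22}-R_{22}&J_{23}-R_{23}&0&0\\ J_{31}-R_{31}&J_{32}-R_{32}&J_{33}-R_{33}&0&0\\ J_{41}&0&0&0&0\\0&0&0&0&0\end{bmatrix},$$ $$K=\begin{bmatrix}K_{11}&K_{12}&0&0&0\\ K_{21}&K_{22}&0&0&0\\ K_{31}&K_{32}&K_{33}&K_{34}&K_{35}\\ K_{41}&K_{42}&K_{43}&K_{44}&K_{45}\\ K_{51}&K_{52}&K_{53}&K_{54}&K_{55}\end{bmatrix}$$ with block sizes $n_1,n_2,n_3,n_4=n_1,n_5$ (blocks may be void), where $\begin{bmatrix}E_{11}&E_{12}\\ E_{21}&E_{22}\end{bmatrix}$ is pointwise symmetric positive definite, $J_{33}-R_{33}$ (with $R_{33}\ge0$) and $J_{41}=-J_{14}^T$ are pointwise nonsingular, and $\begin{bmatrix}E_{11}&E_{12}\\ E_{21}&E_{22}\end{bmatrix}\begin{bmatrix}K_{11}&K_{12}\\ K_{21}&K_{22}\end{bmatrix}$ is pointwise skew-symmetric.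 Partition $z=(z_1,\dots,z_5)$ accordingly. Then: (i) The initial value problem is uniquely solvable (for consistent initial values) if and only if $n_5=0$. If $n_5\ne0$, then $z_5$ can be chosen arbitrarily. (ii) The solution of the initial value problem is not unique (for consistent initial values) if and only if the matrix functions $E,J,R,EK$ have a (nontrivial) common kernel. (iii) The strangeness index is $0$ if and only if $n_1=n_4=0$. Otherwise the strangeness index is $1$, if and only if $n_1=n_4>0$.
   Context: dHDAE: $E=E^T\ge 0$, $R=R^T\ge0$ pointwise, and the operator $E\frac{\mathrm d}{\mathrm dt}-(J-EK)$ is skew-adjoint, i.e. $\dot E=(EK-J)+(EK-J)^T$ pointwise. A solution is a continuously differentiable function satisfying the equation pointwise; an initial value is consistent if the initial value problem has at least one solution. Strangeness index of $E\dot z=Az$ with $E,A:\mathbb T\to\mathbb R^{n,n}$ sufficiently smooth: for $\mu\ge0$ define block matrix functions, $i,j=0,\dots,\mu$, $(\mathcal E_\mu)_{i,j}=\binom ijE^{(i-j)}-\binom i{j+1}A^{(i-j-1)}$ (terms with vanishing binomial coefficient are zero), $(\mathcal A_\mu)_{i,0}=A^{(i)}$, $(\mathcal A_\mu)_{i,j}=0$ for $j\ge1$; let $\widehat{\mathcal A}_\mu$ be the first block column of $\mathcal A_\mu$. The corank of a matrix is its number of rows minus its rank, and $\operatorname{corank}[\mathcal E_{-1}\ \mathcal A_{-1}]:=0$. The strangeness index is the smallest $\mu\geq 0$ for which there are integers $r,a,v$ such that on all of $\mathbb T$: $\operatorname{rank}[\mathcal E_\mu\ \mathcal A_\mu]=r$;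 $\operatorname{corank}[\mathcal E_\mu\ \mathcal A_\mu]-\operatorname{corank}[\mathcal E_{\mu-1}\ \mathcal A_{\mu-1}]=v$; $\operatorname{rank}\mathcal E_\mu=r-a$, so that there are smooth matrix functions $Z_a$ of size $(\mu+1)n\times a$ and $T_a$ of size $n\times(n-a)$ of pointwise maximal rank with $Z_a^T\mathcal E_\mu=0$, $\operatorname{rank}Z_a^T\mathcal A_\mu=a$, $Z_a^T\widehat{\mathcal A}_\mu T_a=0$; and $\operatorname{rank}(ET_a)=n-a-v$. Here $A=J-R-EK$. *)

theory Defs
  imports "HOL-Analysis.Analysis" "HOL-Library.Extended_Nat" "Jordan_Normal_Form.DL_Rank"
begin

text \<open>
  All block sizes may be zero, so matrices and vectors are those of \<open>Jordan_Normal_Form\<close>, with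
  natural-number dimensions. The names \<open>vec\<close>, \<open>rank\<close> and some notation also exist in
  \<open>HOL-Analysis\<close>; the qualified or prefix forms below always denote the \<open>Jordan_Normal_Form\<close> notions.
\<close>


subsection \<open>Smooth matrix functions on an interval\<close>

text \<open>
  Derivatives are taken within \<open>T\<close>, so they are one-sided at the end points of a closed interval.
  The functions are total on \<^typ>\<open>real\<close>, but only their values on \<open>T\<close> matter.
\<close>

definition nderiv :: "real set \<Rightarrow> nat \<Rightarrow> (real \<Rightarrow> real) \<Rightarrow> real \<Rightarrow> real" where
  "nderiv T m = (\<lambda>f t. vector_derivative f (at t within T)) ^^ m"

definition Ck_on :: "enat \<Rightarrow> real set \<Rightarrow> (real \<Rightarrow> real) \<Rightarrow> bool" where
  "Ck_on k T f \<longleftrightarrow>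
     (\<forall>m. enat m < k \<longrightarrow> nderiv T m f differentiable_on T) \<and>
     (\<forall>m. enat m \<le> k \<longrightarrow> continuous_on T (nderiv T m f))"

definition Ck_mat :: "enat \<Rightarrow> real set \<Rightarrow> nat \<Rightarrow> nat \<Rightarrow> (real \<Rightarrow> real mat) \<Rightarrow> bool" where
  "Ck_mat k T nr nc M \<longleftrightarrow>
     (\<forall>t\<in>T. M t \<in> carrier_mat nr nc) \<and>
     (\<forall>i<nr. \<forall>j<nc. Ck_on k T (\<lambda>t. M t $$ (i, j)))"

definition Ck_vec :: "enat \<Rightarrow> real set \<Rightarrow> nat \<Rightarrow> (real \<Rightarrow> real Matrix.vec) \<Rightarrow> bool" where
  "Ck_vec k T n z \<longleftrightarrow>
     (\<forall>t\<in>T. z t \<in> carrier_vec n) \<and> (\<forall>i<n. Ck_on k T (\<lambda>t. vec_index (z t) i))"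

definition mat_nderiv :: "real set \<Rightarrow> nat \<Rightarrow> (real \<Rightarrow> real mat) \<Rightarrow> real \<Rightarrow> real mat" where
  "mat_nderiv T m M t =
     Matrix.mat (dim_row (M t)) (dim_col (M t)) (\<lambda>(i, j). nderiv T m (\<lambda>s. M s $$ (i, j)) t)"

definition vec_deriv :: "real set \<Rightarrow> (real \<Rightarrow> real Matrix.vec) \<Rightarrow> real \<Rightarrow> real Matrix.vec" where
  "vec_deriv T z t = Matrix.vec (dim_vec (z t)) (\<lambda>i. nderiv T 1 (\<lambda>s. vec_index (z s) i) t)"


subsection \<open>Matrices\<close>

definition pos_semidef :: "nat \<Rightarrow> real mat \<Rightarrow> bool" where
  "pos_semidef n A \<longleftrightarrow> A \<in> carrier_mat n n \<and> transpose_mat A = A \<and>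
     (\<forall>x\<in>carrier_vec n. 0 \<le> scalar_prod x (A *\<^sub>v x))"

definition pos_def :: "nat \<Rightarrow> real mat \<Rightarrow> bool" where
  "pos_def n A \<longleftrightarrow> A \<in> carrier_mat n n \<and> transpose_mat A = A \<and>
     (\<forall>x\<in>carrier_vec n. x \<noteq> 0\<^sub>v n \<longrightarrow> 0 < scalar_prod x (A *\<^sub>v x))"

definition mat_rank :: "real mat \<Rightarrow> nat" where
  "mat_rank A = vec_space.rank (dim_row A) A"

text \<open>An integer, because the strangeness index uses differences of coranks.\<close>

definition corank :: "real mat \<Rightarrow> int" where
  "corank A = int (dim_row A) - int (mat_rank A)"

definition hconcat :: "real mat \<Rightarrow> real mat \<Rightarrow> real mat" where
  "hconcat A B = mat_of_cols (dim_row A) (cols A @ cols B)"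

text \<open>An \<open>r\<close> by \<open>c\<close> array of blocks of size \<open>n\<close> by \<open>n\<close>, with block indices starting at 0.\<close>

definition block_array :: "nat \<Rightarrow> nat \<Rightarrow> nat \<Rightarrow> (nat \<Rightarrow> nat \<Rightarrow> real mat) \<Rightarrow> real mat" where
  "block_array n r c B =
     Matrix.mat (r * n) (c * n) (\<lambda>(p, q). B (p div n) (q div n) $$ (p mod n, q mod n))"

text \<open>
  Block \<open>(i, j)\<close> of a matrix whose rows and columns are both partitioned into consecutive blocks of
  the sizes listed in \<open>d\<close>; block indices start at 1.
\<close>

definition block :: "nat list \<Rightarrow> nat \<Rightarrow> nat \<Rightarrow> real mat \<Rightarrow> real mat" where
  "block d i j M = Matrix.mat (d ! (i - 1)) (d ! (j - 1))
     (\<lambda>(p, q). M $$ (sum_list (take (i - 1) d) + p, sum_list (take (j - 1) d) + q))"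

definition zero_block :: "nat list \<Rightarrow> nat \<Rightarrow> nat \<Rightarrow> real mat \<Rightarrow> bool" where
  "zero_block d i j M \<longleftrightarrow> block d i j M = 0\<^sub>m (d ! (i - 1)) (d ! (j - 1))"

definition leading22 :: "nat list \<Rightarrow> real mat \<Rightarrow> real mat" where
  "leading22 d M = four_block_mat (block d 1 1 M) (block d 1 2 M) (block d 2 1 M) (block d 2 2 M)"


subsection \<open>The dHDAE and its solutions\<close>

text \<open>
  The last condition says that the operator \<open>E d/dt - (J - E K)\<close> is skew-adjoint. It does not make
  \<open>J\<close> pointwise skew-symmetric.
\<close>

definition dHDAE ::
    "real set \<Rightarrow> nat \<Rightarrow> (real \<Rightarrow> real mat) \<Rightarrow> (real \<Rightarrow> real mat) \<Rightarrow> (real \<Rightarrow> real mat) \<Rightarrow>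
     (real \<Rightarrow> real mat) \<Rightarrow> bool" where
  "dHDAE T n E J R K \<longleftrightarrow>
     (\<forall>t\<in>T. J t \<in> carrier_mat n n \<and> K t \<in> carrier_mat n n \<and>
        pos_semidef n (E t) \<and> pos_semidef n (R t) \<and>
        mat_nderiv T 1 E t = (E t * K t - J t) + transpose_mat (E t * K t - J t))"

definition sys_mat ::
    "(real \<Rightarrow> real mat) \<Rightarrow> (real \<Rightarrow> real mat) \<Rightarrow> (real \<Rightarrow> real mat) \<Rightarrow> (real \<Rightarrow> real mat) \<Rightarrow>
     real \<Rightarrow> real mat" where
  "sys_mat E J R K t = J t - R t - E t * K t"

text \<open>Here \<open>z\<close> solves \<open>E z' = A z\<close>, \<open>z(t0) = z0\<close> on \<open>[t0, tf]\<close>.\<close>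

definition solves_ivp ::
    "real \<Rightarrow> real \<Rightarrow> nat \<Rightarrow> (real \<Rightarrow> real mat) \<Rightarrow> (real \<Rightarrow> real mat) \<Rightarrow>
     real Matrix.vec \<Rightarrow> (real \<Rightarrow> real Matrix.vec) \<Rightarrow> bool" where
  "solves_ivp t0 tf n E A z0 z \<longleftrightarrow>
     Ck_vec 1 {t0..tf} n z \<and> z t0 = z0 \<and>
     (\<forall>t\<in>{t0..tf}. E t *\<^sub>v vec_deriv {t0..tf} z t = A t *\<^sub>v z t)"

definition consistent ::
    "real \<Rightarrow> real \<Rightarrow> nat \<Rightarrow> (real \<Rightarrow> real mat) \<Rightarrow> (real \<Rightarrow> real mat) \<Rightarrow> real Matrix.vec \<Rightarrow> bool" where
  "consistent t0 tf n E A z0 \<longleftrightarrow> (\<exists>z. solves_ivp t0 tf n E A z0 z)"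

text \<open>Solutions are identified when they agree on \<open>[t0, tf]\<close>.\<close>

definition solution_unique ::
    "real \<Rightarrow> real \<Rightarrow> nat \<Rightarrow> (real \<Rightarrow> real mat) \<Rightarrow> (real \<Rightarrow> real mat) \<Rightarrow> real Matrix.vec \<Rightarrow> bool" where
  "solution_unique t0 tf n E A z0 \<longleftrightarrow>
     (\<forall>y z. solves_ivp t0 tf n E A z0 y \<longrightarrow> solves_ivp t0 tf n E A z0 z \<longrightarrow>
        (\<forall>t\<in>{t0..tf}. y t = z t))"

definition uniquely_solvable ::
    "real \<Rightarrow> real \<Rightarrow> nat \<Rightarrow> (real \<Rightarrow> real mat) \<Rightarrow> (real \<Rightarrow> real mat) \<Rightarrow> real Matrix.vec \<Rightarrow> bool" where
  "uniquely_solvable t0 tf n E A z0 \<longleftrightarrow>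
     (\<exists>z. solves_ivp t0 tf n E A z0 z) \<and> solution_unique t0 tf n E A z0"

definition common_kernel ::
    "nat \<Rightarrow> real mat \<Rightarrow> real mat \<Rightarrow> real mat \<Rightarrow> real mat \<Rightarrow> real Matrix.vec set" where
  "common_kernel n A B C D =
     {x \<in> carrier_vec n. A *\<^sub>v x = 0\<^sub>v n \<and> B *\<^sub>v x = 0\<^sub>v n \<and> C *\<^sub>v x = 0\<^sub>v n \<and> D *\<^sub>v x = 0\<^sub>v n}"


subsection \<open>The strangeness index\<close>

text \<open>
  In the inflated coefficients, the binomial coefficients vanish whenever the subtraction in the
  order of a derivative would truncate.
\<close>

definition infl_E ::
    "real set \<Rightarrow> nat \<Rightarrow> (real \<Rightarrow> real mat) \<Rightarrow> (real \<Rightarrow> real mat) \<Rightarrow> nat \<Rightarrow> real \<Rightarrow> real mat" where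
  "infl_E T n E A \<mu> t = block_array n (\<mu> + 1) (\<mu> + 1) (\<lambda>i j.
     real (i choose j) \<cdot>\<^sub>m mat_nderiv T (i - j) E t -
     real (i choose (j + 1)) \<cdot>\<^sub>m mat_nderiv T (i - j - 1) A t)"

definition infl_A :: "real set \<Rightarrow> nat \<Rightarrow> (real \<Rightarrow> real mat) \<Rightarrow> nat \<Rightarrow> real \<Rightarrow> real mat" where
  "infl_A T n A \<mu> t = block_array n (\<mu> + 1) (\<mu> + 1) (\<lambda>i j.
     if j = 0 then mat_nderiv T i A t else 0\<^sub>m n n)"

definition infl_A_col :: "real set \<Rightarrow> nat \<Rightarrow> (real \<Rightarrow> real mat) \<Rightarrow> nat \<Rightarrow> real \<Rightarrow> real mat" where
  "infl_A_col T n A \<mu> t = block_array n (\<mu> + 1) 1 (\<lambda>i j. mat_nderiv T i A t)"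

definition infl_EA ::
    "real set \<Rightarrow> nat \<Rightarrow> (real \<Rightarrow> real mat) \<Rightarrow> (real \<Rightarrow> real mat) \<Rightarrow> nat \<Rightarrow> real \<Rightarrow> real mat" where
  "infl_EA T n E A \<mu> t = hconcat (infl_E T n E A \<mu> t) (infl_A T n A \<mu> t)"

text \<open>
  For \<open>k\<close> times continuously differentiable coefficients (possibly \<open>k = \<infinity>\<close>), the inflated
  coefficients exist for \<open>\<mu> \<le> k\<close> and are \<open>k - \<mu>\<close> times continuously differentiable; this is
  the smoothness required of \<open>Z\<close> and \<open>Ta\<close>.
\<close>

definition strangeness_hyp ::
    "enat \<Rightarrow> real set \<Rightarrow> nat \<Rightarrow> (real \<Rightarrow> real mat) \<Rightarrow> (real \<Rightarrow> real mat) \<Rightarrow> nat \<Rightarrow> bool" where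
  "strangeness_hyp k T n E A \<mu> \<longleftrightarrow> enat \<mu> \<le> k \<and>
     (\<exists>(r::int) (a::nat) (v::int). a \<le> n \<and>
        (\<forall>t\<in>T. int (mat_rank (infl_EA T n E A \<mu> t)) = r) \<and>
        (\<forall>t\<in>T. corank (infl_EA T n E A \<mu> t) -
           (if \<mu> = 0 then 0 else corank (infl_EA T n E A (\<mu> - 1) t)) = v) \<and>
        (\<forall>t\<in>T. int (mat_rank (infl_E T n E A \<mu> t)) = r - int a) \<and>
        (\<exists>Z Ta. Ck_mat (k - enat \<mu>) T ((\<mu> + 1) * n) a Z \<and>
           Ck_mat (k - enat \<mu>) T n (n - a) Ta \<and>
           (\<forall>t\<in>T.
              mat_rank (Z t) = a \<and> mat_rank (Ta t) = n - a \<and>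
              transpose_mat (Z t) * infl_E T n E A \<mu> t = 0\<^sub>m a ((\<mu> + 1) * n) \<and>
              mat_rank (transpose_mat (Z t) * infl_A T n A \<mu> t) = a \<and>
              transpose_mat (Z t) * infl_A_col T n A \<mu> t * Ta t = 0\<^sub>m a (n - a) \<and>
              int (mat_rank (E t * Ta t)) = int n - int a - v)))"

definition is_strangeness_index ::
    "enat \<Rightarrow> real set \<Rightarrow> nat \<Rightarrow> (real \<Rightarrow> real mat) \<Rightarrow> (real \<Rightarrow> real mat) \<Rightarrow> nat \<Rightarrow> bool" where
  "is_strangeness_index k T n E A \<mu> \<longleftrightarrow>
     strangeness_hyp k T n E A \<mu> \<and> (\<forall>\<nu><\<mu>. \<not> strangeness_hyp k T n E A \<nu>)"


subsection \<open>The block normal form\<close>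

text \<open>
  The block sizes are \<open>d = [n1, n2, n3, n4, n5]\<close>. In the positions (1,4) and (4,1) the block of
  \<open>J - R\<close> is that of \<open>J\<close>, so \<open>R\<close> vanishes there.
\<close>

definition normal_form_pattern ::
    "nat list \<Rightarrow> real mat \<Rightarrow> real mat \<Rightarrow> real mat \<Rightarrow> real mat \<Rightarrow> bool" where
  "normal_form_pattern d E J R K \<longleftrightarrow>
     (\<forall>i\<in>{1..5}. \<forall>j\<in>{1..5}. 3 \<le> i \<or> 3 \<le> j \<longrightarrow> zero_block d i j E) \<and>
     (\<forall>(i, j)\<in>{(1,5), (2,4), (2,5), (3,4), (3,5), (4,2), (4,3), (4,4), (4,5),
                (5,1), (5,2), (5,3), (5,4), (5,5)}. zero_block d i j (J - R)) \<and>
     zero_block d 1 4 R \<and> zero_block d 4 1 R \<and>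
     (\<forall>i\<in>{1,2}. \<forall>j\<in>{3,4,5}. zero_block d i j K)"

definition block_normal_form ::
    "real set \<Rightarrow> nat list \<Rightarrow> (real \<Rightarrow> real mat) \<Rightarrow> (real \<Rightarrow> real mat) \<Rightarrow>
     (real \<Rightarrow> real mat) \<Rightarrow> (real \<Rightarrow> real mat) \<Rightarrow> bool" where
  "block_normal_form T d E J R K \<longleftrightarrow>
     (\<forall>t\<in>T.
        normal_form_pattern d (E t) (J t) (R t) (K t) \<and>
        pos_def (d ! 0 + d ! 1) (leading22 d (E t)) \<and>
        pos_semidef (d ! 2) (block d 3 3 (R t)) \<and>
        invertible_mat (block d 3 3 (J t - R t)) \<and>
        block d 4 1 (J t) = - transpose_mat (block d 1 4 (J t)) \<and>
        invertible_mat (block d 4 1 (J t)) \<and>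
        transpose_mat (leading22 d (E t) * leading22 d (K t)) =
          - (leading22 d (E t) * leading22 d (K t)))"

text \<open>Replaces the part of \<open>x\<close> after the first \<open>m\<close> entries by \<open>w\<close>.\<close>

definition replace_tail :: "nat \<Rightarrow> real Matrix.vec \<Rightarrow> real Matrix.vec \<Rightarrow> real Matrix.vec" where
  "replace_tail m x w = vec_first x m @\<^sub>v w"

end

theory Submission
  imports Defs
begin

text \<open>
  In the normal form, the fourth block row \<open>J41 z1 = 0\<close> forces \<open>z1 = 0\<close>, the third one gives \<open>z3\<close> in
  terms of \<open>z2\<close>, the second one is an implicit differential equation for \<open>z2\<close> with a positive definite
  leading coefficient, the first one gives \<open>z4\<close>, and \<open>z5\<close> does not occur.

  Solvability. No existence theorem is needed, since only consistent initial values are considered.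
  For uniqueness, the structure of the equation replaces a Gronwall argument: by skew-adjointness of
  \<open>E d/dt - (J - E K)\<close>, the energy \<open>u\<^sup>T E u\<close> of the difference \<open>u\<close> of two solutions has the derivative
  \<open>- 2 u\<^sup>T R u \<le> 0\<close> (\<open>energy_derivative\<close>). So \<open>u\<^sup>T E u = 0\<close>, which gives \<open>u1 = u2 = 0\<close> and then, by
  pointwise linear algebra, \<open>u3 = u4 = 0\<close>. Hence two solutions differ at most in \<open>z5\<close>. Conversely,
  \<open>E\<close>, \<open>J\<close>, \<open>R\<close> and \<open>E K\<close> vanish in the columns of \<open>z5\<close>, so \<open>z5\<close> is arbitrary, and its
  coordinate directions lie in the common kernel.

  Strangeness index. Write left kernel vectors of the inflated coefficients of order 1 as pairs
  \<open>(y, w)\<close>. The central lemma \<open>left_kernel1_zero\<close> determines this kernel: a pair that annihilates the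
  inflated \<open>E\<close> and the columns of \<open>z1\<close>, \<open>z3\<close>, \<open>z4\<close> in the inflated \<open>A\<close> lives on the rows of the void
  fifth equation. It yields the ranks, with \<open>a = n3\<close> for order 0 if \<open>n1 = 0\<close>, \<open>a = n3 + 2 n1\<close> for order
  1, and \<open>v = n5\<close>, and it shows that \<open>z2\<close> and \<open>z5\<close> parametrise the solutions of the constraints. If
  \<open>n1 > 0\<close>, then order 0 fails because the constraint \<open>J41 z1 = 0\<close> reduces the rank of \<open>E Ta\<close> to at
  most \<open>n2\<close> (\<open>not_strangeness_hyp_0\<close>).

  Smooth choices of \<open>Ta\<close>, and of \<open>Z\<close> for order 1, come from \<open>smooth_kernel_basis\<close>, which reads a
  kernel basis off an adjugate. Entries of the adjugate are polynomials in the entries of the matrix,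
  so sums and products of \<open>k\<close> times differentiable functions suffice.
\<close>

section \<open>Functions with finitely many derivatives on an interval\<close>

text \<open>First derivatives are kept in the form \<open>nderiv T 1 f\<close>.\<close>

declare One_nat_def [simp del]

lemma nderiv_0 [simp]: "nderiv T 0 f = f"
  by (simp add: nderiv_def)

lemma nderiv_Suc: "nderiv T (Suc m) f t = vector_derivative (nderiv T m f) (at t within T)"
  by (simp add: nderiv_def)

lemma nderiv_Suc_shift: "nderiv T (Suc m) f = nderiv T m (nderiv T 1 f)"
  by (simp add: nderiv_def funpow_Suc_right One_nat_def del: funpow.simps(2))

lemma nderiv_1: "nderiv T 1 f t = vector_derivative f (at t within T)"
  using nderiv_Suc[of T 0 f t] by (simp add: One_nat_def)

lemma nderiv_cong:
  assumes "\<And>t. t \<in> T \<Longrightarrow> f t = g t" "t \<in> T"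
  shows "nderiv T m f t = nderiv T m g t"
  using assms(2)
proof (induction m arbitrary: t)
  case 0
  then show ?case using assms(1) by simp
next
  case (Suc m)
  have "(nderiv T m f has_vector_derivative y) (at t within T)
      \<longleftrightarrow> (nderiv T m g has_vector_derivative y) (at t within T)" for y
  proof
    show "(nderiv T m f has_vector_derivative y) (at t within T)
        \<Longrightarrow> (nderiv T m g has_vector_derivative y) (at t within T)"
      by (rule has_vector_derivative_transform[OF Suc.prems]) (auto simp: Suc.IH)
    show "(nderiv T m g has_vector_derivative y) (at t within T)
        \<Longrightarrow> (nderiv T m f has_vector_derivative y) (at t within T)"
      by (rule has_vector_derivative_transform[OF Suc.prems]) (auto simp: Suc.IH)
  qed
  then show ?case by (simp add: nderiv_Suc vector_derivative_def)
qed

lemma Ck_on_cong: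
  assumes "\<And>t. t \<in> T \<Longrightarrow> f t = g t"
  shows "Ck_on k T f \<longleftrightarrow> Ck_on k T g"
proof -
  have eq: "nderiv T m f t = nderiv T m g t" if "t \<in> T" for m t
    using assms that by (rule nderiv_cong)
  have "h differentiable_on T" if "h' differentiable_on T" "\<And>t. t \<in> T \<Longrightarrow> h t = h' t"
    for h h' :: "real \<Rightarrow> real"
    using that has_derivative_transform[of _ T h h'] unfolding differentiable_on_def differentiable_def
    by meson
  from this[of "nderiv T m f" "nderiv T m g" for m] this[of "nderiv T m g" "nderiv T m f" for m]
  have "nderiv T m f differentiable_on T \<longleftrightarrow> nderiv T m g differentiable_on T" for m
    using eq by metis
  moreover have "continuous_on T (nderiv T m f) \<longleftrightarrow> continuous_on T (nderiv T m g)" for m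
    by (rule continuous_on_cong) (auto simp: eq)
  ultimately show ?thesis by (simp add: Ck_on_def)
qed

lemma Ck_on_mono: "Ck_on k T f \<Longrightarrow> l \<le> k \<Longrightarrow> Ck_on l T f"
  unfolding Ck_on_def by (meson order_less_le_trans order_trans)

lemma Ck_on_iff_finite: "Ck_on k T f \<longleftrightarrow> (\<forall>m. enat m \<le> k \<longrightarrow> Ck_on (enat m) T f)"
proof
  show "Ck_on k T f \<Longrightarrow> \<forall>m. enat m \<le> k \<longrightarrow> Ck_on (enat m) T f"
    using Ck_on_mono by blast
next
  assume f: "\<forall>m. enat m \<le> k \<longrightarrow> Ck_on (enat m) T f"
  have "nderiv T m f differentiable_on T" if "enat m < k" for m
    using f[rule_format, of "Suc m"] that by (simp add: Ck_on_def ileI1 flip: eSuc_enat)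
  moreover have "continuous_on T (nderiv T m f)" if "enat m \<le> k" for m
    using f[rule_format, of m] that by (simp add: Ck_on_def)
  ultimately show "Ck_on k T f" by (simp add: Ck_on_def)
qed

lemma Ck_on_0: "Ck_on (enat 0) T f \<longleftrightarrow> continuous_on T f"
  by (simp add: Ck_on_def)

lemma Ck_on_Suc:
  "Ck_on (enat (Suc m)) T f \<longleftrightarrow> f differentiable_on T \<and> Ck_on (enat m) T (nderiv T 1 f)"
proof
  assume f: "Ck_on (enat (Suc m)) T f"
  have diff: "nderiv T j f differentiable_on T" if "j < Suc m" for j
    using f that by (simp add: Ck_on_def)
  have "continuous_on T (nderiv T j f)" if "j \<le> Suc m" for j
    using f that by (simp add: Ck_on_def)
  with diff diff[of 0] show "f differentiable_on T \<and> Ck_on (enat m) T (nderiv T 1 f)"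
    unfolding Ck_on_def nderiv_Suc_shift[symmetric] by simp
next
  assume f: "f differentiable_on T \<and> Ck_on (enat m) T (nderiv T 1 f)"
  have "nderiv T j f differentiable_on T" if "j < Suc m" for j
    using f that by (cases j) (auto simp: Ck_on_def nderiv_Suc_shift)
  moreover have "continuous_on T (nderiv T j f)" if "j \<le> Suc m" for j
    using f that by (cases j) (auto simp: Ck_on_def nderiv_Suc_shift differentiable_imp_continuous_on)
  ultimately show "Ck_on (enat (Suc m)) T f" by (simp add: Ck_on_def)
qed

lemma Ck_on_differentiable:
  assumes "Ck_on k T f" "1 \<le> k"
  shows "f differentiable_on T"
  using Ck_on_mono[OF assms] Ck_on_Suc[of 0 T f] by (simp add: one_enat_def One_nat_def)

lemma Ck_on_nderiv:
  assumes "Ck_on k T f" "1 \<le> k"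
  shows "Ck_on (k - 1) T (nderiv T 1 f)"
proof (subst Ck_on_iff_finite, intro allI impI)
  fix m assume "enat m \<le> k - 1"
  then have "enat (Suc m) \<le> k"
    using assms(2) by (cases k) (auto simp: one_enat_def)
  then show "Ck_on (enat m) T (nderiv T 1 f)"
    using Ck_on_mono[OF assms(1)] Ck_on_Suc by blast
qed

lemma nderiv_has_vector_derivative:
  assumes "f differentiable_on T" "t \<in> T"
  shows "(f has_vector_derivative nderiv T 1 f t) (at t within T)"
  using assms vector_derivative_works unfolding nderiv_1 differentiable_on_def by blast

lemma nderiv_has_real_derivative:
  assumes "f differentiable_on T" "t \<in> T"
  shows "(f has_real_derivative nderiv T 1 f t) (at t within T)"
  using nderiv_has_vector_derivative[OF assms]
  unfolding has_real_derivative_iff_has_vector_derivative .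

text \<open>
  On an interval with more than one point derivatives are unique at the end points too, so the usual
  rules apply.
\<close>

locale time_interval =
  fixes t0 tf :: real and T :: "real set"
  assumes t0_less_tf: "t0 < tf" and T_def: "T = {t0..tf}"
begin

lemma nderiv_eqI:
  assumes "(f has_real_derivative y) (at t within T)" "t \<in> T"
  shows "nderiv T 1 f t = y"
  using assms t0_less_tf vector_derivative_within_closed_interval[of t0 tf t f y]
  unfolding nderiv_1 T_def has_real_derivative_iff_has_vector_derivative by simp

lemma nderiv_const [simp]: "t \<in> T \<Longrightarrow> nderiv T 1 (\<lambda>s. c) t = 0"
  by (rule nderiv_eqI) auto

lemma nderiv_zero:
  assumes "\<And>s. s \<in> T \<Longrightarrow> f s = 0" "t \<in> T"
  shows "nderiv T 1 f t = 0"
  using nderiv_cong[of T f "\<lambda>s. 0" t 1] assms by simp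

lemma nderiv_diff:
  assumes "f differentiable_on T" "g differentiable_on T" "t \<in> T"
  shows "nderiv T 1 (\<lambda>s. f s - g s) t = nderiv T 1 f t - nderiv T 1 g t"
  using assms by (intro nderiv_eqI DERIV_diff nderiv_has_real_derivative) auto

lemma nderiv_add:
  assumes "f differentiable_on T" "g differentiable_on T" "t \<in> T"
  shows "nderiv T 1 (\<lambda>s. f s + g s) t = nderiv T 1 f t + nderiv T 1 g t"
  using assms by (intro nderiv_eqI DERIV_add nderiv_has_real_derivative) auto

lemma nderiv_mult:
  assumes "f differentiable_on T" "g differentiable_on T" "t \<in> T"
  shows "nderiv T 1 (\<lambda>s. f s * g s) t = nderiv T 1 f t * g t + f t * nderiv T 1 g t"
  using DERIV_mult[OF nderiv_has_real_derivative[OF assms(1,3)] nderiv_has_real_derivative[OF assms(2,3)]]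
    assms(3)
  by (intro nderiv_eqI) (auto simp: algebra_simps)

lemma Ck_on_const [intro, simp]: "Ck_on k T (\<lambda>t. c)"
proof -
  have "Ck_on (enat m) T (\<lambda>t. c)" for m c
  proof (induction m arbitrary: c)
    case 0
    then show ?case by (simp add: Ck_on_0)
  next
    case (Suc m)
    have "Ck_on (enat m) T (nderiv T 1 (\<lambda>t. c))"
      using Ck_on_cong[of T "nderiv T 1 (\<lambda>t. c)" "\<lambda>t. 0" "enat m"] Suc[of 0] by simp
    then show ?case by (simp add: Ck_on_Suc)
  qed
  then show ?thesis by (subst Ck_on_iff_finite) simp
qed

lemma Ck_on_add [intro]:
  assumes "Ck_on k T f" "Ck_on k T g"
  shows "Ck_on k T (\<lambda>t. f t + g t)"
proof -
  have "Ck_on (enat m) T (\<lambda>t. f t + g t)" if "Ck_on (enat m) T f" "Ck_on (enat m) T g" for m f g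
    using that
  proof (induction m arbitrary: f g)
    case 0
    then show ?case by (auto simp: Ck_on_0 intro: continuous_intros)
  next
    case (Suc m)
    then have "Ck_on (enat m) T (nderiv T 1 (\<lambda>t. f t + g t))"
      using Ck_on_cong[of T "nderiv T 1 (\<lambda>t. f t + g t)" "\<lambda>t. nderiv T 1 f t + nderiv T 1 g t" "enat m"]
      by (auto simp: Ck_on_Suc nderiv_add)
    then show ?case using Suc.prems by (auto simp: Ck_on_Suc)
  qed
  from this[OF Ck_on_mono[OF assms(1)] Ck_on_mono[OF assms(2)]] show ?thesis
    using Ck_on_iff_finite[of k T] by blast
qed

lemma Ck_on_mult [intro]:
  assumes "Ck_on k T f" "Ck_on k T g"
  shows "Ck_on k T (\<lambda>t. f t * g t)"
proof -
  have "Ck_on (enat m) T (\<lambda>t. f t * g t)" if "Ck_on (enat m) T f" "Ck_on (enat m) T g" for m f g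
    using that
  proof (induction m arbitrary: f g)
    case 0
    then show ?case by (auto simp: Ck_on_0 intro: continuous_intros)
  next
    case (Suc m)
    have "Ck_on (enat m) T f" "Ck_on (enat m) T g"
      using Suc.prems by (auto elim!: Ck_on_mono)
    then have "Ck_on (enat m) T (\<lambda>t. nderiv T 1 f t * g t + f t * nderiv T 1 g t)"
      using Suc by (intro Ck_on_add Suc.IH) (auto simp: Ck_on_Suc)
    then have "Ck_on (enat m) T (nderiv T 1 (\<lambda>t. f t * g t))"
      using Suc.prems
        Ck_on_cong[of T "nderiv T 1 (\<lambda>t. f t * g t)" "\<lambda>t. nderiv T 1 f t * g t + f t * nderiv T 1 g t" "enat m"]
      by (auto simp: Ck_on_Suc nderiv_mult)
    then show ?case using Suc.prems by (auto simp: Ck_on_Suc)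
  qed
  from this[OF Ck_on_mono[OF assms(1)] Ck_on_mono[OF assms(2)]] show ?thesis
    using Ck_on_iff_finite[of k T] by blast
qed

lemma Ck_on_uminus [intro]: "Ck_on k T f \<Longrightarrow> Ck_on k T (\<lambda>t. - f t)"
  using Ck_on_mult[of k "\<lambda>t. - 1" f] by simp

lemma Ck_on_diff [intro]: "Ck_on k T f \<Longrightarrow> Ck_on k T g \<Longrightarrow> Ck_on k T (\<lambda>t. f t - g t)"
  using Ck_on_add[of k f "\<lambda>t. - g t"] by auto

lemma Ck_on_sum [intro]:
  "(\<And>i. i \<in> I \<Longrightarrow> Ck_on k T (f i)) \<Longrightarrow> Ck_on k T (\<lambda>t. \<Sum>i\<in>I. f i t)"
  by (induction I rule: infinite_finite_induct) auto

lemma Ck_on_prod [intro]: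
  "(\<And>i. i \<in> I \<Longrightarrow> Ck_on k T (f i)) \<Longrightarrow> Ck_on k T (\<lambda>t. \<Prod>i\<in>I. f i t)"
  by (induction I rule: infinite_finite_induct) auto

lemma Ck_on_ident: "Ck_on k T (\<lambda>t. t)"
proof -
  have "Ck_on (enat m) T (\<lambda>t. t)" for m
  proof (cases m)
    case (Suc l)
    have "nderiv T 1 (\<lambda>t. t) t = 1" if "t \<in> T" for t
      using that by (intro nderiv_eqI) auto
    then have "Ck_on (enat l) T (nderiv T 1 (\<lambda>t. t))"
      using Ck_on_cong[of T "nderiv T 1 (\<lambda>t. t)" "\<lambda>t. 1" "enat l"] by simp
    then show ?thesis using Suc by (auto simp: Ck_on_Suc)
  qed (auto simp: Ck_on_0)
  then show ?thesis by (subst Ck_on_iff_finite) simp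
qed

lemma Ck_mat_carrier: "Ck_mat k T nr nc M \<Longrightarrow> t \<in> T \<Longrightarrow> M t \<in> carrier_mat nr nc"
  by (simp add: Ck_mat_def)

lemma Ck_mat_entry: "Ck_mat k T nr nc M \<Longrightarrow> i < nr \<Longrightarrow> j < nc \<Longrightarrow> Ck_on k T (\<lambda>t. M t $$ (i, j))"
  by (simp add: Ck_mat_def)

lemma Ck_matI:
  assumes "\<And>t. t \<in> T \<Longrightarrow> M t \<in> carrier_mat nr nc"
    and "\<And>t i j. t \<in> T \<Longrightarrow> i < nr \<Longrightarrow> j < nc \<Longrightarrow> M t $$ (i, j) = f i j t"
    and "\<And>i j. i < nr \<Longrightarrow> j < nc \<Longrightarrow> Ck_on k T (f i j)"
  shows "Ck_mat k T nr nc M"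
  unfolding Ck_mat_def
proof (intro conjI ballI allI impI)
  fix i j assume ij: "i < nr" "j < nc"
  show "Ck_on k T (\<lambda>t. M t $$ (i, j))"
    using Ck_on_cong[of T "\<lambda>t. M t $$ (i, j)" "f i j" k] assms(2)[OF _ ij] assms(3)[OF ij] by simp
qed (rule assms(1))

lemma Ck_mat_mult:
  assumes M: "Ck_mat k T nr m M" and N: "Ck_mat k T m nc N"
  shows "Ck_mat k T nr nc (\<lambda>t. M t * N t)"
proof (rule Ck_matI)
  show "M t * N t \<in> carrier_mat nr nc" if "t \<in> T" for t
    using assms that by (auto simp: Ck_mat_def)
  show "(M t * N t) $$ (i, j) = (\<Sum>l<m. M t $$ (i, l) * N t $$ (l, j))"
    if "t \<in> T" "i < nr" "j < nc" for t i j
    using Ck_mat_carrier[OF M \<open>t \<in> T\<close>] Ck_mat_carrier[OF N \<open>t \<in> T\<close>] that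
    by (simp add: scalar_prod_def atLeast0LessThan)
  show "Ck_on k T (\<lambda>t. \<Sum>l<m. M t $$ (i, l) * N t $$ (l, j))" if "i < nr" "j < nc" for i j
    using that by (intro Ck_on_sum Ck_on_mult Ck_mat_entry[OF M] Ck_mat_entry[OF N]) auto
qed

lemma Ck_mat_transpose: "Ck_mat k T nr nc M \<Longrightarrow> Ck_mat k T nc nr (\<lambda>t. transpose_mat (M t))"
  by (rule Ck_matI[where f = "\<lambda>i j t. M t $$ (j, i)"]) (auto simp: Ck_mat_def)

lemma Ck_mat_diff:
  "Ck_mat k T nr nc M \<Longrightarrow> Ck_mat k T nr nc N \<Longrightarrow> Ck_mat k T nr nc (\<lambda>t. M t - N t)"
  by (rule Ck_matI[where f = "\<lambda>i j t. M t $$ (i, j) - N t $$ (i, j)"])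
    (auto simp: Ck_mat_def minus_carrier_mat)

lemma Ck_on_det:
  assumes M: "Ck_mat k T n n M"
  shows "Ck_on k T (\<lambda>t. Determinant.det (M t))"
proof -
  have "Ck_on k T (\<lambda>t. \<Sum>p | p permutes {0..<n}. signof p * (\<Prod>i = 0..<n. M t $$ (i, p i)))"
    using Ck_mat_entry[OF M] by (intro Ck_on_sum Ck_on_mult Ck_on_prod) (auto simp: permutes_in_image)
  moreover have "Determinant.det (M t)
      = (\<Sum>p | p permutes {0..<n}. signof p * (\<Prod>i = 0..<n. M t $$ (i, p i)))" if "t \<in> T" for t
    using Ck_mat_carrier[OF M that] by (simp add: Determinant.det_def)
  ultimately show ?thesis by (subst Ck_on_cong) auto
qed

lemma Ck_mat_adj_mat:
  assumes M: "Ck_mat k T n n M"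
  shows "Ck_mat k T n n (\<lambda>t. adj_mat (M t))"
proof (rule Ck_matI)
  show "adj_mat (M t) \<in> carrier_mat n n" if "t \<in> T" for t
    using Ck_mat_carrier[OF M that] by (rule adj_mat)
  show "adj_mat (M t) $$ (i, j) = (- 1) ^ (j + i) * Determinant.det (mat_delete (M t) j i)"
    if "t \<in> T" "i < n" "j < n" for t i j
    using Ck_mat_carrier[OF M that(1)] that by (simp add: adj_mat_def cofactor_def)
  show "Ck_on k T (\<lambda>t. (- 1) ^ (j + i) * Determinant.det (mat_delete (M t) j i))"
    if "i < n" "j < n" for i j
  proof (intro Ck_on_mult Ck_on_const Ck_on_det)
    show "Ck_mat k T (n - 1) (n - 1) (\<lambda>t. mat_delete (M t) j i)"
    proof (rule Ck_matI)
      show "mat_delete (M t) j i \<in> carrier_mat (n - 1) (n - 1)" if "t \<in> T" for t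
        using Ck_mat_carrier[OF M that] by (auto simp: mat_delete_def)
      show "mat_delete (M t) j i $$ (r, c)
          = M t $$ (if r < j then r else Suc r, if c < i then c else Suc c)"
        if "t \<in> T" "r < n - 1" "c < n - 1" for t r c
        using Ck_mat_carrier[OF M that(1)] that by (simp add: mat_delete_def)
      show "Ck_on k T (\<lambda>t. M t $$ (if r < j then r else Suc r, if c < i then c else Suc c))"
        if "r < n - 1" "c < n - 1" for r c
        using that by (intro Ck_mat_entry[OF M]) auto
    qed
  qed
qed

end

unbundle no vec_syntax

section \<open>Ranks and kernels\<close>

lemma mult_mat_unit_vec:
  fixes A :: "real mat"
  assumes "A \<in> carrier_mat nr nc" "j < nc"
  shows "A *\<^sub>v unit_vec nc j = col A j"
  using assms by (intro eq_vecI) auto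

lemma square_det_nonzeroI:
  fixes N :: "real mat"
  assumes "N \<in> carrier_mat n n" "\<And>x. x \<in> carrier_vec n \<Longrightarrow> N *\<^sub>v x = 0\<^sub>v n \<Longrightarrow> x = 0\<^sub>v n"
  shows "Determinant.det N \<noteq> 0"
  using det_0_iff_vec_prod_zero_field[OF assms(1)] assms(2) by blast

lemma square_det_nonzeroD:
  fixes N :: "real mat"
  assumes "N \<in> carrier_mat n n" "Determinant.det N \<noteq> 0" "x \<in> carrier_vec n" "N *\<^sub>v x = 0\<^sub>v n"
  shows "x = 0\<^sub>v n"
  using det_0_iff_vec_prod_zero_field[OF assms(1)] assms by blast

lemma square_solvable:
  fixes N :: "real mat"
  assumes N: "N \<in> carrier_mat n n" and det: "Determinant.det N \<noteq> 0" and b: "b \<in> carrier_vec n"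
  shows "\<exists>x\<in>carrier_vec n. N *\<^sub>v x = b"
proof
  let ?x = "(1 / Determinant.det N) \<cdot>\<^sub>v (adj_mat N *\<^sub>v b)"
  note adj = adj_mat(1,2)[OF N]
  show "?x \<in> carrier_vec n" using adj b by simp
  have "N *\<^sub>v ?x = (1 / Determinant.det N) \<cdot>\<^sub>v ((N * adj_mat N) *\<^sub>v b)"
    using N adj(1) b by (simp add: mult_mat_vec assoc_mult_mat_vec[OF N adj(1) b])
  also have "(N * adj_mat N) *\<^sub>v b = Determinant.det N \<cdot>\<^sub>v b"
    unfolding adj(2) using b by (intro eq_vecI) auto
  finally show "N *\<^sub>v ?x = b" using det by (simp add: smult_smult_assoc)
qed

lemma invertible_det_nonzero:
  fixes N :: "real mat"
  assumes "invertible_mat N" "N \<in> carrier_mat n n"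
  shows "Determinant.det N \<noteq> 0"
proof -
  obtain B where B: "inverts_mat N B" "inverts_mat B N"
    using assms(1) by (auto simp: invertible_mat_def)
  have eq: "B * N = 1\<^sub>m (dim_row B)" "N * B = 1\<^sub>m n"
    using B assms(2) by (auto simp: inverts_mat_def)
  have "B \<in> carrier_mat n n"
    using arg_cong[OF eq(1), of dim_col] arg_cong[OF eq(2), of dim_col] assms(2) by auto
  then have "Determinant.det N * Determinant.det B = 1"
    using det_mult[OF assms(2), of B] unfolding eq(2) by simp
  then show ?thesis by auto
qed

lemma mat_rank_le_cols:
  assumes "A \<in> carrier_mat nr nc"
  shows "mat_rank A \<le> nc"
  using vec_space.rank_le_nc[of A nr nc] assms by (simp add: mat_rank_def)

lemma mat_rank_mult_le:
  assumes A: "A \<in> carrier_mat nr m" and B: "B \<in> carrier_mat m nc"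
  shows "mat_rank (A * B) \<le> mat_rank A"
proof -
  interpret vec_space "TYPE(real)" nr .
  have AB: "A * B \<in> carrier_mat nr nc" using assms by simp
  have cols: "set (cols A) \<subseteq> carrier_vec nr" "set (cols (A * B)) \<subseteq> carrier_vec nr"
    using cols_dim[of A] cols_dim[of "A * B"] A AB by auto
  have "y \<in> col_space A" if y: "y \<in> col_space (A * B)" for y
  proof -
    obtain x where x: "x \<in> carrier_vec nc" "(A * B) *\<^sub>v x = y"
      using y unfolding col_space_eq[OF AB] carrier_matD(2)[OF AB] by blast
    have "B *\<^sub>v x \<in> carrier_vec m" "A *\<^sub>v (B *\<^sub>v x) = y"
      using x B assoc_mult_mat_vec[OF A B x(1)] by simp_all
    moreover from this have "y \<in> carrier_vec nr" using A by force
    ultimately show ?thesis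
      unfolding col_space_eq[OF A] mem_Collect_eq using A by fastforce
  qed
  then have sub: "span (set (cols (A * B))) \<subseteq> span (set (cols A))"
    by (auto simp: col_space_def)
  have vs: "vectorspace class_ring (span_vs (set (cols A)))"
    by (rule subspace_is_vs[OF span_is_subspace]) (use cols in simp)
  have "VectorSpace.subspace class_ring (span (set (cols (A * B)))) (span_vs (set (cols A)))"
    by (rule nested_subspaces[OF span_is_subspace span_is_subspace sub]) (use cols in simp_all)
  from vectorspace.subspace_dim[OF vs this fin_dim_span_cols[OF A]] fin_dim_span_cols[OF AB]
  have "rank (A * B) \<le> rank A" by (simp add: rank_def)
  then show ?thesis
    using A AB by (simp only: mat_rank_def carrier_matD)
qed

lemma mat_rank_trivial_kernel:
  assumes A: "A \<in> carrier_mat nr nc"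
    and inj: "\<And>x. x \<in> carrier_vec nc \<Longrightarrow> A *\<^sub>v x = 0\<^sub>v nr \<Longrightarrow> x = 0\<^sub>v nc"
  shows "mat_rank A = nc"
proof -
  interpret vec_space "TYPE(real)" nr .
  have dist: "distinct (cols A)"
  proof (rule ccontr)
    assume "\<not> distinct (cols A)"
    then obtain i j where ij: "i < nc" "j < nc" "i \<noteq> j" "col A i = col A j"
      using A by (auto simp: distinct_conv_nth)
    let ?x = "unit_vec nc i - unit_vec nc j :: real Matrix.vec"
    have "A *\<^sub>v ?x = 0\<^sub>v nr"
      using A ij by (simp add: mult_minus_distrib_mat_vec mult_mat_unit_vec)
    then have "?x = 0\<^sub>v nc" by (intro inj) auto
    then have "vec_index ?x i = 0" using ij by simp
    then show False using ij by simp
  qed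
  have "lin_indpt (set (cols A))"
    using lin_depE[OF A _ dist] inj by blast
  then show ?thesis
    using lin_indpt_full_rank[OF A dist] A by (simp add: mat_rank_def)
qed

lemma mat_rank_factorization:
  assumes A: "A \<in> carrier_mat nr nc"
  obtains B C where "B \<in> carrier_mat nr (mat_rank A)" "C \<in> carrier_mat (mat_rank A) nc" "A = B * C"
proof -
  interpret vec_space "TYPE(real)" nr .
  have cols: "set (cols A) \<subseteq> carrier_vec nr" using cols_dim[of A] A by auto
  let ?P = "\<lambda>U. U \<subseteq> set (cols A) \<and> lin_indpt U"
  have "?P {}" by (simp add: finite_lin_indpt2)
  then obtain S where S: "maximal S ?P" "finite S"
    using maximal_exists_superset[of "set (cols A)" ?P "{}"] by blast
  then have SA: "S \<subseteq> set (cols A)" "lin_indpt S" by (auto simp: maximal_def)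
  have rank: "mat_rank A = card S"
    using rank_card_indpt[OF A S(1)] A by (simp add: mat_rank_def)
  obtain xs where xs: "set xs = S" "distinct xs" using finite_distinct_list[OF S(2)] by blast
  have len: "length xs = mat_rank A" using xs rank distinct_card by metis
  define B where "B = mat_of_cols nr xs"
  have B: "B \<in> carrier_mat nr (mat_rank A)" by (auto simp: B_def len)
  have colsB: "cols B = xs"
    unfolding B_def by (rule cols_mat_of_cols) (use SA xs cols in auto)
  have "\<exists>c\<in>carrier_vec (mat_rank A). B *\<^sub>v c = col A j" if "j < nc" for j
  proof -
    have colA: "col A j \<in> set (cols A)"
      using that A by (auto simp: cols_def)
    have "col A j \<in> span S"
    proof (cases "col A j \<in> S")
      case True
      then show ?thesis using SA cols by (meson in_own_span subsetD subset_trans)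
    next
      case False
      have "lin_dep (S \<union> {col A j})"
      proof (rule ccontr)
        assume "lin_indpt (S \<union> {col A j})"
        then have "S \<union> {col A j} = S"
          using S(1) SA colA unfolding maximal_def by blast
        then show False using False by blast
      qed
      then show ?thesis
        using lin_dep_iff_in_span[of S "col A j"] SA False cols colA by auto
    qed
    then have "col A j \<in> col_space B" by (simp add: col_space_def colsB xs)
    then show ?thesis unfolding col_space_eq[OF B] using B by auto
  qed
  then obtain c where c: "\<And>j. j < nc \<Longrightarrow> c j \<in> carrier_vec (mat_rank A)"
      "\<And>j. j < nc \<Longrightarrow> B *\<^sub>v c j = col A j"
    by metis
  define C where "C = Matrix.mat (mat_rank A) nc (\<lambda>(i, j). vec_index (c j) i)"
  have C: "C \<in> carrier_mat (mat_rank A) nc" by (simp add: C_def)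
  have colC: "col C j = c j" if "j < nc" for j
    using that c(1)[OF that] by (intro eq_vecI) (auto simp: C_def)
  have "A = B * C"
  proof (rule mat_col_eqI)
    fix j assume "j < dim_col (B * C)"
    then have "j < nc" using C by simp
    then show "col A j = col (B * C) j"
      by (simp only: col_mult2[OF B C] colC c(2))
  qed (use A B C in auto)
  with B C show ?thesis by (rule that)
qed

lemma mat_rank_transpose:
  assumes A: "A \<in> carrier_mat nr nc"
  shows "mat_rank (transpose_mat A) = mat_rank A"
proof -
  have le: "mat_rank (transpose_mat M) \<le> mat_rank M" if "M \<in> carrier_mat p q" for M p q
  proof -
    obtain B C where BC: "B \<in> carrier_mat p (mat_rank M)" "C \<in> carrier_mat (mat_rank M) q" "M = B * C"
      using mat_rank_factorization[OF \<open>M \<in> carrier_mat p q\<close>] .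
    have "transpose_mat M = transpose_mat C * transpose_mat B"
      unfolding BC(3) using BC(1,2) by (rule transpose_mult)
    then have "mat_rank (transpose_mat M) \<le> mat_rank (transpose_mat C)"
      using mat_rank_mult_le[of "transpose_mat C" q "mat_rank M" "transpose_mat B" p] BC(1,2) by simp
    also have "\<dots> \<le> mat_rank M" using mat_rank_le_cols[of "transpose_mat C"] BC(2) by simp
    finally show ?thesis .
  qed
  show ?thesis using le[OF A] le[of "transpose_mat A" nc nr] A by simp
qed

text \<open>
  A rank is computed by the number of free variables: \<open>S\<close> is a set of coordinates such that kernel
  vectors are determined by their entries in \<open>S\<close> (for the lower bound), and such that every unit
  vector on \<open>S\<close> extends to a kernel vector (for the upper bound).
\<close>

lemma column_selection:
  fixes nc :: nat
  assumes "S \<subseteq> {..<nc}"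
  obtains f where "bij_betw f {..<nc - card S} ({..<nc} - S)"
proof -
  have "card ({..<nc} - S) = nc - card S"
    using assms by (simp add: card_Diff_subset finite_subset)
  then show ?thesis
    using that ex_bij_betw_nat_finite[of "{..<nc} - S"] by (auto simp: atLeast0LessThan)
qed

lemma mat_rank_ge_free:
  assumes A: "A \<in> carrier_mat nr nc" and S: "S \<subseteq> {..<nc}"
    and inj: "\<And>x. x \<in> carrier_vec nc \<Longrightarrow> A *\<^sub>v x = 0\<^sub>v nr \<Longrightarrow> (\<And>i. i \<in> S \<Longrightarrow> vec_index x i = 0)
      \<Longrightarrow> x = 0\<^sub>v nc"
  shows "nc - card S \<le> mat_rank A"
proof -
  define c where "c = nc - card S"
  obtain f where f: "bij_betw f {..<c} ({..<nc} - S)"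
    using column_selection[OF S] unfolding c_def by blast
  have fnc: "f j < nc" "f j \<notin> S" if "j < c" for j
    using bij_betwE[OF f] that by auto
  have f_eq: "f i = f j \<longleftrightarrow> i = j" if "i < c" "j < c" for i j
    using bij_betw_imp_inj_on[OF f] that by (auto simp: inj_on_def)
  define P where "P = Matrix.mat nc c (\<lambda>(i, j). if i = f j then 1 else 0 :: real)"
  have P: "P \<in> carrier_mat nc c" by (simp add: P_def)
  have "mat_rank (A * P) = c"
  proof (rule mat_rank_trivial_kernel)
    show "A * P \<in> carrier_mat nr c" using A P by simp
    fix y assume y: "y \<in> carrier_vec c" "(A * P) *\<^sub>v y = 0\<^sub>v nr"
    have Py: "vec_index (P *\<^sub>v y) i = (\<Sum>j<c. if i = f j then vec_index y j else 0)" if "i < nc" for i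
      using that P y by (auto simp: P_def scalar_prod_def atLeast0LessThan intro!: sum.cong)
    have "P *\<^sub>v y = 0\<^sub>v nc"
    proof (rule inj)
      show "P *\<^sub>v y \<in> carrier_vec nc" using P y by simp
      show "A *\<^sub>v (P *\<^sub>v y) = 0\<^sub>v nr" using y by (simp flip: assoc_mult_mat_vec[OF A P y(1)])
      show "vec_index (P *\<^sub>v y) i = 0" if "i \<in> S" for i
      proof -
        have "i < nc" using S that by auto
        then show ?thesis using fnc(2) that by (auto simp: Py intro!: sum.neutral)
      qed
    qed
    moreover have "vec_index (P *\<^sub>v y) (f j) = vec_index y j" if "j < c" for j
    proof -
      have "vec_index (P *\<^sub>v y) (f j) = (\<Sum>l<c. if l = j then vec_index y l else 0)"
        unfolding Py[OF fnc(1)[OF that]] using f_eq that by (intro sum.cong) auto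
      then show ?thesis using that by simp
    qed
    ultimately show "y = 0\<^sub>v c" using y fnc by (intro eq_vecI) auto
  qed
  then show ?thesis using mat_rank_mult_le[OF A P] by (simp add: c_def)
qed

lemma mat_rank_le_free:
  assumes A: "A \<in> carrier_mat nr nc" and S: "S \<subseteq> {..<nc}"
    and ker: "\<And>i. i \<in> S \<Longrightarrow> \<exists>x\<in>carrier_vec nc. A *\<^sub>v x = 0\<^sub>v nr \<and> (\<forall>j\<in>S. vec_index x j = (if j = i then 1 else 0))"
  shows "mat_rank A \<le> nc - card S"
proof -
  define c where "c = nc - card S"
  obtain f where f: "bij_betw f {..<c} ({..<nc} - S)"
    using column_selection[OF S] unfolding c_def by blast
  obtain x where x: "\<And>i. i \<in> S \<Longrightarrow> x i \<in> carrier_vec nc" "\<And>i. i \<in> S \<Longrightarrow> A *\<^sub>v x i = 0\<^sub>v nr"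
      "\<And>i j. i \<in> S \<Longrightarrow> j \<in> S \<Longrightarrow> vec_index (x i) j = (if j = i then 1 else 0)"
    using ker by metis
  define P where "P = Matrix.mat nc c (\<lambda>(i, j). if i = f j then 1 else 0 :: real)"
  define q where "q l = unit_vec nc l - (if l \<in> S then x l else 0\<^sub>v nc)" for l
  define C where "C = Matrix.mat c nc (\<lambda>(j, l). vec_index (q l) (f j))"
  have PC: "P \<in> carrier_mat nc c" "C \<in> carrier_mat c nc" by (simp_all add: P_def C_def)
  have q: "q l \<in> carrier_vec nc" if "l < nc" for l using x(1) by (auto simp: q_def)
  have qS: "vec_index (q l) i = 0" if "l < nc" "i \<in> S" for l i
  proof -
    have "i < nc" using S that by auto
    then show ?thesis using that x by (auto simp: q_def carrier_vecD[OF x(1)])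
  qed
  have "col (P * C) l = q l" if l: "l < nc" for l
  proof (rule eq_vecI)
    fix i assume "i < dim_vec (q l)"
    then have i: "i < nc" using q[OF l] by simp
    have "vec_index (col (P * C) l) i = (\<Sum>j<c. if i = f j then vec_index (q l) (f j) else 0)"
      using i l PC by (auto simp: P_def C_def scalar_prod_def atLeast0LessThan intro!: sum.cong)
    also have "\<dots> = (\<Sum>m\<in>{..<nc} - S. if i = m then vec_index (q l) m else 0)"
      using sum.reindex_bij_betw[OF f, of "\<lambda>m. if i = m then vec_index (q l) m else 0"] by simp
    also have "\<dots> = vec_index (q l) i" using i qS[OF l] by auto
    finally show "vec_index (col (P * C) l) i = vec_index (q l) i" .
  qed (use q[OF l] PC in auto)
  then have "col (A * (P * C)) l = col A l" if "l < nc" for l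
  proof -
    have "col (A * (P * C)) l = A *\<^sub>v q l"
      using that \<open>\<And>l. l < nc \<Longrightarrow> col (P * C) l = q l\<close> A PC by (subst col_mult2) auto
    also have "\<dots> = A *\<^sub>v unit_vec nc l"
      using A x that by (auto simp: q_def mult_minus_distrib_mat_vec)
    finally show ?thesis using A that by (simp add: mult_mat_unit_vec)
  qed
  then have "A = A * (P * C)" using A PC by (intro mat_col_eqI) auto
  also have "\<dots> = (A * P) * C" using A PC by simp
  finally have "mat_rank A \<le> mat_rank (A * P)"
    using mat_rank_mult_le[of "A * P" nr c C nc] A PC by simp
  also have "\<dots> \<le> c" using mat_rank_le_cols[of "A * P" nr c] A PC by simp
  finally show ?thesis by (simp add: c_def)
qed

lemma left_kernel_trivial:
  assumes A: "A \<in> carrier_mat nr nc" and rank: "mat_rank A = nr"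
    and y: "y \<in> carrier_vec nr" "transpose_mat A *\<^sub>v y = 0\<^sub>v nc"
  shows "y = 0\<^sub>v nr"
proof (rule ccontr)
  assume "y \<noteq> 0\<^sub>v nr"
  then obtain i where i: "i < nr" "vec_index y i \<noteq> 0"
    using y(1) by (metis carrier_vecD eq_vecI index_zero_vec(1) index_zero_vec(2))
  have "mat_rank (transpose_mat A) \<le> nr - card {i}"
  proof (rule mat_rank_le_free)
    show "\<exists>x\<in>carrier_vec nr. transpose_mat A *\<^sub>v x = 0\<^sub>v nc
        \<and> (\<forall>l\<in>{i}. vec_index x l = (if l = j then 1 else 0))" if "j \<in> {i}" for j
    proof (intro bexI conjI)
      let ?x = "(1 / vec_index y i) \<cdot>\<^sub>v y"
      show "transpose_mat A *\<^sub>v ?x = 0\<^sub>v nc"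
        using A y mult_mat_vec[of "transpose_mat A" nc nr y] by (intro eq_vecI) auto
      show "\<forall>l\<in>{i}. vec_index ?x l = (if l = j then 1 else 0)" using i y that by auto
    qed (use y in simp)
  qed (use A i in auto)
  then show False using mat_rank_transpose[OF A] rank i by simp
qed

lemma mat_rank_left_free:
  assumes A: "A \<in> carrier_mat nr nc" and S: "S \<subseteq> {..<nr}"
    and inj: "\<And>y. y \<in> carrier_vec nr \<Longrightarrow> transpose_mat A *\<^sub>v y = 0\<^sub>v nc
      \<Longrightarrow> (\<And>i. i \<in> S \<Longrightarrow> vec_index y i = 0) \<Longrightarrow> y = 0\<^sub>v nr"
    and ker: "\<And>i. i \<in> S \<Longrightarrow> \<exists>y\<in>carrier_vec nr. transpose_mat A *\<^sub>v y = 0\<^sub>v nc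
      \<and> (\<forall>j\<in>S. vec_index y j = (if j = i then 1 else 0))"
  shows "mat_rank A = nr - card S"
proof -
  have AT: "transpose_mat A \<in> carrier_mat nc nr" using A by simp
  have "nr - card S \<le> mat_rank (transpose_mat A)"
    using AT S inj by (rule mat_rank_ge_free)
  moreover have "mat_rank (transpose_mat A) \<le> nr - card S"
    using AT S ker by (rule mat_rank_le_free)
  ultimately show ?thesis using mat_rank_transpose[OF A] by simp
qed

lemma mult_mat_vec_index_sum:
  fixes M :: "real mat"
  assumes "M \<in> carrier_mat nr nc" "x \<in> carrier_vec nc" "i < nr"
  shows "vec_index (M *\<^sub>v x) i = (\<Sum>j<nc. M $$ (i, j) * vec_index x j)"
  using assms by (auto simp: scalar_prod_def atLeast0LessThan)

lemma mult_transpose_vec_index_sum: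
  fixes M :: "real mat"
  assumes "M \<in> carrier_mat nr nc" "x \<in> carrier_vec nr" "j < nc"
  shows "vec_index (transpose_mat M *\<^sub>v x) j = (\<Sum>i<nr. M $$ (i, j) * vec_index x i)"
  using assms by (auto simp: scalar_prod_def atLeast0LessThan)

lemma left_kernel_iff:
  fixes M :: "real mat"
  assumes "M \<in> carrier_mat nr nc" "y \<in> carrier_vec nr"
  shows "transpose_mat M *\<^sub>v y = 0\<^sub>v nc \<longleftrightarrow> (\<forall>j<nc. (\<Sum>i<nr. M $$ (i, j) * vec_index y i) = 0)"
proof -
  have "transpose_mat M *\<^sub>v y = 0\<^sub>v nc \<longleftrightarrow> (\<forall>j<nc. vec_index (transpose_mat M *\<^sub>v y) j = 0)"
    using assms by (auto simp: vec_eq_iff)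
  then show ?thesis by (simp only: mult_transpose_vec_index_sum[OF assms] cong: conj_cong imp_cong)
qed

lemma right_kernel_iff:
  fixes M :: "real mat"
  assumes "M \<in> carrier_mat nr nc" "x \<in> carrier_vec nc"
  shows "M *\<^sub>v x = 0\<^sub>v nr \<longleftrightarrow> (\<forall>i<nr. (\<Sum>j<nc. M $$ (i, j) * vec_index x j) = 0)"
proof -
  have "M *\<^sub>v x = 0\<^sub>v nr \<longleftrightarrow> (\<forall>i<nr. vec_index (M *\<^sub>v x) i = 0)"
    using assms by (auto simp: vec_eq_iff)
  then show ?thesis by (simp only: mult_mat_vec_index_sum[OF assms] cong: conj_cong imp_cong)
qed

section \<open>Smooth kernel bases\<close>

lemma sum_lessThan_add:
  fixes f :: "nat \<Rightarrow> real"
  shows "(\<Sum>i<p + r. f i) = (\<Sum>i<p. f i) + (\<Sum>l<r. f (p + l))"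
  by (induction r) auto

context time_interval
begin

text \<open>
  If \<open>q - p\<close> coordinates can serve as free variables for the \<open>p\<close> homogeneous equations \<open>M t\<close> at
  every \<open>t\<close>, then the kernel of \<open>M\<close> has a basis as smooth as \<open>M\<close>. It consists of columns of the
  adjugate of the square matrix obtained by appending the unit rows of the free coordinates to \<open>M t\<close>;
  the adjugate is polynomial in the entries, so no smoothness of inverses is needed. The hypothesis \<open>rows\<close> says
  that the rows of \<open>M t\<close> stay independent when its free columns are deleted.
\<close>

lemma smooth_kernel_basis:
  assumes M: "Ck_mat k T p q M" and pq: "p \<le> q"
    and free: "inj_on \<rho> {..<q - p}" "\<rho> ` {..<q - p} \<subseteq> {..<q}"
    and rows: "\<And>t c. t \<in> T \<Longrightarrow> c \<in> carrier_vec p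
      \<Longrightarrow> (\<And>j. j < q \<Longrightarrow> j \<notin> \<rho> ` {..<q - p} \<Longrightarrow> vec_index (transpose_mat (M t) *\<^sub>v c) j = 0)
      \<Longrightarrow> c = 0\<^sub>v p"
  shows "\<exists>X \<delta>. Ck_mat k T q (q - p) X \<and> (\<forall>t\<in>T. M t * X t = 0\<^sub>m p (q - p) \<and> \<delta> t \<noteq> 0 \<and>
    (\<forall>i<q - p. \<forall>j<q - p. X t $$ (\<rho> i, j) = (if i = j then \<delta> t else 0)) \<and>
    (\<forall>x\<in>carrier_vec q. M t *\<^sub>v x = 0\<^sub>v p \<longrightarrow> (\<forall>i<q - p. vec_index x (\<rho> i) = 0) \<longrightarrow> x = 0\<^sub>v q))"
proof -
  define N where "N t = Matrix.mat q q (\<lambda>(i, j). if i < p then M t $$ (i, j)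
      else if j = \<rho> (i - p) then 1 else 0)" for t
  have Nc: "N t \<in> carrier_mat q q" for t by (simp add: N_def)
  have NCk: "Ck_mat k T q q N"
  proof (rule Ck_matI[where f = "\<lambda>i j t. if i < p then M t $$ (i, j) else if j = \<rho> (i - p) then 1 else 0"])
    show "Ck_on k T (\<lambda>t. if i < p then M t $$ (i, j) else if j = \<rho> (i - p) then 1 else 0)"
      if "j < q" for i j
      using Ck_mat_entry[OF M _ that] by (cases "i < p") simp_all
  qed (auto simp: N_def)
  have \<rho>: "\<rho> l < q" if "l < q - p" for l using free(2) that by auto
  have \<rho>_eq: "\<rho> i = \<rho> l \<longleftrightarrow> i = l" if "i < q - p" "l < q - p" for i l
    using free(1) that by (auto simp: inj_on_def)
  have N_top: "vec_index (N t *\<^sub>v x) i = vec_index (M t *\<^sub>v x) i"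
    if "t \<in> T" "x \<in> carrier_vec q" "i < p" for t x i
  proof -
    have "vec_index (N t *\<^sub>v x) i = (\<Sum>j<q. N t $$ (i, j) * vec_index x j)"
      using that pq by (intro mult_mat_vec_index_sum[OF Nc]) auto
    also have "\<dots> = (\<Sum>j<q. M t $$ (i, j) * vec_index x j)"
      using that pq by (intro sum.cong) (auto simp: N_def)
    also have "\<dots> = vec_index (M t *\<^sub>v x) i"
      using that by (intro mult_mat_vec_index_sum[OF Ck_mat_carrier[OF M], symmetric]) auto
    finally show ?thesis .
  qed
  have N_bottom: "vec_index (N t *\<^sub>v x) (p + l) = vec_index x (\<rho> l)"
    if "x \<in> carrier_vec q" "l < q - p" for t x l
  proof -
    have "vec_index (N t *\<^sub>v x) (p + l) = (\<Sum>j<q. N t $$ (p + l, j) * vec_index x j)"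
      using that by (intro mult_mat_vec_index_sum[OF Nc]) auto
    also have "\<dots> = (\<Sum>j<q. if j = \<rho> l then vec_index x j else 0)"
      using that by (intro sum.cong) (auto simp: N_def)
    finally show ?thesis using \<rho>[OF that(2)] by simp
  qed
  have det: "Determinant.det (N t) \<noteq> 0" if t: "t \<in> T" for t
  proof -
    have "Determinant.det (transpose_mat (N t)) \<noteq> 0"
    proof (rule square_det_nonzeroI)
      fix d assume d: "d \<in> carrier_vec q" "transpose_mat (N t) *\<^sub>v d = 0\<^sub>v q"
      define c where "c = Matrix.vec p (vec_index d)"
      have c: "c \<in> carrier_vec p" by (simp add: c_def)
      have split: "(\<Sum>i<q. N t $$ (i, j) * vec_index d i)
          = vec_index (transpose_mat (M t) *\<^sub>v c) j
            + (\<Sum>l<q - p. if j = \<rho> l then vec_index d (p + l) else 0)" if "j < q" for j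
      proof -
        have "(\<Sum>i<q. N t $$ (i, j) * vec_index d i)
            = (\<Sum>i<p. N t $$ (i, j) * vec_index d i)
              + (\<Sum>l<q - p. N t $$ (p + l, j) * vec_index d (p + l))"
          using sum_lessThan_add[of "\<lambda>i. N t $$ (i, j) * vec_index d i" p "q - p"] pq by simp
        also have "(\<Sum>i<p. N t $$ (i, j) * vec_index d i) = vec_index (transpose_mat (M t) *\<^sub>v c) j"
          using that pq by (subst mult_transpose_vec_index_sum[OF Ck_mat_carrier[OF M t] c])
            (auto simp: N_def c_def intro!: sum.cong)
        also have "(\<Sum>l<q - p. N t $$ (p + l, j) * vec_index d (p + l))
            = (\<Sum>l<q - p. if j = \<rho> l then vec_index d (p + l) else 0)"
          using that by (intro sum.cong) (auto simp: N_def)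
        finally show ?thesis .
      qed
      have zero: "(\<Sum>i<q. N t $$ (i, j) * vec_index d i) = 0" if "j < q" for j
        using arg_cong[OF d(2), of "\<lambda>v. vec_index v j"] that
        by (simp add: mult_transpose_vec_index_sum[OF Nc d(1)] del: index_mult_mat_vec)
      have "c = 0\<^sub>v p"
      proof (rule rows[OF t c])
        fix j assume j: "j < q" "j \<notin> \<rho> ` {..<q - p}"
        then have "(\<Sum>l<q - p. if j = \<rho> l then vec_index d (p + l) else 0) = 0"
          by (intro sum.neutral) auto
        then show "vec_index (transpose_mat (M t) *\<^sub>v c) j = 0"
          using split[OF j(1)] zero[OF j(1)] by simp
      qed
      moreover have bottom: "vec_index d (p + l) = 0" if "l < q - p" for l
      proof -
        have "(\<Sum>i<q - p. if \<rho> l = \<rho> i then vec_index d (p + i) else 0)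
            = (\<Sum>i<q - p. if i = l then vec_index d (p + i) else 0)"
          using \<rho>_eq that by (intro sum.cong) auto
        moreover have "transpose_mat (M t) *\<^sub>v 0\<^sub>v p = 0\<^sub>v q"
          using Ck_mat_carrier[OF M t] by (intro eq_vecI) auto
        ultimately show ?thesis
          using split[OF \<rho>[OF that]] zero[OF \<rho>[OF that]] \<open>c = 0\<^sub>v p\<close> that \<rho>[OF that] by simp
      qed
      moreover have "vec_index d i = vec_index c i" if "i < p" for i using that by (simp add: c_def)
      ultimately have "vec_index d i = 0" if "i < q" for i
        using that bottom[of "i - p"] by (cases "i < p") auto
      then show "d = 0\<^sub>v q" using d(1) by (intro eq_vecI) auto
    qed (use Nc in simp)
    then show ?thesis using det_transpose[OF Nc] by simp
  qed
  define X where "X t = Matrix.mat q (q - p) (\<lambda>(i, j). adj_mat (N t) $$ (i, p + j))" for t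
  have Xc: "X t \<in> carrier_mat q (q - p)" for t by (simp add: X_def)
  have NX: "N t *\<^sub>v col (X t) j = Determinant.det (N t) \<cdot>\<^sub>v unit_vec q (p + j)" if "j < q - p" for t j
  proof -
    have "col (X t) j = col (adj_mat (N t)) (p + j)"
      using that adj_mat(1)[OF Nc, of t] by (intro eq_vecI) (auto simp: X_def)
    then have "N t *\<^sub>v col (X t) j = col (N t * adj_mat (N t)) (p + j)"
      using that col_mult2[OF Nc adj_mat(1)[OF Nc, of t]] by simp
    then show ?thesis
      unfolding adj_mat(2)[OF Nc] using that by (intro eq_vecI) auto
  qed
  show ?thesis
  proof (rule exI[of _ X], rule exI[of _ "\<lambda>t. Determinant.det (N t)"], intro conjI ballI allI impI)
    show "Ck_mat k T q (q - p) X"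
      by (rule Ck_matI[where f = "\<lambda>i j t. adj_mat (N t) $$ (i, p + j)"])
        (use Ck_mat_entry[OF Ck_mat_adj_mat[OF NCk]] in \<open>auto simp: X_def\<close>)
    show "Determinant.det (N t) \<noteq> 0" if "t \<in> T" for t using that by (rule det)
    show "X t $$ (\<rho> i, j) = (if i = j then Determinant.det (N t) else 0)"
      if "i < q - p" "j < q - p" for t i j
    proof -
      have "col (X t) j \<in> carrier_vec q" using Xc[of t] by (simp add: carrier_vecI)
      from N_bottom[OF this that(1), of t]
      have "vec_index (col (X t) j) (\<rho> i)
          = vec_index (Determinant.det (N t) \<cdot>\<^sub>v unit_vec q (p + j)) (p + i)"
        unfolding NX[OF that(2)] by simp
      moreover have "vec_index (col (X t) j) (\<rho> i) = X t $$ (\<rho> i, j)"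
        using Xc[of t] \<rho>[OF that(1)] that(2) by simp
      ultimately show ?thesis using that by simp
    qed
    show "M t * X t = 0\<^sub>m p (q - p)" if t: "t \<in> T" for t
    proof (rule eq_matI)
      fix i j assume "i < dim_row (0\<^sub>m p (q - p))" "j < dim_col (0\<^sub>m p (q - p))"
      then have ij: "i < p" "j < q - p" by auto
      have "col (X t) j \<in> carrier_vec q" using Xc[of t] by (simp add: carrier_vecI)
      have "(M t * X t) $$ (i, j) = vec_index (M t *\<^sub>v col (X t) j) i"
        using ij Xc[of t] Ck_mat_carrier[OF M t] by auto
      also have "\<dots> = vec_index (N t *\<^sub>v col (X t) j) i"
        by (rule N_top[OF t \<open>col (X t) j \<in> carrier_vec q\<close> ij(1), symmetric])
      also have "\<dots> = 0" using NX[OF ij(2)] ij pq by simp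
      finally show "(M t * X t) $$ (i, j) = 0\<^sub>m p (q - p) $$ (i, j)" using ij by simp
    qed (use Xc[of t] Ck_mat_carrier[OF M t] in auto)
    show "x = 0\<^sub>v q" if t: "t \<in> T" and x: "x \<in> carrier_vec q" "M t *\<^sub>v x = 0\<^sub>v p"
      and free: "\<forall>i<q - p. vec_index x (\<rho> i) = 0" for t x
    proof (rule square_det_nonzeroD[OF Nc det[OF t] x(1)])
      show "N t *\<^sub>v x = 0\<^sub>v q"
      proof (rule eq_vecI)
        fix i assume "i < dim_vec (0\<^sub>v q)"
        then have i: "i < q" by simp
        show "vec_index (N t *\<^sub>v x) i = vec_index (0\<^sub>v q) i"
        proof (cases "i < p")
          case True
          then show ?thesis using N_top[OF t x(1) True] x(2) i by simp
        next
          case False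
          then have "vec_index (N t *\<^sub>v x) (p + (i - p)) = 0"
            using i free by (subst N_bottom[OF x(1)]) auto
          then show ?thesis using False i by simp
        qed
      qed (use Nc[of t] in simp)
    qed
  qed
qed

end

section \<open>The inflated coefficients for orders 0 and 1\<close>

lemma hconcat_carrier [simp]:
  "A \<in> carrier_mat nr nc \<Longrightarrow> B \<in> carrier_mat nr nd \<Longrightarrow> hconcat A B \<in> carrier_mat nr (nc + nd)"
  by (simp add: hconcat_def mat_of_cols_def)

lemma hconcat_left_kernel:
  fixes A B :: "real mat"
  assumes A: "A \<in> carrier_mat nr nc" and B: "B \<in> carrier_mat nr nd" and y: "y \<in> carrier_vec nr"
  shows "transpose_mat (hconcat A B) *\<^sub>v y = 0\<^sub>v (nc + nd)
    \<longleftrightarrow> transpose_mat A *\<^sub>v y = 0\<^sub>v nc \<and> transpose_mat B *\<^sub>v y = 0\<^sub>v nd"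
proof -
  have entA: "hconcat A B $$ (i, j) = A $$ (i, j)" if "i < nr" "j < nc" for i j
    using that A B by (auto simp: hconcat_def mat_of_cols_def nth_append)
  have entB: "hconcat A B $$ (i, nc + l) = B $$ (i, l)" if "i < nr" "l < nd" for i l
    using that A B by (auto simp: hconcat_def mat_of_cols_def nth_append)
  have "(\<forall>j<nc + nd. P j) \<longleftrightarrow> (\<forall>j<nc. P j) \<and> (\<forall>l<nd. P (nc + l))" for P
  proof (intro iffI allI impI; (elim conjE)?)
    fix j assume "\<forall>j<nc. P j" "\<forall>l<nd. P (nc + l)" "j < nc + nd"
    then show "P j" by (cases "j < nc") (auto dest: spec[of _ "j - nc"])
  qed auto
  then show ?thesis
    unfolding left_kernel_iff[OF hconcat_carrier[OF A B] y] left_kernel_iff[OF A y] left_kernel_iff[OF B y]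
    by (simp add: entA entB)
qed

lemma infl_E_carrier [simp]: "infl_E T n E A \<mu> t \<in> carrier_mat ((\<mu> + 1) * n) ((\<mu> + 1) * n)"
  by (simp add: infl_E_def block_array_def)

lemma infl_A_carrier [simp]: "infl_A T n A \<mu> t \<in> carrier_mat ((\<mu> + 1) * n) ((\<mu> + 1) * n)"
  by (simp add: infl_A_def block_array_def)

lemma infl_A_col_carrier [simp]: "infl_A_col T n A \<mu> t \<in> carrier_mat ((\<mu> + 1) * n) n"
  by (simp add: infl_A_col_def block_array_def)

lemma infl_A_first_columns:
  assumes "i < (\<mu> + 1) * n" "j < n"
  shows "infl_A T n A \<mu> t $$ (i, j) = infl_A_col T n A \<mu> t $$ (i, j)"
proof -
  have "j < (\<mu> + 1) * n" by (rule less_le_trans[OF assms(2)]) simp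
  with assms show ?thesis by (simp add: infl_A_def infl_A_col_def block_array_def)
qed

lemma mat_nderiv_entry:
  "M t \<in> carrier_mat nr nc \<Longrightarrow> i < nr \<Longrightarrow> j < nc
    \<Longrightarrow> mat_nderiv T m M t $$ (i, j) = nderiv T m (\<lambda>s. M s $$ (i, j)) t"
  by (simp add: mat_nderiv_def)

lemma mat_nderiv_0:
  "M t \<in> carrier_mat nr nc \<Longrightarrow> mat_nderiv T 0 M t = M t"
  by (intro eq_matI) (auto simp: mat_nderiv_def)

lemma mat_nderiv_dim [simp]:
  "dim_row (mat_nderiv T m M t) = dim_row (M t)" "dim_col (mat_nderiv T m M t) = dim_col (M t)"
  by (simp_all add: mat_nderiv_def)

lemma mat_nderiv_carrier:
  "M t \<in> carrier_mat nr nc \<Longrightarrow> mat_nderiv T m M t \<in> carrier_mat nr nc"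
  by (simp add: mat_nderiv_def)

lemma infl_0:
  assumes "E t \<in> carrier_mat n n" "A t \<in> carrier_mat n n"
  shows "infl_E T n E A 0 t = E t" "infl_A T n A 0 t = A t" "infl_A_col T n A 0 t = A t"
  using assms mat_nderiv_carrier[of E t n n T 0] mat_nderiv_carrier[of A t n n T 0]
  by (auto simp: infl_E_def infl_A_def infl_A_col_def block_array_def mat_nderiv_0 binomial_eq_0
      intro!: eq_matI)

lemma infl_E_1_entry:
  assumes "E t \<in> carrier_mat n n" "A t \<in> carrier_mat n n" "i < n" "j < n"
  shows "infl_E T n E A 1 t $$ (i, j) = E t $$ (i, j)"
    "infl_E T n E A 1 t $$ (i, n + j) = 0"
    "infl_E T n E A 1 t $$ (n + i, j) = mat_nderiv T 1 E t $$ (i, j) - A t $$ (i, j)"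
    "infl_E T n E A 1 t $$ (n + i, n + j) = E t $$ (i, j)"
  using assms mat_nderiv_carrier[of E t n n T] mat_nderiv_carrier[of A t n n T]
  by (simp_all add: infl_E_def block_array_def mat_nderiv_0 binomial_eq_0 div_add_self1)

lemma infl_A_col_1_entry:
  assumes "A t \<in> carrier_mat n n" "i < n" "j < n"
  shows "infl_A_col T n A 1 t $$ (i, j) = A t $$ (i, j)"
    "infl_A_col T n A 1 t $$ (n + i, j) = mat_nderiv T 1 A t $$ (i, j)"
  using assms by (simp_all add: infl_A_col_def block_array_def mat_nderiv_0 div_add_self1)

lemma infl_A_left_kernel:
  assumes "y \<in> carrier_vec ((\<mu> + 1) * n)"
  shows "transpose_mat (infl_A T n A \<mu> t) *\<^sub>v y = 0\<^sub>v ((\<mu> + 1) * n)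
    \<longleftrightarrow> transpose_mat (infl_A_col T n A \<mu> t) *\<^sub>v y = 0\<^sub>v n"
proof -
  have "infl_A T n A \<mu> t $$ (i, j) = 0" if "i < (\<mu> + 1) * n" "j < (\<mu> + 1) * n" "\<not> j < n" for i j
  proof -
    have "n > 0" using that by (cases n) auto
    with that have "i mod n < n" "j mod n < n" "j div n \<noteq> 0" by (auto simp: div_eq_0_iff)
    then show ?thesis using that by (simp add: infl_A_def block_array_def)
  qed
  then have "(\<Sum>i<(\<mu> + 1) * n. infl_A T n A \<mu> t $$ (i, j) * vec_index y i)
      = (if j < n then \<Sum>i<(\<mu> + 1) * n. infl_A_col T n A \<mu> t $$ (i, j) * vec_index y i else 0)"
    if "j < (\<mu> + 1) * n" for j
    using that by (auto simp: infl_A_first_columns simp del: add_mult_distrib)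
  then show ?thesis
    unfolding left_kernel_iff[OF infl_A_carrier assms] left_kernel_iff[OF infl_A_col_carrier assms]
    using less_le_trans[of _ n "(\<mu> + 1) * n"] by auto
qed

lemma infl_EA_left_kernel:
  assumes "y \<in> carrier_vec ((\<mu> + 1) * n)"
  shows "transpose_mat (infl_EA T n E A \<mu> t) *\<^sub>v y = 0\<^sub>v ((\<mu> + 1) * n + (\<mu> + 1) * n)
    \<longleftrightarrow> transpose_mat (infl_E T n E A \<mu> t) *\<^sub>v y = 0\<^sub>v ((\<mu> + 1) * n)
      \<and> transpose_mat (infl_A_col T n A \<mu> t) *\<^sub>v y = 0\<^sub>v n"
  unfolding infl_EA_def hconcat_left_kernel[OF infl_E_carrier infl_A_carrier assms] infl_A_left_kernel[OF assms]
  ..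

lemma infl_EA_carrier [simp]:
  "infl_EA T n E A \<mu> t \<in> carrier_mat ((\<mu> + 1) * n) ((\<mu> + 1) * n + (\<mu> + 1) * n)"
  unfolding infl_EA_def by (rule hconcat_carrier) simp_all

section \<open>A sufficient condition for the strangeness hypothesis\<close>

text \<open>
  Once the ranks are constant and \<open>Z\<close> is known, a smooth \<open>Ta\<close> comes from \<open>smooth_kernel_basis\<close>. The
  coordinates \<open>\<rho> 0, \<dots>, \<rho> (b - 1)\<close> parametrise the solutions \<open>x\<close> of the constraints
  \<open>Z\<^sup>T B x = 0\<close>, where \<open>B\<close> is the first block column of the inflated \<open>A\<close>: the first \<open>b - v\<close> of them
  are seen by \<open>E\<close>, the remaining \<open>v\<close> belong to components that do not occur in the equation. The
  assumption \<open>rows\<close> says that no combination of the constraints involves free coordinates only.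
\<close>

lemma (in time_interval) strangeness_hypI:
  assumes \<mu>: "enat \<mu> \<le> k" and ab: "a + b = n" and v: "v \<le> b"
    and rank_EA: "\<And>t. t \<in> T \<Longrightarrow> int (mat_rank (infl_EA T n E A \<mu> t)) = r"
    and corank_EA: "\<And>t. t \<in> T \<Longrightarrow> corank (infl_EA T n E A \<mu> t) -
           (if \<mu> = 0 then 0 else corank (infl_EA T n E A (\<mu> - 1) t)) = int v"
    and rank_E: "\<And>t. t \<in> T \<Longrightarrow> int (mat_rank (infl_E T n E A \<mu> t)) = r - int a"
    and smooth: "Ck_mat (k - enat \<mu>) T ((\<mu> + 1) * n) n (infl_A_col T n A \<mu>)"
    and Z: "Ck_mat (k - enat \<mu>) T ((\<mu> + 1) * n) a Z"
    and ZE: "\<And>t. t \<in> T \<Longrightarrow> transpose_mat (Z t) * infl_E T n E A \<mu> t = 0\<^sub>m a ((\<mu> + 1) * n)"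
    and \<rho>: "inj_on \<rho> {..<b}" "\<rho> ` {..<b} \<subseteq> {..<n}"
    and rows: "\<And>t c. t \<in> T \<Longrightarrow> c \<in> carrier_vec a
      \<Longrightarrow> (\<And>j. j < n \<Longrightarrow> j \<notin> \<rho> ` {..<b}
        \<Longrightarrow> vec_index (transpose_mat (infl_A_col T n A \<mu> t) *\<^sub>v (Z t *\<^sub>v c)) j = 0) \<Longrightarrow> c = 0\<^sub>v a"
    and Ec: "\<And>t. t \<in> T \<Longrightarrow> E t \<in> carrier_mat n n"
    and E_ker: "\<And>t x i. t \<in> T \<Longrightarrow> x \<in> carrier_vec n \<Longrightarrow> E t *\<^sub>v x = 0\<^sub>v n \<Longrightarrow> i < b - v
      \<Longrightarrow> vec_index x (\<rho> i) = 0"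
    and E_free: "\<And>t i. t \<in> T \<Longrightarrow> b - v \<le> i \<Longrightarrow> i < b \<Longrightarrow> E t *\<^sub>v unit_vec n (\<rho> i) = 0\<^sub>v n"
    and A_free: "\<And>t i. t \<in> T \<Longrightarrow> b - v \<le> i \<Longrightarrow> i < b
      \<Longrightarrow> infl_A_col T n A \<mu> t *\<^sub>v unit_vec n (\<rho> i) = 0\<^sub>v ((\<mu> + 1) * n)"
  shows "strangeness_hyp k T n E A \<mu>"
proof -
  let ?N = "(\<mu> + 1) * n"
  let ?B = "infl_A_col T n A \<mu>"
  have b: "n - a = b" using ab by simp
  have Zc: "Z t \<in> carrier_mat ?N a" if "t \<in> T" for t by (rule Ck_mat_carrier[OF Z that])
  define M where "M t = transpose_mat (Z t) * ?B t" for t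
  have Mc: "M t \<in> carrier_mat a n" if "t \<in> T" for t
    unfolding M_def by (rule mult_carrier_mat[OF _ infl_A_col_carrier]) (use Zc[OF that] in simp)
  have MT: "transpose_mat (M t) *\<^sub>v c = transpose_mat (?B t) *\<^sub>v (Z t *\<^sub>v c)"
    if "t \<in> T" "c \<in> carrier_vec a" for t c
  proof -
    have "transpose_mat (M t) = transpose_mat (?B t) * Z t"
      unfolding M_def using transpose_mult[of "transpose_mat (Z t)" a ?N "?B t" n] Zc[OF that(1)] by simp
    then show ?thesis
      using assoc_mult_mat_vec[of "transpose_mat (?B t)" n ?N "Z t" a c] Zc[OF that(1)] that(2) by simp
  qed
  have MCk: "Ck_mat (k - enat \<mu>) T a n M"
    unfolding M_def by (rule Ck_mat_mult[OF Ck_mat_transpose[OF Z] smooth])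
  have "a \<le> n" using ab by simp
  let ?basis = "\<lambda>X \<delta>. Ck_mat (k - enat \<mu>) T n b X \<and> (\<forall>t\<in>T. M t * X t = 0\<^sub>m a b \<and> \<delta> t \<noteq> 0 \<and>
      (\<forall>i<b. \<forall>j<b. X t $$ (\<rho> i, j) = (if i = j then \<delta> t else 0)) \<and>
      (\<forall>x\<in>carrier_vec n. M t *\<^sub>v x = 0\<^sub>v a \<longrightarrow> (\<forall>i<b. vec_index x (\<rho> i) = 0) \<longrightarrow> x = 0\<^sub>v n))"
  have "\<exists>X \<delta>. ?basis X \<delta>"
  proof (rule smooth_kernel_basis[OF MCk \<open>a \<le> n\<close>, unfolded b, OF \<rho>])
    show "c = 0\<^sub>v a" if "t \<in> T" "c \<in> carrier_vec a"
      "\<And>j. j < n \<Longrightarrow> j \<notin> \<rho> ` {..<b} \<Longrightarrow> vec_index (transpose_mat (M t) *\<^sub>v c) j = 0" for t c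
      using rows[OF that(1,2)] that(3) MT[OF that(1,2)] by simp
  qed
  then obtain Ta \<delta> where "?basis Ta \<delta>" by blast
  then have Ta: "Ck_mat (k - enat \<mu>) T n b Ta" "\<And>t. t \<in> T \<Longrightarrow> M t * Ta t = 0\<^sub>m a b"
      "\<And>t. t \<in> T \<Longrightarrow> \<delta> t \<noteq> 0"
      "\<And>t i j. t \<in> T \<Longrightarrow> i < b \<Longrightarrow> j < b \<Longrightarrow> Ta t $$ (\<rho> i, j) = (if i = j then \<delta> t else 0)"
      "\<And>t x. t \<in> T \<Longrightarrow> x \<in> carrier_vec n \<Longrightarrow> M t *\<^sub>v x = 0\<^sub>v a
        \<Longrightarrow> (\<And>i. i < b \<Longrightarrow> vec_index x (\<rho> i) = 0) \<Longrightarrow> x = 0\<^sub>v n"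
    by blast+
  have Tac: "Ta t \<in> carrier_mat n b" if "t \<in> T" for t by (rule Ck_mat_carrier[OF Ta(1) that])
  have \<rho>_less: "\<rho> i < n" if "i < b" for i using \<rho>(2) that by auto
  have \<rho>_eq: "\<rho> i = \<rho> j \<longleftrightarrow> i = j" if "i < b" "j < b" for i j
    using \<rho>(1) that by (auto simp: inj_on_def)
  have Ta_\<rho>: "vec_index (Ta t *\<^sub>v c) (\<rho> i) = \<delta> t * vec_index c i"
    if "t \<in> T" "c \<in> carrier_vec b" "i < b" for t c i
  proof -
    have "vec_index (Ta t *\<^sub>v c) (\<rho> i) = (\<Sum>j<b. Ta t $$ (\<rho> i, j) * vec_index c j)"
      by (rule mult_mat_vec_index_sum[OF Tac[OF that(1)] that(2) \<rho>_less[OF that(3)]])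
    also have "\<dots> = (\<Sum>j<b. if i = j then \<delta> t * vec_index c j else 0)"
      using that Ta(4) by (intro sum.cong) auto
    finally show ?thesis using that by simp
  qed
  have rank_Z: "mat_rank (Z t) = a" if t: "t \<in> T" for t
  proof (rule mat_rank_trivial_kernel[OF Zc[OF t]])
    fix c assume c: "c \<in> carrier_vec a" "Z t *\<^sub>v c = 0\<^sub>v ?N"
    have "vec_index (transpose_mat (?B t) *\<^sub>v 0\<^sub>v ?N) j = 0" if "j < n" for j
      using that by (subst mult_transpose_vec_index_sum[OF infl_A_col_carrier]) auto
    then show "c = 0\<^sub>v a" using rows[OF t c(1)] c(2) by simp
  qed
  have rank_Ta: "mat_rank (Ta t) = b" if t: "t \<in> T" for t
  proof (rule mat_rank_trivial_kernel[OF Tac[OF t]])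
    fix c assume c: "c \<in> carrier_vec b" "Ta t *\<^sub>v c = 0\<^sub>v n"
    have "vec_index c i = 0" if "i < b" for i
      using Ta_\<rho>[OF t c(1) that] c(2) Ta(3)[OF t] \<rho>_less[OF that] by simp
    then show "c = 0\<^sub>v b" using c(1) by (intro eq_vecI) auto
  qed
  have rank_ZA: "mat_rank (transpose_mat (Z t) * infl_A T n A \<mu> t) = a" if t: "t \<in> T" for t
  proof -
    have ZAc: "transpose_mat (Z t) * infl_A T n A \<mu> t \<in> carrier_mat a ?N"
      by (rule mult_carrier_mat[OF _ infl_A_carrier]) (use Zc[OF t] in simp)
    have "mat_rank (transpose_mat (transpose_mat (Z t) * infl_A T n A \<mu> t)) = a"
    proof (rule mat_rank_trivial_kernel)
      show "transpose_mat (transpose_mat (Z t) * infl_A T n A \<mu> t) \<in> carrier_mat ?N a"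
        using ZAc by simp
      fix c assume c: "c \<in> carrier_vec a"
        "transpose_mat (transpose_mat (Z t) * infl_A T n A \<mu> t) *\<^sub>v c = 0\<^sub>v ?N"
      have Zcc: "Z t *\<^sub>v c \<in> carrier_vec ?N" by (rule mult_mat_vec_carrier[OF Zc[OF t] c(1)])
      have "transpose_mat (transpose_mat (Z t) * infl_A T n A \<mu> t) = transpose_mat (infl_A T n A \<mu> t) * Z t"
        using transpose_mult[of "transpose_mat (Z t)" a ?N "infl_A T n A \<mu> t" ?N] Zc[OF t] by simp
      then have "transpose_mat (infl_A T n A \<mu> t) *\<^sub>v (Z t *\<^sub>v c) = 0\<^sub>v ?N"
        using c(2) assoc_mult_mat_vec[of "transpose_mat (infl_A T n A \<mu> t)" ?N ?N "Z t" a c] Zc[OF t] c(1)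
        by simp
      then have "transpose_mat (?B t) *\<^sub>v (Z t *\<^sub>v c) = 0\<^sub>v n"
        using infl_A_left_kernel[OF Zcc] by blast
      then show "c = 0\<^sub>v a" using rows[OF t c(1)] by simp
    qed
    then show ?thesis using mat_rank_transpose[OF ZAc] by simp
  qed
  have rank_ETa: "mat_rank (E t * Ta t) = b - v" if t: "t \<in> T" for t
  proof -
    have ETa: "E t * Ta t \<in> carrier_mat n b" using Ec[OF t] Tac[OF t] by simp
    have S: "{b - v..<b} \<subseteq> {..<b}" by auto
    have "b - card {b - v..<b} \<le> mat_rank (E t * Ta t)"
    proof (rule mat_rank_ge_free[OF ETa S])
      fix c assume c: "c \<in> carrier_vec b" "(E t * Ta t) *\<^sub>v c = 0\<^sub>v n"
        "\<And>i. i \<in> {b - v..<b} \<Longrightarrow> vec_index c i = 0"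
      have "vec_index c i = 0" if "i < b - v" for i
      proof -
        have "E t *\<^sub>v (Ta t *\<^sub>v c) = 0\<^sub>v n"
          using c(2) assoc_mult_mat_vec[OF Ec[OF t] Tac[OF t] c(1)] by simp
        moreover have "Ta t *\<^sub>v c \<in> carrier_vec n" by (rule mult_mat_vec_carrier[OF Tac[OF t] c(1)])
        ultimately have "vec_index (Ta t *\<^sub>v c) (\<rho> i) = 0" using E_ker[OF t] that by blast
        then show ?thesis using Ta_\<rho>[OF t c(1)] Ta(3)[OF t] that by simp
      qed
      then have "vec_index c i = 0" if "i < b" for i
        using c(3)[of i] that by (cases "i < b - v") auto
      then show "c = 0\<^sub>v b" using c(1) by (intro eq_vecI) auto
    qed
    moreover have "mat_rank (E t * Ta t) \<le> b - card {b - v..<b}"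
    proof (rule mat_rank_le_free[OF ETa S])
      fix i assume i: "i \<in> {b - v..<b}"
      then have ib: "i < b" by simp
      let ?u = "unit_vec n (\<rho> i) :: real Matrix.vec"
      have colc: "col (Ta t) i \<in> carrier_vec n" using Tac[OF t] by (simp add: carrier_vecI)
      have Mu: "M t *\<^sub>v ?u = 0\<^sub>v a"
        unfolding M_def using assoc_mult_mat_vec[of "transpose_mat (Z t)" a ?N "?B t" n ?u]
          A_free[OF t, of i] i Zc[OF t] by (auto intro!: eq_vecI)
      have MTa: "M t *\<^sub>v col (Ta t) i = 0\<^sub>v a"
        using col_mult2[OF Mc[OF t] Tac[OF t] ib] ib by (simp add: Ta(2)[OF t])
      \<comment> \<open>Both columns solve the constraints and agree in the free coordinates.\<close>
      have zero: "col (Ta t) i - \<delta> t \<cdot>\<^sub>v ?u = 0\<^sub>v n"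
      proof (rule Ta(5)[OF t])
        show "col (Ta t) i - \<delta> t \<cdot>\<^sub>v ?u \<in> carrier_vec n" using colc by simp
        have "M t *\<^sub>v (col (Ta t) i - \<delta> t \<cdot>\<^sub>v ?u) = M t *\<^sub>v col (Ta t) i - \<delta> t \<cdot>\<^sub>v (M t *\<^sub>v ?u)"
          using mult_minus_distrib_mat_vec[OF Mc[OF t] colc, of "\<delta> t \<cdot>\<^sub>v ?u"] mult_mat_vec[OF Mc[OF t], of ?u "\<delta> t"]
          by simp
        then show "M t *\<^sub>v (col (Ta t) i - \<delta> t \<cdot>\<^sub>v ?u) = 0\<^sub>v a"
          unfolding Mu MTa by (intro eq_vecI) auto
        show "vec_index (col (Ta t) i - \<delta> t \<cdot>\<^sub>v ?u) (\<rho> j) = 0" if "j < b" for j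
          using Ta(4)[OF t that ib] Tac[OF t] \<rho>_less[OF that] \<rho>_less[OF ib] ib that \<rho>_eq[OF that ib] by auto
      qed
      have "vec_index (col (Ta t) i) j = vec_index (\<delta> t \<cdot>\<^sub>v ?u) j" if "j < n" for j
        using arg_cong[OF zero, of "\<lambda>x. vec_index x j"] that by simp
      then have "col (Ta t) i = \<delta> t \<cdot>\<^sub>v ?u"
        using Tac[OF t] by (intro eq_vecI) auto
      then have "E t *\<^sub>v col (Ta t) i = 0\<^sub>v n"
        using mult_mat_vec[OF Ec[OF t], of ?u "\<delta> t"] E_free[OF t, of i] i by (auto intro!: eq_vecI)
      then have "(E t * Ta t) *\<^sub>v unit_vec b i = 0\<^sub>v n"
        by (simp only: mult_mat_unit_vec[OF ETa ib] col_mult2[OF Ec[OF t] Tac[OF t] ib])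
      then show "\<exists>x\<in>carrier_vec b. (E t * Ta t) *\<^sub>v x = 0\<^sub>v n
          \<and> (\<forall>j\<in>{b - v..<b}. vec_index x j = (if j = i then 1 else 0))"
        using ib by (intro bexI[of _ "unit_vec b i"]) auto
    qed
    ultimately show ?thesis using v by simp
  qed
  have exI2: "\<exists>Z Ta. P Z Ta" if "P Z Ta" for P using that by blast
  show ?thesis
    unfolding strangeness_hyp_def
  proof (rule conjI[OF \<mu>], rule exI[of _ r], rule exI[of _ a], rule exI[of _ "int v"],
      intro conjI ballI exI2)
    show "a \<le> n" by fact
    show "Ck_mat (k - enat \<mu>) T n (n - a) Ta" using Ta(1) by (simp only: b)
    fix t assume t: "t \<in> T"
    show "mat_rank (Ta t) = n - a" using rank_Ta[OF t] by (simp only: b)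
    show "transpose_mat (Z t) * infl_A_col T n A \<mu> t * Ta t = 0\<^sub>m a (n - a)"
      using Ta(2)[OF t] by (simp only: M_def b)
    show "int (mat_rank (E t * Ta t)) = int n - int a - int v"
      unfolding rank_ETa[OF t] using ab v by simp
  qed (fact rank_EA corank_EA rank_E Z rank_Z ZE rank_ZA)+
qed

section \<open>Pointwise linear algebra of the normal form\<close>

lemma sum_lessThan_eq_sum:
  fixes f :: "nat \<Rightarrow> real"
  assumes "I \<subseteq> {..<n}" "\<And>i. i < n \<Longrightarrow> i \<notin> I \<Longrightarrow> f i = 0"
  shows "(\<Sum>i<n. f i) = sum f I"
  using assms by (intro sum.mono_neutral_right) auto

text \<open>
  The values \<open>e\<close>, \<open>a\<close> of \<open>E\<close> and \<open>A = J - R - E K\<close> at one point and the values \<open>e'\<close>, \<open>a'\<close> of their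
  derivatives, as functions of the row and column index. The five blocks of indices are
  \<open>{..<n1}\<close>, \<open>{n1..<m}\<close>, \<open>{m..<s}\<close>, \<open>{s..<l}\<close> and \<open>{l..<n}\<close>; the fourth has the size \<open>n1\<close> of the first.
  The derivatives only inherit the zero blocks.
\<close>

locale block_pattern =
  fixes n1 n2 n3 n5 m s l n :: nat and e a e' a' :: "nat \<Rightarrow> nat \<Rightarrow> real"
  assumes m_def: "m = n1 + n2" and s_def: "s = m + n3" and l_def: "l = s + n1" and n_def: "n = l + n5"
    and e_zero: "\<And>i j. i < n \<Longrightarrow> j < n \<Longrightarrow> m \<le> i \<or> m \<le> j \<Longrightarrow> e i j = 0"
    and e'_zero: "\<And>i j. i < n \<Longrightarrow> j < n \<Longrightarrow> m \<le> i \<or> m \<le> j \<Longrightarrow> e' i j = 0"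
    and e_sym: "\<And>i j. i < n \<Longrightarrow> j < n \<Longrightarrow> e i j = e j i"
    and e_definite: "\<And>x i. (\<Sum>i<m. x i * (\<Sum>j<m. e i j * x j)) = 0 \<Longrightarrow> i < m \<Longrightarrow> x i = 0"
    and a_zero: "\<And>i j. i < n \<Longrightarrow> j < n \<Longrightarrow> l \<le> i \<or> l \<le> j \<or> n1 \<le> i \<and> s \<le> j \<or> s \<le> i \<and> n1 \<le> j
      \<Longrightarrow> a i j = 0"
    and a'_zero: "\<And>i j. i < n \<Longrightarrow> j < n \<Longrightarrow> l \<le> i \<or> l \<le> j \<or> n1 \<le> i \<and> s \<le> j \<or> s \<le> i \<and> n1 \<le> j
      \<Longrightarrow> a' i j = 0"
    and a33_rows: "\<And>y i. (\<And>j. j \<in> {m..<s} \<Longrightarrow> (\<Sum>i\<in>{m..<s}. a i j * y i) = 0) \<Longrightarrow> i \<in> {m..<s} \<Longrightarrow> y i = 0"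
    and a33_cols: "\<And>x j. (\<And>i. i \<in> {m..<s} \<Longrightarrow> (\<Sum>j\<in>{m..<s}. a i j * x j) = 0) \<Longrightarrow> j \<in> {m..<s} \<Longrightarrow> x j = 0"
    and a14_rows: "\<And>y i. (\<And>j. j \<in> {s..<l} \<Longrightarrow> (\<Sum>i<n1. a i j * y i) = 0) \<Longrightarrow> i < n1 \<Longrightarrow> y i = 0"
    and a14_cols: "\<And>x j. (\<And>i. i < n1 \<Longrightarrow> (\<Sum>j\<in>{s..<l}. a i j * x j) = 0) \<Longrightarrow> j \<in> {s..<l} \<Longrightarrow> x j = 0"
    and a41_rows: "\<And>y i. (\<And>j. j < n1 \<Longrightarrow> (\<Sum>i\<in>{s..<l}. a i j * y i) = 0) \<Longrightarrow> i \<in> {s..<l} \<Longrightarrow> y i = 0"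
    and a41_cols: "\<And>x j. (\<And>i. i \<in> {s..<l} \<Longrightarrow> (\<Sum>j<n1. a i j * x j) = 0) \<Longrightarrow> j < n1 \<Longrightarrow> x j = 0"
begin

lemma le: "n1 \<le> m" "m \<le> s" "s \<le> l" "l \<le> n"
  by (simp_all add: m_def s_def l_def n_def)

lemma e_sum:
  assumes "j < n"
  shows "(\<Sum>i<n. e i j * y i) = (\<Sum>i<m. e i j * y i)"
  by (rule sum_lessThan_eq_sum) (use le e_zero assms in auto)

lemma e_injective:
  assumes "\<And>j. j < m \<Longrightarrow> (\<Sum>i<n. e i j * y i) = 0" "i < m"
  shows "y i = 0"
proof (rule e_definite[OF _ assms(2)])
  have "(\<Sum>j<m. e i j * y j) = 0" if "i < m" for i
  proof -
    have "(\<Sum>j<m. e i j * y j) = (\<Sum>j<m. e j i * y j)"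
      using that le by (intro sum.cong) (auto simp: e_sym)
    then show ?thesis using assms(1)[OF that] e_sum[of i y] that le by simp
  qed
  then show "(\<Sum>i<m. y i * (\<Sum>j<m. e i j * y j)) = 0" by simp
qed

lemma e_injective_cols:
  assumes "\<And>i. i < m \<Longrightarrow> (\<Sum>j<n. e i j * x j) = 0" "j < m"
  shows "x j = 0"
proof (rule e_injective[OF _ assms(2)])
  fix i assume i: "i < m"
  have "(\<Sum>j<n. e j i * x j) = (\<Sum>j<n. e i j * x j)"
    using i le by (intro sum.cong) (auto simp: e_sym)
  then show "(\<Sum>j<n. e j i * x j) = 0" using assms(1)[OF i] by simp
qed

text \<open>
  The left kernel of the matrix \<open>[E 0; E' - A E]\<close> of the once differentiated equation: the vector
  with the parts \<open>y\<close> and \<open>w\<close> annihilates its columns.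
\<close>

definition left_kernel1 :: "(nat \<Rightarrow> real) \<Rightarrow> (nat \<Rightarrow> real) \<Rightarrow> bool" where
  "left_kernel1 y w \<longleftrightarrow>
     (\<forall>j<n. (\<Sum>i<n. e i j * y i) + (\<Sum>i<n. (e' i j - a i j) * w i) = 0) \<and>
     (\<forall>j<n. (\<Sum>i<n. e i j * w i) = 0)"

lemma left_kernel1_w_zero:
  assumes "left_kernel1 y w" "i < s"
  shows "w i = 0"
proof -
  have w12: "w i = 0" if "i < m" for i
    by (rule e_injective[OF _ that]) (use assms(1) le in \<open>auto simp: left_kernel1_def\<close>)
  have "w i = 0" if "i \<in> {m..<s}" for i
  proof (rule a33_rows[OF _ that])
    fix j assume j: "j \<in> {m..<s}"
    then have jn: "j < n" using le by simp
    have "(\<Sum>i<n. e i j * y i) = 0"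
      using j jn e_zero by (intro sum.neutral) auto
    moreover have "(\<Sum>i<n. (e' i j - a i j) * w i) = (\<Sum>i\<in>{m..<s}. (e' i j - a i j) * w i)"
      using j jn le w12 by (intro sum_lessThan_eq_sum) (auto simp: e'_zero a_zero)
    moreover have "\<dots> = (\<Sum>i\<in>{m..<s}. - (a i j * w i))"
      using j jn le by (intro sum.cong) (auto simp: e'_zero)
    ultimately show "(\<Sum>i\<in>{m..<s}. a i j * w i) = 0"
      using assms(1) jn by (auto simp: left_kernel1_def sum_negf)
  qed
  with w12 assms(2) show ?thesis by (cases "i < m") auto
qed

lemma left_kernel1_eq:
  assumes "left_kernel1 y w" "j < m"
  shows "(\<Sum>i<m. e i j * y i) = (\<Sum>i\<in>{s..<l}. a i j * w i)"
proof -
  have jn: "j < n" using assms(2) le by simp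
  have "(\<Sum>i<n. (e' i j - a i j) * w i) = (\<Sum>i\<in>{s..<l}. (e' i j - a i j) * w i)"
    using jn le left_kernel1_w_zero[OF assms(1)]
    by (intro sum_lessThan_eq_sum) (auto simp: e'_zero a_zero)
  moreover have "\<dots> = (\<Sum>i\<in>{s..<l}. - (a i j * w i))"
    using jn le by (intro sum.cong) (auto simp: e'_zero)
  ultimately show ?thesis
    using assms(1) jn e_sum[OF jn, of y] by (auto simp: left_kernel1_def sum_negf)
qed

text \<open>
  If in addition the left kernel vector annihilates the columns of \<open>[A; A']\<close> that belong to \<open>z1\<close>, \<open>z3\<close>
  and \<open>z4\<close>, then it lives on the rows of the void fifth equation. The crucial step is that column \<open>z4\<close>
  forces \<open>y1 = 0\<close>, so that \<open>y\<^sup>T E y\<close> reduces to a product with the vanishing block \<open>A42\<close>.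
\<close>

lemma left_kernel1_zero:
  assumes ker: "left_kernel1 y w"
    and cols: "\<And>j. j < l \<Longrightarrow> j < n1 \<or> m \<le> j \<Longrightarrow> (\<Sum>i<n. a i j * y i) + (\<Sum>i<n. a' i j * w i) = 0"
    and i: "i < l"
  shows "y i = 0" "w i = 0"
proof -
  have w0: "w i = 0" if "i < s" for i by (rule left_kernel1_w_zero[OF ker that])
  have a'_part: "(\<Sum>i<n. a' i j * w i) = 0" if "j < l" "n1 \<le> j" for j
  proof (intro sum.neutral ballI)
    fix i assume "i \<in> {..<n}"
    then show "a' i j * w i = 0"
      using that w0[of i] le a'_zero[of i j] by (cases "i < s") auto
  qed
  have y1: "y i = 0" if "i < n1" for i
  proof (rule a14_rows[OF _ that])
    fix j assume j: "j \<in> {s..<l}"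
    have "(\<Sum>i<n. a i j * y i) = (\<Sum>i<n1. a i j * y i)"
      using j le by (intro sum_lessThan_eq_sum) (auto simp: a_zero)
    then show "(\<Sum>i<n1. a i j * y i) = 0" using cols[of j] a'_part[of j] j le by auto
  qed
  have y12: "y i = 0" if "i < m" for i
  proof (rule e_definite[OF _ that])
    have "y j * (\<Sum>i<m. e j i * y i) = 0" if "j < m" for j
    proof (cases "j < n1")
      case False
      have "(\<Sum>i<m. e j i * y i) = (\<Sum>i<m. e i j * y i)"
        using that le by (intro sum.cong) (auto simp: e_sym)
      also have "\<dots> = (\<Sum>i\<in>{s..<l}. a i j * w i)" by (rule left_kernel1_eq[OF ker that])
      also have "\<dots> = 0" using False that le by (intro sum.neutral) (auto simp: a_zero)
      finally show ?thesis by simp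
    qed (simp add: y1)
    then show "(\<Sum>i<m. y i * (\<Sum>j<m. e i j * y j)) = 0" by (intro sum.neutral ballI) blast
  qed
  have w4: "w i = 0" if "i \<in> {s..<l}" for i
  proof (rule a41_rows[OF _ that])
    fix j assume "j < n1"
    then show "(\<Sum>i\<in>{s..<l}. a i j * w i) = 0"
      using left_kernel1_eq[OF ker, of j] y12 le by simp
  qed
  show "w i = 0" using w0[of i] w4[of i] i by (cases "i < s") auto
  have y3: "y i = 0" if "i \<in> {m..<s}" for i
  proof (rule a33_rows[OF _ that])
    fix j assume j: "j \<in> {m..<s}"
    have "(\<Sum>i<n. a i j * y i) = (\<Sum>i\<in>{m..<s}. a i j * y i)"
      using j le y12 by (intro sum_lessThan_eq_sum) (auto simp: a_zero)
    then show "(\<Sum>i\<in>{m..<s}. a i j * y i) = 0" using cols[of j] a'_part[of j] j le by auto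
  qed
  have y4: "y i = 0" if "i \<in> {s..<l}" for i
  proof (rule a41_rows[OF _ that])
    fix j assume j: "j < n1"
    have "y i = 0" if "i < s" for i using y12[of i] y3[of i] that by (cases "i < m") auto
    then have "(\<Sum>i<n. a i j * y i) = (\<Sum>i\<in>{s..<l}. a i j * y i)"
      using j le by (intro sum_lessThan_eq_sum) (auto simp: a_zero)
    moreover have "(\<Sum>i<n. a' i j * w i) = 0"
    proof (intro sum.neutral ballI)
      fix i assume "i \<in> {..<n}"
      then show "a' i j * w i = 0"
        using j le w0[of i] w4[of i] a'_zero[of i j] by (cases "i < l"; cases "i < s") auto
    qed
    ultimately show "(\<Sum>i\<in>{s..<l}. a i j * y i) = 0" using cols[of j] j le by auto
  qed
  show "y i = 0" using y12[of i] y3[of i] y4[of i] i by (cases "i < m"; cases "i < s") auto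
qed

lemma left_kernel0_zero:
  assumes "\<And>j. j < m \<Longrightarrow> (\<Sum>i<n. e i j * y i) = 0"
    and "\<And>j. j < l \<Longrightarrow> j < n1 \<or> m \<le> j \<Longrightarrow> (\<Sum>i<n. a i j * y i) = 0"
    and "i < l"
  shows "y i = 0"
proof (rule left_kernel1_zero(1)[of y "\<lambda>i. 0", OF _ _ assms(3)])
  have "(\<Sum>i<n. e i j * y i) = 0" if "j < n" for j
    using that assms(1)[of j] e_zero[of _ j] by (cases "j < m") (auto intro!: sum.neutral)
  then show "left_kernel1 y (\<lambda>i. 0)" by (simp add: left_kernel1_def)
qed (use assms(2) in simp)

text \<open>Conversely, only the first \<open>m\<close> columns impose conditions once \<open>w1\<close>, \<open>w2\<close> and \<open>w3\<close> vanish.\<close>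

lemma left_kernel1I:
  assumes "\<And>j. j < m \<Longrightarrow> (\<Sum>i<n. e i j * y i) + (\<Sum>i<n. (e' i j - a i j) * w i) = 0"
    and w: "\<And>i. i < s \<Longrightarrow> w i = 0"
  shows "left_kernel1 y w"
  unfolding left_kernel1_def
proof (intro conjI allI impI)
  fix j assume j: "j < n"
  show "(\<Sum>i<n. e i j * w i) = 0"
    unfolding e_sum[OF j] using w le by (intro sum.neutral) auto
  show "(\<Sum>i<n. e i j * y i) + (\<Sum>i<n. (e' i j - a i j) * w i) = 0"
  proof (cases "j < m")
    case False
    have "(e' i j - a i j) * w i = 0" if "i < n" for i
      using that j False le w[of i] by (cases "i < s") (auto simp: e'_zero a_zero)
    moreover have "e i j * y i = 0" if "i < n" for i using that j False e_zero by simp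
    ultimately have "(\<Sum>i<n. e i j * y i) = 0" "(\<Sum>i<n. (e' i j - a i j) * w i) = 0"
      by (simp_all add: sum.neutral)
    then show ?thesis by simp
  qed (use assms(1) in simp)
qed

lemma right_kernel_zero:
  assumes "\<And>i. i < n \<Longrightarrow> (\<Sum>j<n. a i j * x j) = 0" "\<And>j. j < m \<Longrightarrow> x j = 0" "j < l"
  shows "x j = 0"
proof -
  have x3: "x j = 0" if "j \<in> {m..<s}" for j
  proof (rule a33_cols[OF _ that])
    fix i assume i: "i \<in> {m..<s}"
    have "(\<Sum>j<n. a i j * x j) = (\<Sum>j\<in>{m..<s}. a i j * x j)"
      using i le assms(2) by (intro sum_lessThan_eq_sum) (auto simp: a_zero)
    then show "(\<Sum>j\<in>{m..<s}. a i j * x j) = 0" using assms(1)[of i] i le by simp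
  qed
  have x123: "x j = 0" if "j < s" for j using assms(2)[of j] x3[of j] that by (cases "j < m") auto
  have "x j = 0" if "j \<in> {s..<l}" for j
  proof (rule a14_cols[OF _ that])
    fix i assume i: "i < n1"
    have "(\<Sum>j<n. a i j * x j) = (\<Sum>j\<in>{s..<l}. a i j * x j)"
      using i le x123 by (intro sum_lessThan_eq_sum) (auto simp: a_zero)
    then show "(\<Sum>j\<in>{s..<l}. a i j * x j) = 0" using assms(1)[of i] i le by simp
  qed
  then show ?thesis using x123[of j] assms(3) by (cases "j < s") auto
qed

end

section \<open>The system in normal form\<close>

lemma sum_atLeastLessThan_shift:
  fixes f :: "nat \<Rightarrow> real"
  shows "(\<Sum>i\<in>{p..<p + r}. f i) = (\<Sum>i<r. f (p + i))"
  by (induction r) auto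

lemma invertible_cols:
  assumes "N \<in> carrier_mat p p" "invertible_mat (N :: real mat)"
    and "\<And>i. i < p \<Longrightarrow> (\<Sum>j<p. N $$ (i, j) * x j) = 0" "j < p"
  shows "x j = 0"
proof -
  have "N *\<^sub>v Matrix.vec p x = 0\<^sub>v p"
    using assms(3) by (subst right_kernel_iff[OF assms(1)]) auto
  then have "Matrix.vec p x = 0\<^sub>v p"
    using square_det_nonzeroD[OF assms(1) invertible_det_nonzero[OF assms(2,1)]] by simp
  from arg_cong[OF this, of "\<lambda>v. vec_index v j"] show ?thesis using assms(4) by simp
qed

lemma invertible_rows:
  assumes "N \<in> carrier_mat p p" "invertible_mat (N :: real mat)"
    and "\<And>j. j < p \<Longrightarrow> (\<Sum>i<p. N $$ (i, j) * y i) = 0" "i < p"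
  shows "y i = 0"
proof -
  have "transpose_mat N *\<^sub>v Matrix.vec p y = 0\<^sub>v p"
    using assms(3) by (subst left_kernel_iff[OF assms(1)]) auto
  moreover have "Determinant.det (transpose_mat N) \<noteq> 0"
    using invertible_det_nonzero[OF assms(2,1)] det_transpose[OF assms(1)] by simp
  ultimately have "Matrix.vec p y = 0\<^sub>v p"
    using square_det_nonzeroD[of "transpose_mat N" p] assms(1) by simp
  from arg_cong[OF this, of "\<lambda>v. vec_index v i"] show ?thesis using assms(4) by simp
qed

lemma zero_block_entry:
  assumes "zero_block d i j M"
    and "sum_list (take (i - 1) d) \<le> r" "r < sum_list (take (i - 1) d) + d ! (i - 1)"
    and "sum_list (take (j - 1) d) \<le> c" "c < sum_list (take (j - 1) d) + d ! (j - 1)"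
  shows "M $$ (r, c) = 0"
proof -
  have "block d i j M $$ (r - sum_list (take (i - 1) d), c - sum_list (take (j - 1) d)) = 0"
    using assms by (simp add: zero_block_def)
  then show ?thesis using assms by (simp add: block_def)
qed

text \<open>
  The fourth block has the size \<open>n1\<close>. The partial sums \<open>m\<close>, \<open>s\<close>, \<open>l\<close>, \<open>n\<close> of the block sizes are
  parameters of their own, so that index ranges are compared without unfolding them.
\<close>

locale normal_form_system = time_interval +
  fixes E J R K A :: "real \<Rightarrow> real mat" and n1 n2 n3 n5 m s l n :: nat and k :: enat
  assumes sizes: "m = n1 + n2" "s = m + n3" "l = s + n1" "n = l + n5"
    and A_def: "A = sys_mat E J R K"
    and k: "1 \<le> k"
    and E_smooth: "Ck_mat k T n n E" and J_smooth: "Ck_mat k T n n J"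
    and R_smooth: "Ck_mat k T n n R" and K_smooth: "Ck_mat k T n n K"
    and dHDAE: "dHDAE T n E J R K"
    and normal_form: "block_normal_form T [n1, n2, n3, n1, n5] E J R K"
begin

abbreviation "d \<equiv> [n1, n2, n3, n1, n5]"

lemma size_le: "n1 \<le> m" "m \<le> s" "s \<le> l" "l \<le> n"
  by (simp_all add: sizes)

lemma carriers:
  assumes "t \<in> T"
  shows "E t \<in> carrier_mat n n" "J t \<in> carrier_mat n n" "R t \<in> carrier_mat n n" "K t \<in> carrier_mat n n"
    "A t \<in> carrier_mat n n"
proof -
  show c: "E t \<in> carrier_mat n n" "J t \<in> carrier_mat n n" "R t \<in> carrier_mat n n" "K t \<in> carrier_mat n n"
    using E_smooth J_smooth R_smooth K_smooth assms by (auto simp: Ck_mat_def)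
  show "A t \<in> carrier_mat n n" unfolding A_def sys_mat_def using c by (intro minus_carrier_mat mult_carrier_mat)
qed

lemma A_smooth: "Ck_mat k T n n A"
  unfolding A_def sys_mat_def
  by (intro Ck_mat_diff Ck_mat_mult[of k n n] E_smooth J_smooth R_smooth K_smooth)

lemma A_entry:
  assumes "t \<in> T" "i < n" "j < n"
  shows "A t $$ (i, j) = J t $$ (i, j) - R t $$ (i, j) - (E t * K t) $$ (i, j)"
  using carriers[OF assms(1)] assms by (simp add: A_def sys_mat_def)

lemma block_index:
  assumes "r < n"
  shows "\<exists>i\<in>{1..5}. sum_list (take (i - 1) d) \<le> r \<and> r < sum_list (take (i - 1) d) + d ! (i - 1) \<and>
    (i = 1 \<longleftrightarrow> r < n1) \<and> (i \<le> 2 \<longleftrightarrow> r < m) \<and> (i \<le> 3 \<longleftrightarrow> r < s) \<and> (i \<le> 4 \<longleftrightarrow> r < l)"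
proof -
  consider "r < n1" | "n1 \<le> r" "r < m" | "m \<le> r" "r < s" | "s \<le> r" "r < l" | "l \<le> r" by linarith
  then show ?thesis
  proof cases
    case 1
    then show ?thesis by (intro bexI[of _ 1]) (auto simp: sizes)
  next
    case 2
    then show ?thesis by (intro bexI[of _ 2]) (auto simp: sizes numeral_eq_Suc One_nat_def)
  next
    case 3
    then show ?thesis by (intro bexI[of _ 3]) (auto simp: sizes numeral_eq_Suc One_nat_def)
  next
    case 4
    then show ?thesis by (intro bexI[of _ 4]) (auto simp: sizes numeral_eq_Suc One_nat_def)
  next
    case 5
    then show ?thesis using assms by (intro bexI[of _ 5]) (auto simp: sizes numeral_eq_Suc One_nat_def)
  qed
qed

lemma pattern:
  assumes "t \<in> T"
  shows "normal_form_pattern d (E t) (J t) (R t) (K t)"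
  using normal_form assms by (simp add: block_normal_form_def)

lemma E_zero:
  assumes t: "t \<in> T" and ij: "i < n" "j < n" "m \<le> i \<or> m \<le> j"
  shows "E t $$ (i, j) = 0"
proof -
  obtain bi where bi: "bi \<in> {1..5}" "sum_list (take (bi - 1) d) \<le> i" "i < sum_list (take (bi - 1) d) + d ! (bi - 1)"
      "bi \<le> 2 \<longleftrightarrow> i < m" using block_index[OF ij(1)] by blast
  obtain bj where bj: "bj \<in> {1..5}" "sum_list (take (bj - 1) d) \<le> j" "j < sum_list (take (bj - 1) d) + d ! (bj - 1)"
      "bj \<le> 2 \<longleftrightarrow> j < m" using block_index[OF ij(2)] by blast
  have "3 \<le> bi \<or> 3 \<le> bj" using bi(4) bj(4) ij(3) by linarith
  then have "zero_block d bi bj (E t)"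
    using pattern[OF t] bi(1) bj(1) unfolding normal_form_pattern_def by blast
  then show ?thesis by (rule zero_block_entry[OF _ bi(2,3) bj(2,3)])
qed

lemma K_zero:
  assumes t: "t \<in> T" and ij: "i < m" "j < n" "m \<le> j"
  shows "K t $$ (i, j) = 0"
proof -
  have "i < n" using ij size_le by simp
  from block_index[OF this] ij(1)
  obtain bi where bi: "bi \<in> {1..5}" "sum_list (take (bi - 1) d) \<le> i" "i < sum_list (take (bi - 1) d) + d ! (bi - 1)"
      "bi \<le> 2" by blast
  obtain bj where bj: "bj \<in> {1..5}" "sum_list (take (bj - 1) d) \<le> j" "j < sum_list (take (bj - 1) d) + d ! (bj - 1)"
      "bj \<le> 2 \<longleftrightarrow> j < m" using block_index[OF ij(2)] by blast
  have "bi = 1 \<or> bi = 2" "bj = 3 \<or> bj = 4 \<or> bj = 5"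
    using bi(1,4) bj(1,4) ij(3) unfolding atLeastAtMost_iff by linarith+
  then have "zero_block d bi bj (K t)"
    using pattern[OF t] unfolding normal_form_pattern_def by blast
  then show ?thesis by (rule zero_block_entry[OF _ bi(2,3) bj(2,3)])
qed

lemma JR_zero:
  assumes t: "t \<in> T" and ij: "i < n" "j < n" "l \<le> i \<or> l \<le> j \<or> n1 \<le> i \<and> s \<le> j \<or> s \<le> i \<and> n1 \<le> j"
  shows "J t $$ (i, j) = R t $$ (i, j)"
proof -
  obtain bi where bi: "bi \<in> {1..5}" "sum_list (take (bi - 1) d) \<le> i" "i < sum_list (take (bi - 1) d) + d ! (bi - 1)"
      "bi = 1 \<longleftrightarrow> i < n1" "bi \<le> 3 \<longleftrightarrow> i < s" "bi \<le> 4 \<longleftrightarrow> i < l" using block_index[OF ij(1)] by blast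
  obtain bj where bj: "bj \<in> {1..5}" "sum_list (take (bj - 1) d) \<le> j" "j < sum_list (take (bj - 1) d) + d ! (bj - 1)"
      "bj = 1 \<longleftrightarrow> j < n1" "bj \<le> 3 \<longleftrightarrow> j < s" "bj \<le> 4 \<longleftrightarrow> j < l" using block_index[OF ij(2)] by blast
  have "2 \<le> bi" if "n1 \<le> i" using bi(1,4) that by auto
  moreover have "4 \<le> bi" if "s \<le> i" using bi(5) that by auto
  moreover have "bi = 5" if "l \<le> i" using bi(1,6) that by auto
  moreover have "2 \<le> bj" if "n1 \<le> j" using bj(1,4) that by auto
  moreover have "4 \<le> bj" if "s \<le> j" using bj(5) that by auto
  moreover have "bj = 5" if "l \<le> j" using bj(1,6) that by auto
  ultimately have "bi = 5 \<or> bj = 5 \<or> 2 \<le> bi \<and> 4 \<le> bj \<or> 4 \<le> bi \<and> 2 \<le> bj"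
    using ij(3) by blast
  moreover have "bi = 1 \<or> bi = 2 \<or> bi = 3 \<or> bi = 4 \<or> bi = 5" "bj = 1 \<or> bj = 2 \<or> bj = 3 \<or> bj = 4 \<or> bj = 5"
    using bi(1) bj(1) unfolding atLeastAtMost_iff by presburger+
  ultimately have "(bi, bj) \<in> {(1,5), (2,4), (2,5), (3,4), (3,5), (4,2), (4,3), (4,4), (4,5),
                (5,1), (5,2), (5,3), (5,4), (5,5)}"
    by (elim disjE) simp_all
  from bspec[OF pattern[OF t, unfolded normal_form_pattern_def, THEN conjunct2, THEN conjunct1] this]
  have "zero_block d bi bj (J t - R t)" by simp
  from zero_block_entry[OF this bi(2,3) bj(2,3)] show ?thesis
    using carriers[OF t] ij by simp
qed

lemma EK_zero:
  assumes t: "t \<in> T" and ij: "i < n" "j < n" "m \<le> i \<or> m \<le> j"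
  shows "(E t * K t) $$ (i, j) = 0"
proof -
  have "E t $$ (i, q) * K t $$ (q, j) = 0" if "q < n" for q
    using E_zero[OF t ij(1) that] K_zero[OF t _ ij(2), of q] ij(3) by (cases "q < m") auto
  then show ?thesis
    using carriers[OF t] ij by (simp add: scalar_prod_def sum.neutral)
qed

lemma A_zero:
  assumes t: "t \<in> T" and ij: "i < n" "j < n" "l \<le> i \<or> l \<le> j \<or> n1 \<le> i \<and> s \<le> j \<or> s \<le> i \<and> n1 \<le> j"
  shows "A t $$ (i, j) = 0"
  using A_entry[OF t ij(1,2)] JR_zero[OF t ij] EK_zero[OF t ij(1,2)] ij(3) size_le by auto

lemma symmetric:
  assumes t: "t \<in> T" and ij: "i < n" "j < n"
  shows "E t $$ (i, j) = E t $$ (j, i)" "R t $$ (i, j) = R t $$ (j, i)"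
proof -
  have "transpose_mat (E t) = E t" "transpose_mat (R t) = R t"
    using dHDAE t by (auto simp: dHDAE_def pos_semidef_def)
  then show "E t $$ (i, j) = E t $$ (j, i)" "R t $$ (i, j) = R t $$ (j, i)"
    using carriers[OF t] ij by (metis carrier_matD index_transpose_mat(1))+
qed

lemma E_deriv_entry:
  assumes t: "t \<in> T" and ij: "i < n" "j < n"
  shows "nderiv T 1 (\<lambda>r. E r $$ (i, j)) t
      = (E t * K t) $$ (i, j) - J t $$ (i, j) + ((E t * K t) $$ (j, i) - J t $$ (j, i))"
proof -
  have "mat_nderiv T 1 E t = (E t * K t - J t) + transpose_mat (E t * K t - J t)"
    using dHDAE t by (simp add: dHDAE_def)
  from arg_cong[OF this, of "\<lambda>M. M $$ (i, j)"] show ?thesis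
    using carriers[OF t] ij by (simp add: mat_nderiv_entry)
qed

lemma leading22_entry:
  assumes "i < m" "j < m"
  shows "leading22 d M $$ (i, j) = M $$ (i, j)"
  using assms by (auto simp: leading22_def block_def sizes One_nat_def)

lemma leading_definite:
  assumes t: "t \<in> T" and zero: "(\<Sum>i<m. x i * (\<Sum>j<m. E t $$ (i, j) * x j)) = 0" and i: "i < m"
  shows "x i = 0"
proof -
  let ?L = "leading22 d (E t)" and ?x = "Matrix.vec m x"
  have L: "pos_def m ?L"
    using normal_form t by (auto simp: block_normal_form_def sizes One_nat_def)
  then have Lc: "?L \<in> carrier_mat m m" by (simp add: pos_def_def)
  have "vec_index (?L *\<^sub>v ?x) i = (\<Sum>j<m. E t $$ (i, j) * x j)" if "i < m" for i
    using that by (subst mult_mat_vec_index_sum[OF Lc]) (auto simp: leading22_entry)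
  then have "scalar_prod ?x (?L *\<^sub>v ?x) = 0"
    using zero Lc by (simp add: scalar_prod_def atLeast0LessThan del: index_mult_mat_vec)
  then have "?x = 0\<^sub>v m"
    using L unfolding pos_def_def by (metis less_irrefl vec_carrier)
  from arg_cong[OF this, of "\<lambda>v. vec_index v i"] show ?thesis using i by simp
qed

text \<open>The diagonal block \<open>A33\<close> of \<open>A\<close> is \<open>J33 - R33\<close>, since \<open>E K\<close> has no entries there.\<close>

lemma A33:
  assumes t: "t \<in> T"
  shows "\<exists>N\<in>carrier_mat n3 n3. invertible_mat N \<and> (\<forall>p<n3. \<forall>q<n3. N $$ (p, q) = A t $$ (m + p, m + q))"
proof (intro bexI conjI allI impI)
  show "block d 3 3 (J t - R t) \<in> carrier_mat n3 n3" by (simp add: block_def numeral_eq_Suc One_nat_def)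
  show "invertible_mat (block d 3 3 (J t - R t))"
    using normal_form t by (simp add: block_normal_form_def)
  show "block d 3 3 (J t - R t) $$ (p, q) = A t $$ (m + p, m + q)" if "p < n3" "q < n3" for p q
  proof -
    have "m + p < n" "m + q < n" using that by (simp_all add: sizes)
    then have "A t $$ (m + p, m + q) = (J t - R t) $$ (m + p, m + q)"
      using A_entry[OF t, of "m + p" "m + q"] EK_zero[OF t, of "m + p" "m + q"] carriers[OF t] by simp
    then show ?thesis
      using that by (simp add: block_def sizes numeral_eq_Suc One_nat_def)
  qed
qed

text \<open>One nonsingular matrix represents both \<open>A41\<close> and \<open>A14 = - A41\<^sup>T\<close>.\<close>

lemma A41:
  assumes t: "t \<in> T"
  shows "\<exists>N\<in>carrier_mat n1 n1. invertible_mat N \<and>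
    (\<forall>p<n1. \<forall>q<n1. N $$ (p, q) = A t $$ (s + p, q) \<and> N $$ (p, q) = - A t $$ (q, s + p))"
proof (intro bexI conjI allI impI)
  have nf: "zero_block d 1 4 (R t)" "zero_block d 4 1 (R t)"
      "block d 4 1 (J t) = - transpose_mat (block d 1 4 (J t))" "invertible_mat (block d 4 1 (J t))"
    using normal_form pattern[OF t] t unfolding block_normal_form_def normal_form_pattern_def by blast+
  show "block d 4 1 (J t) \<in> carrier_mat n1 n1" by (simp add: block_def numeral_eq_Suc One_nat_def)
  show "invertible_mat (block d 4 1 (J t))" by (rule nf)
  fix p q assume pq: "p < n1" "q < n1"
  then have in_n: "s + p < n" "q < n" by (simp_all add: sizes)
  have R0: "R t $$ (s + p, q) = 0" "R t $$ (q, s + p) = 0"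
    by (rule zero_block_entry[OF nf(2)] zero_block_entry[OF nf(1)];
        use pq in \<open>simp add: sizes numeral_eq_Suc One_nat_def\<close>)+
  have AJ: "A t $$ (s + p, q) = J t $$ (s + p, q)" "A t $$ (q, s + p) = J t $$ (q, s + p)"
    using A_entry[OF t in_n] A_entry[OF t in_n(2,1)] EK_zero[OF t in_n] EK_zero[OF t in_n(2,1)] R0 size_le
    by auto
  show eq: "block d 4 1 (J t) $$ (p, q) = A t $$ (s + p, q)"
    unfolding AJ using pq by (simp add: block_def sizes numeral_eq_Suc One_nat_def add.assoc)
  have "block d 4 1 (J t) $$ (p, q) = - block d 1 4 (J t) $$ (q, p)"
    unfolding nf(3) using pq by (simp add: block_def numeral_eq_Suc One_nat_def)
  then show "block d 4 1 (J t) $$ (p, q) = - A t $$ (q, s + p)"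
    unfolding AJ using pq by (simp add: block_def sizes numeral_eq_Suc One_nat_def add.assoc)
qed

lemma block_pattern_at:
  assumes t: "t \<in> T"
  shows "block_pattern n1 n2 n3 n5 m s l n (\<lambda>i j. E t $$ (i, j)) (\<lambda>i j. A t $$ (i, j))
    (\<lambda>i j. mat_nderiv T 1 E t $$ (i, j)) (\<lambda>i j. mat_nderiv T 1 A t $$ (i, j))"
proof
  obtain N3 where N3: "N3 \<in> carrier_mat n3 n3" "invertible_mat N3"
    "\<And>p q. p < n3 \<Longrightarrow> q < n3 \<Longrightarrow> N3 $$ (p, q) = A t $$ (m + p, m + q)" using A33[OF t] by blast
  obtain N4 where N4: "N4 \<in> carrier_mat n1 n1" "invertible_mat N4"
    "\<And>p q. p < n1 \<Longrightarrow> q < n1 \<Longrightarrow> N4 $$ (p, q) = A t $$ (s + p, q)"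
    "\<And>p q. p < n1 \<Longrightarrow> q < n1 \<Longrightarrow> N4 $$ (p, q) = - A t $$ (q, s + p)" using A41[OF t] by blast
  have shift3: "(\<Sum>i\<in>{m..<s}. f i) = (\<Sum>p<n3. f (m + p))" for f :: "nat \<Rightarrow> real"
    unfolding sizes(2) by (rule sum_atLeastLessThan_shift)
  have shift4: "(\<Sum>i\<in>{s..<l}. f i) = (\<Sum>p<n1. f (s + p))" for f :: "nat \<Rightarrow> real"
    unfolding sizes(3) by (rule sum_atLeastLessThan_shift)
  show "m = n1 + n2" "s = m + n3" "l = s + n1" "n = l + n5" by (rule sizes)+
  show "E t $$ (i, j) = 0" if "i < n" "j < n" "m \<le> i \<or> m \<le> j" for i j
    using t that by (rule E_zero)
  show "mat_nderiv T 1 E t $$ (i, j) = 0" if "i < n" "j < n" "m \<le> i \<or> m \<le> j" for i j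
    unfolding mat_nderiv_entry[where M = E, OF carriers(1)[OF t] that(1,2)] using E_zero that t by (intro nderiv_zero) auto
  show "E t $$ (i, j) = E t $$ (j, i)" if "i < n" "j < n" for i j
    using t that by (rule symmetric)
  show "x i = 0" if "(\<Sum>i<m. x i * (\<Sum>j<m. E t $$ (i, j) * x j)) = 0" "i < m" for x i
    using t that by (rule leading_definite)
  show "A t $$ (i, j) = 0"
    if "i < n" "j < n" "l \<le> i \<or> l \<le> j \<or> n1 \<le> i \<and> s \<le> j \<or> s \<le> i \<and> n1 \<le> j" for i j
    using t that by (rule A_zero)
  show "mat_nderiv T 1 A t $$ (i, j) = 0"
    if "i < n" "j < n" "l \<le> i \<or> l \<le> j \<or> n1 \<le> i \<and> s \<le> j \<or> s \<le> i \<and> n1 \<le> j" for i j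
    unfolding mat_nderiv_entry[where M = A, OF carriers(5)[OF t] that(1,2)] using A_zero that t by (intro nderiv_zero) auto
  show "y i = 0" if "\<And>j. j \<in> {m..<s} \<Longrightarrow> (\<Sum>i\<in>{m..<s}. A t $$ (i, j) * y i) = 0" "i \<in> {m..<s}" for y i
  proof -
    have "y (m + (i - m)) = 0"
    proof (rule invertible_rows[OF N3(1,2), of "\<lambda>p. y (m + p)"])
      show "(\<Sum>i<n3. N3 $$ (i, j) * y (m + i)) = 0" if "j < n3" for j
      proof -
        have "m + j \<in> {m..<s}" using that by (simp add: sizes(2))
        then have "(\<Sum>i\<in>{m..<s}. A t $$ (i, m + j) * y i) = 0" by fact
        then show ?thesis using that by (simp add: shift3 N3(3))
      qed
      show "i - m < n3" using that(2) by (auto simp: sizes(2))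
    qed
    then show ?thesis using that(2) by simp
  qed
  show "x j = 0" if "\<And>i. i \<in> {m..<s} \<Longrightarrow> (\<Sum>j\<in>{m..<s}. A t $$ (i, j) * x j) = 0" "j \<in> {m..<s}" for x j
  proof -
    have "x (m + (j - m)) = 0"
    proof (rule invertible_cols[OF N3(1,2), of "\<lambda>p. x (m + p)"])
      show "(\<Sum>j<n3. N3 $$ (i, j) * x (m + j)) = 0" if "i < n3" for i
      proof -
        have "m + i \<in> {m..<s}" using that by (simp add: sizes(2))
        then have "(\<Sum>j\<in>{m..<s}. A t $$ (m + i, j) * x j) = 0" by fact
        then show ?thesis using that by (simp add: shift3 N3(3))
      qed
      show "j - m < n3" using that(2) by (auto simp: sizes(2))
    qed
    then show ?thesis using that(2) by simp
  qed
  show "y i = 0" if "\<And>j. j \<in> {s..<l} \<Longrightarrow> (\<Sum>i<n1. A t $$ (i, j) * y i) = 0" "i < n1" for y i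
  proof (rule invertible_cols[OF N4(1,2) _ that(2)])
    show "(\<Sum>j<n1. N4 $$ (i, j) * y j) = 0" if "i < n1" for i
      using \<open>\<And>j. j \<in> {s..<l} \<Longrightarrow> _ j = 0\<close>[of "s + i"] that by (simp add: N4(4) sizes(3) sum_negf)
  qed
  show "x j = 0" if "\<And>i. i < n1 \<Longrightarrow> (\<Sum>j\<in>{s..<l}. A t $$ (i, j) * x j) = 0" "j \<in> {s..<l}" for x j
  proof -
    have "x (s + (j - s)) = 0"
    proof (rule invertible_rows[OF N4(1,2), of "\<lambda>p. x (s + p)"])
      show "(\<Sum>i<n1. N4 $$ (i, j) * x (s + i)) = 0" if "j < n1" for j
        using \<open>\<And>i. i < n1 \<Longrightarrow> _ i = 0\<close>[of j] that by (simp add: shift4 N4(4) sum_negf)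
      show "j - s < n1" using that(2) by (auto simp: sizes(3))
    qed
    then show ?thesis using that(2) by simp
  qed
  show "y i = 0" if "\<And>j. j < n1 \<Longrightarrow> (\<Sum>i\<in>{s..<l}. A t $$ (i, j) * y i) = 0" "i \<in> {s..<l}" for y i
  proof -
    have "y (s + (i - s)) = 0"
    proof (rule invertible_rows[OF N4(1,2), of "\<lambda>p. y (s + p)"])
      show "(\<Sum>i<n1. N4 $$ (i, j) * y (s + i)) = 0" if "j < n1" for j
        using \<open>\<And>j. j < n1 \<Longrightarrow> _ j = 0\<close>[of j] that by (simp add: shift4 N4(3))
      show "i - s < n1" using that(2) by (auto simp: sizes(3))
    qed
    then show ?thesis using that(2) by simp
  qed
  show "x j = 0" if "\<And>i. i \<in> {s..<l} \<Longrightarrow> (\<Sum>j<n1. A t $$ (i, j) * x j) = 0" "j < n1" for x j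
  proof (rule invertible_cols[OF N4(1,2) _ that(2)])
    show "(\<Sum>j<n1. N4 $$ (i, j) * x j) = 0" if "i < n1" for i
      using \<open>\<And>i. i \<in> {s..<l} \<Longrightarrow> _ i = 0\<close>[of "s + i"] that by (simp add: N4(3) sizes(3))
  qed
qed

end

section \<open>Uniqueness of solutions and free components\<close>

context normal_form_system
begin

text \<open>The initial value problem of the system at hand.\<close>

definition solves :: "real Matrix.vec \<Rightarrow> (real \<Rightarrow> real Matrix.vec) \<Rightarrow> bool" where
  "solves z0 z \<longleftrightarrow> solves_ivp t0 tf n E A z0 z"

lemma solves_iff:
  "solves z0 z \<longleftrightarrow> (\<forall>t\<in>T. z t \<in> carrier_vec n) \<and> (\<forall>i<n. Ck_on 1 T (\<lambda>t. vec_index (z t) i)) \<and> z t0 = z0 \<and>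
    (\<forall>t\<in>T. \<forall>i<n. (\<Sum>j<n. E t $$ (i, j) * nderiv T 1 (\<lambda>r. vec_index (z r) j) t)
      = (\<Sum>j<n. A t $$ (i, j) * vec_index (z t) j))"
proof -
  have "E t *\<^sub>v vec_deriv T z t = A t *\<^sub>v z t \<longleftrightarrow>
      (\<forall>i<n. (\<Sum>j<n. E t $$ (i, j) * nderiv T 1 (\<lambda>r. vec_index (z r) j) t)
      = (\<Sum>j<n. A t $$ (i, j) * vec_index (z t) j))" if t: "t \<in> T" and zc: "z t \<in> carrier_vec n" for t
  proof -
    have dc: "vec_deriv T z t \<in> carrier_vec n" using zc by (simp add: vec_deriv_def)
    have "E t *\<^sub>v vec_deriv T z t = A t *\<^sub>v z t \<longleftrightarrow>
      (\<forall>i<n. vec_index (E t *\<^sub>v vec_deriv T z t) i = vec_index (A t *\<^sub>v z t) i)"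
      using carriers[OF t] by (auto simp: vec_eq_iff)
    also have "\<dots> \<longleftrightarrow> (\<forall>i<n. (\<Sum>j<n. E t $$ (i, j) * vec_index (vec_deriv T z t) j)
      = (\<Sum>j<n. A t $$ (i, j) * vec_index (z t) j))"
      by (simp only: mult_mat_vec_index_sum[OF carriers(1)[OF t] dc] mult_mat_vec_index_sum[OF carriers(5)[OF t] zc]
        cong: imp_cong)
    finally show ?thesis using zc by (simp add: vec_deriv_def)
  qed
  then show ?thesis
    unfolding solves_def solves_ivp_def Ck_vec_def T_def[symmetric] by auto
qed

text \<open>
  The energy \<open>u\<^sup>T E u\<close> of a solution \<open>u\<close> of the homogeneous equation has the derivative
  \<open>- 2 u\<^sup>T R u\<close>: this is what skew-adjointness of \<open>E d/dt - (J - E K)\<close> says.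
\<close>

lemma energy_derivative:
  assumes t: "t \<in> T" and u: "\<And>i. i < n \<Longrightarrow> u i differentiable_on T"
    and eq: "\<And>i. i < n \<Longrightarrow> (\<Sum>j<n. E t $$ (i, j) * nderiv T 1 (u j) t) = (\<Sum>j<n. A t $$ (i, j) * u j t)"
  shows "((\<lambda>r. \<Sum>i<n. \<Sum>j<n. u i r * E r $$ (i, j) * u j r) has_real_derivative
      - 2 * (\<Sum>i<n. \<Sum>j<n. u i t * R t $$ (i, j) * u j t)) (at t within T)"
proof -
  define D where "D i = nderiv T 1 (u i) t" for i
  define F where "F i j = (E t * K t) $$ (i, j) - J t $$ (i, j)" for i j
  define x where "x i = u i t" for i
  have Ed: "((\<lambda>r. E r $$ (i, j)) has_real_derivative F i j + F j i) (at t within T)"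
    if "i < n" "j < n" for i j
    using nderiv_has_real_derivative[OF Ck_on_differentiable[OF Ck_mat_entry[OF E_smooth that] k] t]
      E_deriv_entry[OF t that] by (simp add: F_def)
  have ud: "(u i has_real_derivative D i) (at t within T)" if "i < n" for i
    unfolding D_def by (rule nderiv_has_real_derivative[OF u[OF that] t])
  have "((\<lambda>r. \<Sum>i<n. \<Sum>j<n. u i r * E r $$ (i, j) * u j r) has_real_derivative
      (\<Sum>i<n. \<Sum>j<n. (D i * E t $$ (i, j) + x i * (F i j + F j i)) * x j + x i * E t $$ (i, j) * D j)) (at t within T)"
  proof (intro DERIV_sum)
    fix i j assume "i \<in> {..<n}" "j \<in> {..<n}"
    then have ij: "i < n" "j < n" by auto
    show "((\<lambda>r. u i r * E r $$ (i, j) * u j r) has_real_derivative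
        (D i * E t $$ (i, j) + x i * (F i j + F j i)) * x j + x i * E t $$ (i, j) * D j) (at t within T)"
      using DERIV_mult[OF DERIV_mult[OF ud[OF ij(1)] Ed[OF ij]] ud[OF ij(2)]]
      by (simp add: x_def algebra_simps)
  qed
  moreover have "(\<Sum>i<n. \<Sum>j<n. (D i * E t $$ (i, j) + x i * (F i j + F j i)) * x j + x i * E t $$ (i, j) * D j)
      = - 2 * (\<Sum>i<n. \<Sum>j<n. x i * R t $$ (i, j) * x j)"
  proof -
    have EA: "(\<Sum>i<n. \<Sum>j<n. x i * E t $$ (i, j) * D j) = (\<Sum>i<n. \<Sum>j<n. x i * A t $$ (i, j) * x j)"
    proof (rule sum.cong)
      fix i assume "i \<in> {..<n}"
      then have "x i * (\<Sum>j<n. E t $$ (i, j) * D j) = x i * (\<Sum>j<n. A t $$ (i, j) * x j)"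
        using eq[of i] by (simp add: D_def x_def)
      then show "(\<Sum>j<n. x i * E t $$ (i, j) * D j) = (\<Sum>j<n. x i * A t $$ (i, j) * x j)"
        by (simp add: sum_distrib_left mult.assoc)
    qed simp
    have "(\<Sum>i<n. \<Sum>j<n. D i * E t $$ (i, j) * x j) = (\<Sum>j<n. \<Sum>i<n. D i * E t $$ (i, j) * x j)"
      by (rule sum.swap)
    also have "\<dots> = (\<Sum>i<n. \<Sum>j<n. x i * E t $$ (i, j) * D j)"
      by (intro sum.cong) (auto simp: symmetric(1)[OF t])
    finally have DE: "(\<Sum>i<n. \<Sum>j<n. D i * E t $$ (i, j) * x j) = (\<Sum>i<n. \<Sum>j<n. x i * A t $$ (i, j) * x j)"
      using EA by simp
    have F_swap: "(\<Sum>i<n. \<Sum>j<n. x i * F j i * x j) = (\<Sum>i<n. \<Sum>j<n. x i * F i j * x j)"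
      by (subst sum.swap) (simp add: mult_ac)
    have "(\<Sum>i<n. \<Sum>j<n. x i * A t $$ (i, j) * x j) = (\<Sum>i<n. \<Sum>j<n. - (x i * F i j * x j) - x i * R t $$ (i, j) * x j)"
      by (intro sum.cong) (auto simp: A_entry[OF t] F_def algebra_simps)
    then have A: "(\<Sum>i<n. \<Sum>j<n. x i * A t $$ (i, j) * x j)
        = - (\<Sum>i<n. \<Sum>j<n. x i * F i j * x j) - (\<Sum>i<n. \<Sum>j<n. x i * R t $$ (i, j) * x j)"
      by (simp add: sum_subtractf sum_negf)
    have "(\<Sum>i<n. \<Sum>j<n. (D i * E t $$ (i, j) + x i * (F i j + F j i)) * x j + x i * E t $$ (i, j) * D j)
      = (\<Sum>i<n. \<Sum>j<n. D i * E t $$ (i, j) * x j) + (\<Sum>i<n. \<Sum>j<n. x i * F i j * x j)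
        + (\<Sum>i<n. \<Sum>j<n. x i * F j i * x j) + (\<Sum>i<n. \<Sum>j<n. x i * E t $$ (i, j) * D j)"
      by (simp add: sum.distrib algebra_simps)
    then show ?thesis unfolding DE EA F_swap A by simp
  qed
  ultimately show ?thesis by (simp only: x_def)
qed

lemma T_subset: "t \<in> T \<Longrightarrow> t0 \<le> t \<and> t \<le> tf"
  by (simp add: T_def)

lemma quadratic_form_vec:
  fixes M :: "real mat"
  assumes M: "M \<in> carrier_mat n n"
  shows "scalar_prod (Matrix.vec n x) (M *\<^sub>v Matrix.vec n x) = (\<Sum>i<n. \<Sum>j<n. x i * M $$ (i, j) * x j)"
proof -
  have "scalar_prod (Matrix.vec n x) (M *\<^sub>v Matrix.vec n x)
      = (\<Sum>i<n. x i * vec_index (M *\<^sub>v Matrix.vec n x) i)"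
    using M by (simp add: scalar_prod_def atLeast0LessThan)
  also have "\<dots> = (\<Sum>i<n. x i * (\<Sum>j<n. M $$ (i, j) * x j))"
    by (intro sum.cong) (auto simp: mult_mat_vec_index_sum[OF M] simp del: index_mult_mat_vec)
  finally show ?thesis by (simp add: sum_distrib_left mult.assoc)
qed

text \<open>
  For zero initial values the energy is nonincreasing, nonnegative and initially zero. So \<open>u1\<close> and
  \<open>u2\<close> vanish identically, the left-hand side of the equation is zero, and \<open>right_kernel_zero\<close> applies.
\<close>

lemma homogeneous_zero:
  assumes u: "\<And>i. i < n \<Longrightarrow> u i differentiable_on T"
    and eq: "\<And>t i. t \<in> T \<Longrightarrow> i < n \<Longrightarrow>
      (\<Sum>j<n. E t $$ (i, j) * nderiv T 1 (u j) t) = (\<Sum>j<n. A t $$ (i, j) * u j t)"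
    and init: "\<And>i. i < n \<Longrightarrow> u i t0 = 0"
    and t: "t \<in> T" and j: "j < l"
  shows "u j t = 0"
proof -
  define \<phi> where "\<phi> r = (\<Sum>i<n. \<Sum>j<n. u i r * E r $$ (i, j) * u j r)" for r
  have deriv: "(\<phi> has_real_derivative - 2 * (\<Sum>i<n. \<Sum>j<n. u i r * R r $$ (i, j) * u j r)) (at r within T)"
    if "r \<in> T" for r
    unfolding \<phi>_def using energy_derivative[OF that u eq[OF that]] .
  have semidef: "pos_semidef n (E r)" "pos_semidef n (R r)" if "r \<in> T" for r
    using dHDAE that unfolding dHDAE_def by blast+
  have form: "0 \<le> (\<Sum>i<n. \<Sum>j<n. u i r * M $$ (i, j) * u j r)" if "pos_semidef n M" for M r
  proof -
    have M: "M \<in> carrier_mat n n" using that by (simp add: pos_semidef_def)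
    have "0 \<le> scalar_prod (Matrix.vec n (\<lambda>i. u i r)) (M *\<^sub>v Matrix.vec n (\<lambda>i. u i r))"
      using that unfolding pos_semidef_def by (blast intro: vec_carrier)
    then show ?thesis unfolding quadratic_form_vec[OF M] .
  qed
  have R: "0 \<le> (\<Sum>i<n. \<Sum>j<n. u i r * R r $$ (i, j) * u j r)" if "r \<in> T" for r
    by (rule form[OF semidef(2)[OF that]])
  have E: "0 \<le> \<phi> r" if "r \<in> T" for r
    unfolding \<phi>_def by (rule form[OF semidef(1)[OF that]])
  have "\<phi> r \<le> \<phi> t0" if r: "r \<in> T" for r
  proof (rule DERIV_nonpos_imp_decreasing_open[where f = \<phi>])
    show "t0 \<le> r" using T_subset[OF r] by simp
    show "\<exists>y. (\<phi> has_real_derivative y) (at v) \<and> y \<le> 0" if v: "t0 < v" "v < r" for v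
    proof (intro exI conjI)
      have "v \<in> T" "v \<in> interior T" using v T_subset[OF r] by (auto simp: T_def)
      show "(\<phi> has_real_derivative - 2 * (\<Sum>i<n. \<Sum>j<n. u i v * R v $$ (i, j) * u j v)) (at v)"
        using deriv[OF \<open>v \<in> T\<close>] unfolding at_within_interior[OF \<open>v \<in> interior T\<close>] .
      show "- 2 * (\<Sum>i<n. \<Sum>j<n. u i v * R v $$ (i, j) * u j v) \<le> 0" using R[OF \<open>v \<in> T\<close>] by simp
    qed
    have "continuous_on T \<phi>"
      using deriv by (meson DERIV_continuous continuous_on_eq_continuous_within)
    then show "continuous_on {t0..r} \<phi>"
      by (rule continuous_on_subset) (use T_subset[OF r] in \<open>auto simp: T_def\<close>)
  qed
  moreover have "\<phi> t0 = 0" using init by (simp add: \<phi>_def)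
  ultimately have \<phi>0: "\<phi> r = 0" if "r \<in> T" for r using E[OF that] that by force
  have u12: "u i r = 0" if r: "r \<in> T" and i: "i < m" for r i
  proof -
    interpret block_pattern n1 n2 n3 n5 m s l n "\<lambda>i j. E r $$ (i, j)" "\<lambda>i j. A r $$ (i, j)"
      "\<lambda>i j. mat_nderiv T 1 E r $$ (i, j)" "\<lambda>i j. mat_nderiv T 1 A r $$ (i, j)"
      by (rule block_pattern_at[OF r])
    have "(\<Sum>i<m. u i r * (\<Sum>j<m. E r $$ (i, j) * u j r)) = (\<Sum>i<n. u i r * (\<Sum>j<n. E r $$ (i, j) * u j r))"
    proof -
      have "(\<Sum>i<n. u i r * (\<Sum>j<n. E r $$ (i, j) * u j r)) = (\<Sum>i<m. u i r * (\<Sum>j<n. E r $$ (i, j) * u j r))"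
        using size_le E_zero[OF r] by (intro sum_lessThan_eq_sum) auto
      also have "\<dots> = (\<Sum>i<m. u i r * (\<Sum>j<m. E r $$ (i, j) * u j r))"
      proof (intro sum.cong refl)
        fix i assume "i \<in> {..<m}"
        then have "(\<Sum>j<n. E r $$ (i, j) * u j r) = (\<Sum>j<m. E r $$ (i, j) * u j r)"
          using size_le E_zero[OF r] by (intro sum_lessThan_eq_sum) auto
        then show "u i r * (\<Sum>j<n. E r $$ (i, j) * u j r) = u i r * (\<Sum>j<m. E r $$ (i, j) * u j r)" by simp
      qed
      finally show ?thesis by simp
    qed
    also have "\<dots> = \<phi> r" by (simp add: \<phi>_def sum_distrib_left mult.assoc)
    finally show ?thesis using e_definite[of "\<lambda>i. u i r" i] \<phi>0[OF r] i by simp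
  qed
  interpret block_pattern n1 n2 n3 n5 m s l n "\<lambda>i j. E t $$ (i, j)" "\<lambda>i j. A t $$ (i, j)"
    "\<lambda>i j. mat_nderiv T 1 E t $$ (i, j)" "\<lambda>i j. mat_nderiv T 1 A t $$ (i, j)"
    by (rule block_pattern_at[OF t])
  show ?thesis
  proof (rule right_kernel_zero[of "\<lambda>j. u j t", OF _ _ j])
    fix i assume i: "i < n"
    have "(\<Sum>j<n. E t $$ (i, j) * nderiv T 1 (u j) t) = 0"
    proof (intro sum.neutral ballI)
      fix j assume "j \<in> {..<n}"
      then show "E t $$ (i, j) * nderiv T 1 (u j) t = 0"
        using E_zero[OF t i, of j] nderiv_zero[of "u j" t] u12[of _ j] t by (cases "j < m") auto
    qed
    then show "(\<Sum>j<n. A t $$ (i, j) * u j t) = 0" using eq[OF t i] by simp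
  qed (use u12[OF t] in simp)
qed

lemma solutions_agree:
  assumes y: "solves z0 y" and z: "solves z0 z" and t: "t \<in> T" and j: "j < l"
  shows "vec_index (y t) j = vec_index (z t) j"
proof -
  define u where "u i r = vec_index (y r) i - vec_index (z r) i" for i r
  have yd: "(\<lambda>r. vec_index (y r) i) differentiable_on T" if "i < n" for i
    using y that Ck_on_differentiable[of 1] by (auto simp: solves_iff)
  have zd: "(\<lambda>r. vec_index (z r) i) differentiable_on T" if "i < n" for i
    using z that Ck_on_differentiable[of 1] by (auto simp: solves_iff)
  have "u j t = 0"
  proof (rule homogeneous_zero[OF _ _ _ t j])
    show "u i differentiable_on T" if "i < n" for i
      unfolding u_def by (rule differentiable_on_diff[OF yd[OF that] zd[OF that]])
    show "u i t0 = 0" if "i < n" for i using y z by (simp add: u_def solves_iff)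
    show "(\<Sum>j<n. E r $$ (i, j) * nderiv T 1 (u j) r) = (\<Sum>j<n. A r $$ (i, j) * u j r)"
      if "r \<in> T" "i < n" for r i
    proof -
      have "(\<Sum>j<n. E r $$ (i, j) * nderiv T 1 (u j) r)
          = (\<Sum>j<n. E r $$ (i, j) * nderiv T 1 (\<lambda>r. vec_index (y r) j) r
            - E r $$ (i, j) * nderiv T 1 (\<lambda>r. vec_index (z r) j) r)"
        unfolding u_def using yd zd that
        by (intro sum.cong refl) (simp add: nderiv_diff right_diff_distrib)
      also have "\<dots> = (\<Sum>j<n. A r $$ (i, j) * vec_index (y r) j) - (\<Sum>j<n. A r $$ (i, j) * vec_index (z r) j)"
        using y z that by (simp add: solves_iff sum_subtractf)
      also have "\<dots> = (\<Sum>j<n. A r $$ (i, j) * u j r)"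
        by (simp add: u_def right_diff_distrib sum_subtractf)
      finally show ?thesis .
    qed
  qed
  then show ?thesis by (simp add: u_def)
qed

lemma replace_tail_entry:
  assumes "x \<in> carrier_vec n" "w \<in> carrier_vec n5"
  shows "replace_tail l x w \<in> carrier_vec n"
    and "i < n \<Longrightarrow> vec_index (replace_tail l x w) i = (if i < l then vec_index x i else vec_index w (i - l))"
  using assms by (auto simp: replace_tail_def vec_first_def sizes)

text \<open>The columns of \<open>E\<close> and \<open>A\<close> that belong to the fifth block vanish.\<close>

lemma solves_replace_tail:
  assumes z: "solves z0 z" and w: "Ck_vec 1 T n5 w"
  shows "solves (replace_tail l z0 (w t0)) (\<lambda>t. replace_tail l (z t) (w t))"
proof -
  let ?z = "\<lambda>t. replace_tail l (z t) (w t)"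
  have zc: "z t \<in> carrier_vec n" and wc: "w t \<in> carrier_vec n5" if "t \<in> T" for t
    using z w that by (auto simp: solves_iff Ck_vec_def)
  note ent = replace_tail_entry[OF zc wc]
  have z_tail: "Ck_on 1 T (\<lambda>t. vec_index (?z t) i)" if "i < n" for i
  proof (cases "i < l")
    case True
    then have "Ck_on 1 T (\<lambda>t. vec_index (?z t) i) \<longleftrightarrow> Ck_on 1 T (\<lambda>t. vec_index (z t) i)"
      using that by (intro Ck_on_cong) (simp add: ent)
    then show ?thesis using z that by (simp add: solves_iff)
  next
    case False
    then have "Ck_on 1 T (\<lambda>t. vec_index (?z t) i) \<longleftrightarrow> Ck_on 1 T (\<lambda>t. vec_index (w t) (i - l))"
      using that by (intro Ck_on_cong) (simp add: ent)
    then show ?thesis using w that False by (simp add: Ck_vec_def sizes)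
  qed
  have "(\<Sum>j<n. E t $$ (i, j) * nderiv T 1 (\<lambda>r. vec_index (?z r) j) t) = (\<Sum>j<n. A t $$ (i, j) * vec_index (?z t) j)"
    if t: "t \<in> T" and i: "i < n" for t i
  proof -
    have "(\<Sum>j<n. E t $$ (i, j) * nderiv T 1 (\<lambda>r. vec_index (?z r) j) t)
        = (\<Sum>j<n. E t $$ (i, j) * nderiv T 1 (\<lambda>r. vec_index (z r) j) t)"
    proof (intro sum.cong refl)
      fix j assume "j \<in> {..<n}"
      then have j: "j < n" by simp
      show "E t $$ (i, j) * nderiv T 1 (\<lambda>r. vec_index (?z r) j) t = E t $$ (i, j) * nderiv T 1 (\<lambda>r. vec_index (z r) j) t"
      proof (cases "j < l")
        case True
        then have "nderiv T 1 (\<lambda>r. vec_index (?z r) j) t = nderiv T 1 (\<lambda>r. vec_index (z r) j) t"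
          using j by (intro nderiv_cong[OF _ t]) (simp add: ent)
        then show ?thesis by simp
      next
        case False
        then show ?thesis using E_zero[OF t i j] size_le by simp
      qed
    qed
    also have "\<dots> = (\<Sum>j<n. A t $$ (i, j) * vec_index (z t) j)" using z t i by (simp add: solves_iff)
    also have "\<dots> = (\<Sum>j<n. A t $$ (i, j) * vec_index (?z t) j)"
    proof (intro sum.cong refl)
      fix j assume "j \<in> {..<n}"
      then show "A t $$ (i, j) * vec_index (z t) j = A t $$ (i, j) * vec_index (?z t) j"
        using A_zero[OF t i, of j] ent[OF t t] by (cases "j < l") auto
    qed
    finally show ?thesis .
  qed
  moreover have "?z t0 = replace_tail l z0 (w t0)" using z by (simp add: solves_iff)
  moreover have "\<forall>t\<in>T. ?z t \<in> carrier_vec n" using replace_tail_entry(1) zc wc by simp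
  ultimately show ?thesis using z_tail unfolding solves_iff by blast
qed

lemma solution_unique_iff:
  assumes "consistent t0 tf n E A z0"
  shows "solution_unique t0 tf n E A z0 \<longleftrightarrow> n5 = 0"
proof
  assume "n5 = 0"
  then have "l = n" by (simp add: sizes)
  show "solution_unique t0 tf n E A z0"
    unfolding solution_unique_def solves_def[symmetric] T_def[symmetric]
  proof (intro allI impI ballI)
    fix y z t assume yz: "solves z0 y" "solves z0 z" and t: "t \<in> T"
    then have "y t \<in> carrier_vec n" "z t \<in> carrier_vec n" by (auto simp: solves_iff)
    then show "y t = z t"
      using solutions_agree[OF yz t] \<open>l = n\<close> by (intro eq_vecI) auto
  qed
next
  assume uniq: "solution_unique t0 tf n E A z0"
  show "n5 = 0"
  proof (rule ccontr)
    assume n5: "n5 \<noteq> 0"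
    obtain z where z: "solves z0 z" using assms by (auto simp: consistent_def solves_def)
    \<comment> \<open>Any modification of \<open>z5\<close> that vanishes at \<open>t0\<close> gives another solution.\<close>
    define w where "w t = Matrix.vec n5 (\<lambda>i. vec_index (z t) (l + i) + (t - t0))" for t
    have w: "Ck_vec 1 T n5 w"
      unfolding Ck_vec_def
    proof (intro conjI ballI allI impI)
      fix i assume i: "i < n5"
      have "l + i < n" using i by (simp add: sizes)
      then have "Ck_on 1 T (\<lambda>t. vec_index (z t) (l + i))" using z by (simp add: solves_iff)
      then have "Ck_on 1 T (\<lambda>t. vec_index (z t) (l + i) + (t - t0))"
        by (intro Ck_on_add Ck_on_diff Ck_on_ident Ck_on_const)
      then show "Ck_on 1 T (\<lambda>t. vec_index (w t) i)" using i by (simp add: w_def)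
    qed (simp add: w_def)
    have T: "t0 \<in> T" "tf \<in> T" using t0_less_tf by (auto simp: T_def)
    have zc: "z t \<in> carrier_vec n" if "t \<in> T" for t using z that by (auto simp: solves_iff)
    have wc: "w t \<in> carrier_vec n5" for t by (simp add: w_def)
    have z0: "z0 = z t0" using z by (simp add: solves_iff)
    have "vec_index (replace_tail l z0 (w t0)) i = vec_index z0 i" if "i < n" for i
      using that unfolding z0 replace_tail_entry(2)[OF zc[OF T(1)] wc that] by (auto simp: w_def sizes)
    then have "replace_tail l z0 (w t0) = z0"
      using replace_tail_entry(1)[OF zc[OF T(1)] wc] zc[OF T(1)] z0 by (intro eq_vecI) auto
    then have "solves z0 (\<lambda>t. replace_tail l (z t) (w t))"
      using solves_replace_tail[OF z w] by simp
    then have "z tf = replace_tail l (z tf) (w tf)"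
      using uniq z T(2) unfolding solution_unique_def solves_def T_def by blast
    then have "vec_index (z tf) l = vec_index (replace_tail l (z tf) (w tf)) l" by simp
    also have "\<dots> = vec_index (z tf) l + (tf - t0)"
      using n5 by (subst replace_tail_entry(2)[OF zc[OF T(2)] wc]) (auto simp: w_def sizes)
    finally show False using t0_less_tf by simp
  qed
qed

text \<open>
  The normal form only says \<open>J = R\<close> in the rows and columns of the last block. As \<open>E\<close> and \<open>E K\<close>
  vanish there, \<open>J\<close> is skew in these rows and columns, whereas \<open>R\<close> is symmetric; so both vanish.
\<close>

lemma unit_vec_common_kernel:
  assumes t: "t \<in> T" and j: "l \<le> j" "j < n"
  shows "unit_vec n j \<in> common_kernel n (E t) (J t) (R t) (E t * K t)"
proof -
  have JR: "J t $$ (i, j) = 0" "R t $$ (i, j) = 0" if i: "i < n" for i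
  proof -
    have "nderiv T 1 (\<lambda>r. E r $$ (i, j)) t = 0"
      using E_zero i j size_le by (intro nderiv_zero[OF _ t]) auto
    then have "J t $$ (i, j) + J t $$ (j, i) = 0"
      using E_deriv_entry[OF t i j(2)] EK_zero[OF t i j(2)] EK_zero[OF t j(2) i] j size_le by simp
    then show "J t $$ (i, j) = 0" "R t $$ (i, j) = 0"
      using JR_zero[OF t i j(2)] JR_zero[OF t j(2) i] symmetric(2)[OF t i j(2)] j by auto
  qed
  have col: "M *\<^sub>v unit_vec n j = 0\<^sub>v n"
    if "M \<in> carrier_mat n n" "\<And>i. i < n \<Longrightarrow> M $$ (i, j) = 0" for M :: "real mat"
    using that j by (subst mult_mat_unit_vec[OF that(1) j(2)]) (auto intro!: eq_vecI)
  show ?thesis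
    unfolding common_kernel_def
    using col[OF carriers(1)[OF t]] col[OF carriers(2)[OF t]] col[OF carriers(3)[OF t]]
      col[of "E t * K t"] carriers[OF t] JR E_zero[OF t _ j(2)] EK_zero[OF t _ j(2)] j size_le by simp
qed

lemma common_kernel_trivial:
  assumes t: "t \<in> T" and "n5 = 0"
  shows "common_kernel n (E t) (J t) (R t) (E t * K t) = {0\<^sub>v n}"
proof (intro equalityI subsetI)
  interpret block_pattern n1 n2 n3 n5 m s l n "\<lambda>i j. E t $$ (i, j)" "\<lambda>i j. A t $$ (i, j)"
    "\<lambda>i j. mat_nderiv T 1 E t $$ (i, j)" "\<lambda>i j. mat_nderiv T 1 A t $$ (i, j)"
    by (rule block_pattern_at[OF t])
  fix x assume "x \<in> common_kernel n (E t) (J t) (R t) (E t * K t)"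
  then have x: "x \<in> carrier_vec n" "E t *\<^sub>v x = 0\<^sub>v n" "J t *\<^sub>v x = 0\<^sub>v n" "R t *\<^sub>v x = 0\<^sub>v n"
      "(E t * K t) *\<^sub>v x = 0\<^sub>v n" by (simp_all add: common_kernel_def)
  have EKc: "E t * K t \<in> carrier_mat n n" using carriers[OF t] by simp
  have x12: "vec_index x j = 0" if "j < m" for j
    by (rule e_injective_cols[OF _ that]) (use x(2) right_kernel_iff[OF carriers(1)[OF t] x(1)] size_le in auto)
  have Ax: "(\<Sum>j<n. A t $$ (i, j) * vec_index x j) = 0" if i: "i < n" for i
  proof -
    have "(\<Sum>j<n. A t $$ (i, j) * vec_index x j) = (\<Sum>j<n. J t $$ (i, j) * vec_index x j)
        - (\<Sum>j<n. R t $$ (i, j) * vec_index x j) - (\<Sum>j<n. (E t * K t) $$ (i, j) * vec_index x j)"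
      unfolding sum_subtractf[symmetric]
      using i by (intro sum.cong refl) (simp add: A_entry[OF t] left_diff_distrib del: index_mult_mat)
    also have "\<dots> = 0"
      using x(3,4,5) i unfolding right_kernel_iff[OF carriers(2)[OF t] x(1)]
        right_kernel_iff[OF carriers(3)[OF t] x(1)] right_kernel_iff[OF EKc x(1)] by simp
    finally show ?thesis .
  qed
  have "vec_index x j = 0" if "j < n" for j
    by (rule right_kernel_zero[OF Ax x12]) (use that \<open>n5 = 0\<close> in \<open>simp_all add: sizes\<close>)
  then show "x \<in> {0\<^sub>v n}" using x(1) by (auto intro!: eq_vecI)
next
  have "M *\<^sub>v 0\<^sub>v n = 0\<^sub>v n" if "M \<in> carrier_mat n n" for M :: "real mat"
    using that by (intro eq_vecI) auto
  then show "x \<in> common_kernel n (E t) (J t) (R t) (E t * K t)" if "x \<in> {0\<^sub>v n}" for x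
    using that carriers[OF t] by (simp add: common_kernel_def)
qed

lemma common_kernel_iff:
  "(\<forall>t\<in>T. common_kernel n (E t) (J t) (R t) (E t * K t) \<noteq> {0\<^sub>v n}) \<longleftrightarrow> n5 \<noteq> 0"
  "(\<Inter>t\<in>T. common_kernel n (E t) (J t) (R t) (E t * K t)) \<noteq> {0\<^sub>v n} \<longleftrightarrow> n5 \<noteq> 0"
proof -
  have T: "t0 \<in> T" using t0_less_tf by (simp add: T_def)
  have triv: "(\<Inter>t\<in>T. common_kernel n (E t) (J t) (R t) (E t * K t)) = {0\<^sub>v n}" if "n5 = 0"
    using common_kernel_trivial[OF _ that] T by auto
  have nontriv: "unit_vec n l \<in> common_kernel n (E t) (J t) (R t) (E t * K t)" if "n5 \<noteq> 0" "t \<in> T" for t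
    using unit_vec_common_kernel[OF that(2), of l] that(1) by (simp add: sizes)
  have "unit_vec n l \<noteq> (0\<^sub>v n :: real Matrix.vec)" if "n5 \<noteq> 0"
  proof
    assume "unit_vec n l = (0\<^sub>v n :: real Matrix.vec)"
    from arg_cong[OF this, of "\<lambda>v. vec_index v l"] show False using that by (simp add: sizes)
  qed
  with nontriv triv common_kernel_trivial T
  show "(\<forall>t\<in>T. common_kernel n (E t) (J t) (R t) (E t * K t) \<noteq> {0\<^sub>v n}) \<longleftrightarrow> n5 \<noteq> 0"
    "(\<Inter>t\<in>T. common_kernel n (E t) (J t) (R t) (E t * K t)) \<noteq> {0\<^sub>v n} \<longleftrightarrow> n5 \<noteq> 0"
    by blast+
qed

end

section \<open>The strangeness index\<close>

context normal_form_system
begin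

text \<open>The coordinates of \<open>z2\<close> and \<open>z5\<close>, which the constraints leave free.\<close>

definition free_coord :: "nat \<Rightarrow> nat" where
  "free_coord i = (if i < n2 then n1 + i else l + (i - n2))"

lemma free_coord:
  shows "inj_on free_coord {..<n2 + n5}" "free_coord ` {..<n2 + n5} \<subseteq> {..<n}"
    and "j < n \<Longrightarrow> j \<notin> free_coord ` {..<n2 + n5} \<longleftrightarrow> j < l \<and> (j < n1 \<or> m \<le> j)"
proof -
  show "inj_on free_coord {..<n2 + n5}"
    unfolding free_coord_def by (rule inj_onI) (auto simp: sizes split: if_splits)
  have "free_coord ` {..<n2 + n5} = {n1..<m} \<union> {l..<n}"
  proof (intro equalityI subsetI)
    fix j assume j: "j \<in> {n1..<m} \<union> {l..<n}"
    show "j \<in> free_coord ` {..<n2 + n5}"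
    proof (cases "j < m")
      case True
      then have "j = free_coord (j - n1)" "j - n1 < n2 + n5"
        using j size_le unfolding free_coord_def by (auto simp: sizes)
      then show ?thesis by blast
    next
      case False
      then have "j = free_coord (n2 + (j - l))" "n2 + (j - l) < n2 + n5"
        using j unfolding free_coord_def by (auto simp: sizes)
      then show ?thesis by blast
    qed
  next
    fix j assume "j \<in> free_coord ` {..<n2 + n5}"
    then show "j \<in> {n1..<m} \<union> {l..<n}" unfolding free_coord_def by (auto simp: sizes)
  qed
  then show "free_coord ` {..<n2 + n5} \<subseteq> {..<n}"
    "j < n \<Longrightarrow> j \<notin> free_coord ` {..<n2 + n5} \<longleftrightarrow> j < l \<and> (j < n1 \<or> m \<le> j)"
    using size_le by auto
qed

lemma free_coord_head: "i < n2 \<Longrightarrow> free_coord i < m"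
  unfolding free_coord_def by (simp add: sizes(1))

lemma free_coord_tail: "n2 \<le> i \<Longrightarrow> i < n2 + n5 \<Longrightarrow> l \<le> free_coord i \<and> free_coord i < n"
  unfolding free_coord_def by (auto simp: sizes(4))

lemma A_left_eq:
  assumes "t \<in> T" "y \<in> carrier_vec n" "j < n"
  shows "vec_index (transpose_mat (A t) *\<^sub>v y) j = (\<Sum>i<n. A t $$ (i, j) * vec_index y i)"
  using mult_transpose_vec_index_sum[OF carriers(5)[OF assms(1)] assms(2,3)] .

subsection \<open>Order 0\<close>

lemma infl_0_at:
  assumes "t \<in> T"
  shows "infl_E T n E A 0 t = E t" "infl_A T n A 0 t = A t" "infl_A_col T n A 0 t = A t"
  using infl_0[of E t n A T] carriers[OF assms] by auto

lemma rank_E: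
  assumes t: "t \<in> T"
  shows "mat_rank (E t) = m"
proof -
  interpret block_pattern n1 n2 n3 n5 m s l n "\<lambda>i j. E t $$ (i, j)" "\<lambda>i j. A t $$ (i, j)"
    "\<lambda>i j. mat_nderiv T 1 E t $$ (i, j)" "\<lambda>i j. mat_nderiv T 1 A t $$ (i, j)"
    by (rule block_pattern_at[OF t])
  have "mat_rank (E t) = n - card {m..<n}"
  proof (rule mat_rank_left_free[OF carriers(1)[OF t]])
    fix y assume y: "y \<in> carrier_vec n" "transpose_mat (E t) *\<^sub>v y = 0\<^sub>v n"
      "\<And>i. i \<in> {m..<n} \<Longrightarrow> vec_index y i = 0"
    have "vec_index y i = 0" if "i < m" for i
      by (rule e_injective[OF _ that])
        (use y(2) size_le in \<open>simp add: left_kernel_iff[OF carriers(1)[OF t] y(1)]\<close>)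
    then have "vec_index y i = 0" if "i < n" for i using y(3)[of i] that by (cases "i < m") auto
    then show "y = 0\<^sub>v n" using y(1) by (intro eq_vecI) auto
  next
    fix i assume i: "i \<in> {m..<n}"
    show "\<exists>y\<in>carrier_vec n. transpose_mat (E t) *\<^sub>v y = 0\<^sub>v n \<and> (\<forall>j\<in>{m..<n}. vec_index y j = (if j = i then 1 else 0))"
    proof (intro bexI[of _ "unit_vec n i"] conjI)
      show "transpose_mat (E t) *\<^sub>v unit_vec n i = 0\<^sub>v n"
        unfolding left_kernel_iff[OF carriers(1)[OF t] unit_vec_carrier]
      proof (intro allI impI sum.neutral ballI)
        fix j r assume "j < n" "r \<in> {..<n}"
        then show "E t $$ (r, j) * vec_index (unit_vec n i) r = 0"
          using E_zero[OF t, of r j] i by (cases "r = i") auto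
      qed
    qed (use i in auto)
  qed auto
  then show ?thesis using size_le by simp
qed

lemma rank_infl_EA_0:
  assumes t: "t \<in> T"
  shows "mat_rank (infl_EA T n E A 0 t) = l"
proof -
  interpret block_pattern n1 n2 n3 n5 m s l n "\<lambda>i j. E t $$ (i, j)" "\<lambda>i j. A t $$ (i, j)"
    "\<lambda>i j. mat_nderiv T 1 E t $$ (i, j)" "\<lambda>i j. mat_nderiv T 1 A t $$ (i, j)"
    by (rule block_pattern_at[OF t])
  have c: "infl_EA T n E A 0 t \<in> carrier_mat n (n + n)" using infl_EA_carrier[of T n E A 0 t] by simp
  have ker: "transpose_mat (infl_EA T n E A 0 t) *\<^sub>v y = 0\<^sub>v (n + n) \<longleftrightarrow>
      (\<forall>j<n. (\<Sum>i<n. E t $$ (i, j) * vec_index y i) = 0) \<and> (\<forall>j<n. (\<Sum>i<n. A t $$ (i, j) * vec_index y i) = 0)"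
    if "y \<in> carrier_vec n" for y
    using infl_EA_left_kernel[of y 0 n T E A t] that
    by (simp add: infl_0_at[OF t] left_kernel_iff[OF carriers(1)[OF t] that] left_kernel_iff[OF carriers(5)[OF t] that])
  have "mat_rank (infl_EA T n E A 0 t) = n - card {l..<n}"
  proof (rule mat_rank_left_free[OF c])
    fix y assume y: "y \<in> carrier_vec n" "transpose_mat (infl_EA T n E A 0 t) *\<^sub>v y = 0\<^sub>v (n + n)"
      "\<And>i. i \<in> {l..<n} \<Longrightarrow> vec_index y i = 0"
    have "vec_index y i = 0" if "i < l" for i
      by (rule left_kernel0_zero[OF _ _ that]) (use y(2) size_le in \<open>simp_all add: ker[OF y(1)]\<close>)
    then have "vec_index y i = 0" if "i < n" for i using y(3)[of i] that by (cases "i < l") auto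
    then show "y = 0\<^sub>v n" using y(1) by (intro eq_vecI) auto
  next
    fix i assume i: "i \<in> {l..<n}"
    show "\<exists>y\<in>carrier_vec n. transpose_mat (infl_EA T n E A 0 t) *\<^sub>v y = 0\<^sub>v (n + n)
        \<and> (\<forall>j\<in>{l..<n}. vec_index y j = (if j = i then 1 else 0))"
    proof (intro bexI[of _ "unit_vec n i"] conjI)
      show "transpose_mat (infl_EA T n E A 0 t) *\<^sub>v unit_vec n i = 0\<^sub>v (n + n)"
        unfolding ker[OF unit_vec_carrier]
      proof (intro conjI allI impI sum.neutral ballI)
        fix j r assume "j < n" "r \<in> {..<n}"
        then show "E t $$ (r, j) * vec_index (unit_vec n i) r = 0" "A t $$ (r, j) * vec_index (unit_vec n i) r = 0"
          using E_zero[OF t, of r j] A_zero[OF t, of r j] i size_le by (cases "r = i"; auto)+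
      qed
    qed (use i in auto)
  qed auto
  then show ?thesis using size_le by simp
qed

lemma corank_infl_EA_0:
  assumes "t \<in> T"
  shows "corank (infl_EA T n E A 0 t) = int n5"
  using carrier_matD(1)[OF infl_EA_carrier[of T n E A 0 t]]
  unfolding corank_def rank_infl_EA_0[OF assms] by (simp add: sizes(4))

lemma E_kernel:
  assumes t: "t \<in> T" and x: "x \<in> carrier_vec n" "E t *\<^sub>v x = 0\<^sub>v n" and j: "j < m"
  shows "vec_index x j = 0"
proof -
  interpret block_pattern n1 n2 n3 n5 m s l n "\<lambda>i j. E t $$ (i, j)" "\<lambda>i j. A t $$ (i, j)"
    "\<lambda>i j. mat_nderiv T 1 E t $$ (i, j)" "\<lambda>i j. mat_nderiv T 1 A t $$ (i, j)"
    by (rule block_pattern_at[OF t])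
  show ?thesis
    by (rule e_injective_cols[OF _ j])
      (use x(2) size_le in \<open>simp add: right_kernel_iff[OF carriers(1)[OF t] x(1)]\<close>)
qed

lemma zero_column:
  fixes M :: "real mat"
  assumes "M \<in> carrier_mat nr nc" "j < nc" "\<And>i. i < nr \<Longrightarrow> M $$ (i, j) = 0"
  shows "M *\<^sub>v unit_vec nc j = 0\<^sub>v nr"
  using assms by (subst mult_mat_unit_vec[OF assms(1,2)]) (auto intro!: eq_vecI)

text \<open>For \<open>n1 = 0\<close>, the only constraint is the third block row; \<open>Z\<close> selects it.\<close>

lemma strangeness_hyp_0:
  assumes n1: "n1 = 0"
  shows "strangeness_hyp k T n E A 0"
proof (rule strangeness_hypI[where a = n3 and b = "n2 + n5" and v = n5 and r = "int l" and \<rho> = free_coord])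
  define Z where "Z = Matrix.mat n n3 (\<lambda>(i, j). if i = m + j then 1 else 0 :: real)"
  have Zc: "Z \<in> carrier_mat n n3" by (simp add: Z_def)
  have Z_vec: "vec_index (Z *\<^sub>v c) i = (if m \<le> i \<and> i < s then vec_index c (i - m) else 0)"
    if "c \<in> carrier_vec n3" "i < n" for c i
  proof -
    have "vec_index (Z *\<^sub>v c) i = (\<Sum>j<n3. Z $$ (i, j) * vec_index c j)"
      by (rule mult_mat_vec_index_sum[OF Zc that])
    also have "\<dots> = (\<Sum>j<n3. if j = i - m then (if m \<le> i \<and> i < s then vec_index c j else 0) else 0)"
      using that by (intro sum.cong) (auto simp: Z_def sizes)
    finally show ?thesis by (auto simp: sizes)
  qed
  show "Ck_mat (k - enat 0) T ((0 + 1) * n) n3 (\<lambda>t. Z)"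
    by (rule Ck_matI[where f = "\<lambda>i j t. Z $$ (i, j)"]) (use Zc in auto)
  fix t assume t: "t \<in> T"
  interpret block_pattern n1 n2 n3 n5 m s l n "\<lambda>i j. E t $$ (i, j)" "\<lambda>i j. A t $$ (i, j)"
    "\<lambda>i j. mat_nderiv T 1 E t $$ (i, j)" "\<lambda>i j. mat_nderiv T 1 A t $$ (i, j)"
    by (rule block_pattern_at[OF t])
  show "transpose_mat Z * infl_E T n E A 0 t = 0\<^sub>m n3 ((0 + 1) * n)"
  proof (rule eq_matI)
    fix p j assume "p < dim_row (0\<^sub>m n3 ((0 + 1) * n))" "j < dim_col (0\<^sub>m n3 ((0 + 1) * n))"
    then have pj: "p < n3" "j < n" by auto
    have "(transpose_mat Z * E t) $$ (p, j) = (\<Sum>i<n. Z $$ (i, p) * E t $$ (i, j))"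
      using pj Zc carriers(1)[OF t] by (simp add: scalar_prod_def atLeast0LessThan)
    also have "\<dots> = 0"
    proof (intro sum.neutral ballI)
      fix i assume "i \<in> {..<n}"
      then show "Z $$ (i, p) * E t $$ (i, j) = 0"
        using pj E_zero[OF t, of i j] by (cases "m \<le> i") (auto simp: Z_def)
    qed
    finally show "(transpose_mat Z * infl_E T n E A 0 t) $$ (p, j) = 0\<^sub>m n3 ((0 + 1) * n) $$ (p, j)"
      using pj by (simp add: infl_0_at[OF t])
  qed (use Zc carriers(1)[OF t] in \<open>auto simp: infl_0_at[OF t]\<close>)
  show "c = 0\<^sub>v n3" if c: "c \<in> carrier_vec n3" and
    cols: "\<And>j. j < n \<Longrightarrow> j \<notin> free_coord ` {..<n2 + n5}
      \<Longrightarrow> vec_index (transpose_mat (infl_A_col T n A 0 t) *\<^sub>v (Z *\<^sub>v c)) j = 0" for c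
  proof -
    have Zcc: "Z *\<^sub>v c \<in> carrier_vec n" using Zc c by simp
    have "vec_index (Z *\<^sub>v c) i = 0" if "i < l" for i
    proof (rule left_kernel0_zero[OF _ _ that])
      fix j assume j: "j < m"
      show "(\<Sum>i<n. E t $$ (i, j) * vec_index (Z *\<^sub>v c) i) = 0"
      proof (intro sum.neutral ballI)
        fix i assume "i \<in> {..<n}"
        then show "E t $$ (i, j) * vec_index (Z *\<^sub>v c) i = 0"
          using j size_le E_zero[OF t, of i j] Z_vec[OF c, of i] by (cases "m \<le> i") auto
      qed
    next
      fix j assume "j < l" "j < n1 \<or> m \<le> j"
      then show "(\<Sum>i<n. A t $$ (i, j) * vec_index (Z *\<^sub>v c) i) = 0"
        using cols[of j] free_coord(3)[of j] size_le
        by (simp add: infl_0_at[OF t] A_left_eq[OF t Zcc] del: index_mult_mat_vec)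
    qed
    then have "vec_index c p = 0" if "p < n3" for p
      using Z_vec[OF c, of "m + p"] that by (simp add: sizes del: index_mult_mat_vec)
    then show ?thesis using c by (intro eq_vecI) auto
  qed
  show "int (mat_rank (infl_EA T n E A 0 t)) = int l" by (simp add: rank_infl_EA_0[OF t])
  show "corank (infl_EA T n E A 0 t) - (if 0 = 0 then 0 else corank (infl_EA T n E A (0 - 1) t)) = int n5"
    by (simp add: corank_infl_EA_0[OF t])
  show "int (mat_rank (infl_E T n E A 0 t)) = int l - int n3"
    using n1 unfolding infl_0_at[OF t] rank_E[OF t] by (simp add: sizes)
  show "E t \<in> carrier_mat n n" by (rule carriers[OF t])
  show "vec_index x (free_coord i) = 0"
    if "x \<in> carrier_vec n" "E t *\<^sub>v x = 0\<^sub>v n" "i < n2 + n5 - n5" for x i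
    using E_kernel[OF t that(1,2) free_coord_head] that(3) by simp
  show "E t *\<^sub>v unit_vec n (free_coord i) = 0\<^sub>v n" if "n2 + n5 - n5 \<le> i" "i < n2 + n5" for i
    using that free_coord_tail[of i] E_zero[OF t] size_le by (intro zero_column[OF carriers(1)[OF t]]) auto
  show "infl_A_col T n A 0 t *\<^sub>v unit_vec n (free_coord i) = 0\<^sub>v ((0 + 1) * n)"
    if "n2 + n5 - n5 \<le> i" "i < n2 + n5" for i
    using that free_coord_tail[of i] A_zero[OF t] size_le zero_column[OF carriers(5)[OF t], of "free_coord i"]
    unfolding infl_0_at[OF t] by auto
next
  show "Ck_mat (k - enat 0) T ((0 + 1) * n) n (infl_A_col T n A 0)"
  proof -
    have "Ck_mat k T n n (infl_A_col T n A 0)"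
      by (rule Ck_matI[where f = "\<lambda>i j t. A t $$ (i, j)"])
        (use carriers(5) Ck_mat_entry[OF A_smooth] in \<open>auto simp: infl_0_at\<close>)
    then show ?thesis by (cases k) (simp_all add: zero_enat_def)
  qed
qed (use n1 free_coord in \<open>auto simp: sizes zero_enat_def[symmetric]\<close>)

text \<open>
  If \<open>n1 > 0\<close>, then order 0 fails: \<open>Z\<close> must span all the constraints, among them \<open>A41 z1 = 0\<close>, so that
  \<open>E Ta\<close> only depends on the \<open>n2\<close> rows of \<open>Ta\<close> that belong to \<open>z2\<close>.
\<close>

lemma not_strangeness_hyp_0:
  assumes n1: "n1 > 0"
  shows "\<not> strangeness_hyp k T n E A 0"
proof
  assume "strangeness_hyp k T n E A 0"
  then obtain r a v Z Ta where hyp: "a \<le> n"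
      "\<forall>t\<in>T. int (mat_rank (infl_EA T n E A 0 t)) = r"
      "\<forall>t\<in>T. corank (infl_EA T n E A 0 t) -
           (if (0::nat) = 0 then 0 else corank (infl_EA T n E A (0 - 1) t)) = v"
      "\<forall>t\<in>T. int (mat_rank (infl_E T n E A 0 t)) = r - int a"
      "Ck_mat (k - enat 0) T ((0 + 1) * n) a Z" "Ck_mat (k - enat 0) T n (n - a) Ta"
      "\<forall>t\<in>T. mat_rank (Z t) = a \<and> mat_rank (Ta t) = n - a \<and>
        transpose_mat (Z t) * infl_E T n E A 0 t = 0\<^sub>m a ((0 + 1) * n) \<and>
        mat_rank (transpose_mat (Z t) * infl_A T n A 0 t) = a \<and>
        transpose_mat (Z t) * infl_A_col T n A 0 t * Ta t = 0\<^sub>m a (n - a) \<and>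
        int (mat_rank (E t * Ta t)) = int n - int a - v"
    unfolding strangeness_hyp_def by blast
  have t: "t0 \<in> T" using t0_less_tf by (simp add: T_def)
  interpret block_pattern n1 n2 n3 n5 m s l n "\<lambda>i j. E t0 $$ (i, j)" "\<lambda>i j. A t0 $$ (i, j)"
    "\<lambda>i j. mat_nderiv T 1 E t0 $$ (i, j)" "\<lambda>i j. mat_nderiv T 1 A t0 $$ (i, j)"
    by (rule block_pattern_at[OF t])
  have Ec: "E t0 \<in> carrier_mat n n" and Ac: "A t0 \<in> carrier_mat n n" using carriers[OF t] by auto
  have Zc: "Z t0 \<in> carrier_mat n a" and Tac: "Ta t0 \<in> carrier_mat n (n - a)"
    using Ck_mat_carrier[OF hyp(5) t] Ck_mat_carrier[OF hyp(6) t] by simp_all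
  have r: "r = int l" using hyp(2) t rank_infl_EA_0[OF t] by auto
  have v: "v = int n5" using hyp(3) t corank_infl_EA_0[OF t] by auto
  have a: "a = l - m" using hyp(4) t rank_E[OF t] r size_le by (auto simp: infl_0_at[OF t])
  have la: "l = m + a" using a size_le by simp
  have ZE: "transpose_mat (Z t0) * E t0 = 0\<^sub>m a n" using hyp(7) t by (auto simp: infl_0_at[OF t])
  have ZA: "mat_rank (transpose_mat (Z t0) * A t0) = a" using hyp(7) t by (auto simp: infl_0_at[OF t])
  have ZAT: "transpose_mat (Z t0) * A t0 * Ta t0 = 0\<^sub>m a (n - a)" using hyp(7) t by (auto simp: infl_0_at[OF t])
  have tr: "transpose_mat (transpose_mat (Z t0) * M) *\<^sub>v c = transpose_mat M *\<^sub>v (Z t0 *\<^sub>v c)"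
    if "M \<in> carrier_mat n q" "c \<in> carrier_vec a" for M q c
    using transpose_mult[of "transpose_mat (Z t0)" a n M q] assoc_mult_mat_vec[of "transpose_mat M" q n "Z t0" a c]
      Zc that by simp
  have Zcc: "Z t0 *\<^sub>v c \<in> carrier_vec n" if "c \<in> carrier_vec a" for c using Zc that by simp
  have Z12: "vec_index (Z t0 *\<^sub>v c) i = 0" if c: "c \<in> carrier_vec a" and i: "i < m" for c i
  proof -
    have "transpose_mat (0\<^sub>m a n) *\<^sub>v c = 0\<^sub>v n" using c by (intro eq_vecI) auto
    then have "transpose_mat (E t0) *\<^sub>v (Z t0 *\<^sub>v c) = 0\<^sub>v n" using tr[OF Ec c] by (simp only: ZE)
    then have "\<forall>j<n. (\<Sum>i<n. E t0 $$ (i, j) * vec_index (Z t0 *\<^sub>v c) i) = 0"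
      by (simp only: left_kernel_iff[OF Ec Zcc[OF c]])
    then have "(\<Sum>i<n. E t0 $$ (i, j) * vec_index (Z t0 *\<^sub>v c) i) = 0" if "j < m" for j
      using that size_le by simp
    then show ?thesis by (rule e_injective[OF _ i])
  qed
  \<comment> \<open>The rows of \<open>Z\<close> below the first \<open>m\<close> and above the last \<open>n5\<close> ones form a square matrix \<open>Q\<close>.\<close>
  define Q where "Q = Matrix.mat a a (\<lambda>(p, q). Z t0 $$ (m + p, q))"
  have Qc: "Q \<in> carrier_mat a a" by (simp add: Q_def)
  have Q_vec: "vec_index (Q *\<^sub>v c) p = vec_index (Z t0 *\<^sub>v c) (m + p)" if "c \<in> carrier_vec a" "p < a" for c p
  proof -
    have mp: "m + p < n" using that(2) la size_le(4) by linarith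
    have "vec_index (Q *\<^sub>v c) p = (\<Sum>j<a. Q $$ (p, j) * vec_index c j)"
      by (rule mult_mat_vec_index_sum[OF Qc that])
    also have "\<dots> = (\<Sum>j<a. Z t0 $$ (m + p, j) * vec_index c j)"
      using that(2) by (intro sum.cong) (auto simp: Q_def)
    also have "\<dots> = vec_index (Z t0 *\<^sub>v c) (m + p)"
      by (rule mult_mat_vec_index_sum[OF Zc that(1) mp, symmetric])
    finally show ?thesis .
  qed
  have "Determinant.det Q \<noteq> 0"
  proof (rule square_det_nonzeroI[OF Qc])
    fix c assume c: "c \<in> carrier_vec a" "Q *\<^sub>v c = 0\<^sub>v a"
    have Z0: "vec_index (Z t0 *\<^sub>v c) i = 0" if "i < l" for i
    proof (cases "i < m")
      case False
      then show ?thesis using Q_vec[OF c(1), of "i - m"] c(2) that la by simp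
    qed (rule Z12[OF c(1)])
    have "(\<Sum>i<n. A t0 $$ (i, j) * vec_index (Z t0 *\<^sub>v c) i) = 0" if "j < n" for j
    proof (intro sum.neutral ballI)
      fix i assume "i \<in> {..<n}"
      then show "A t0 $$ (i, j) * vec_index (Z t0 *\<^sub>v c) i = 0"
        using Z0[of i] A_zero[OF t, of i j] that by (cases "i < l") (auto simp del: index_mult_mat_vec)
    qed
    then have "transpose_mat (A t0) *\<^sub>v (Z t0 *\<^sub>v c) = 0\<^sub>v n"
      by (simp add: left_kernel_iff[OF Ac Zcc[OF c(1)]] del: index_mult_mat_vec)
    then have "transpose_mat (transpose_mat (Z t0) * A t0) *\<^sub>v c = 0\<^sub>v n" using tr[OF Ac c(1)] by simp
    moreover have "transpose_mat (Z t0) * A t0 \<in> carrier_mat a n" using Zc Ac by simp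
    ultimately show "c = 0\<^sub>v a" using left_kernel_trivial[OF _ ZA c(1)] by blast
  qed
  have Ta1: "Ta t0 $$ (j, q) = 0" if j: "j < n1" and q: "q < n - a" for j q
  proof (rule a41_cols[of "\<lambda>j. Ta t0 $$ (j, q)", OF _ j])
    fix i assume i: "i \<in> {s..<l}"
    then have im: "i - m < a" "m \<le> i" "i < n" using la size_le by auto
    obtain c where c: "c \<in> carrier_vec a" "Q *\<^sub>v c = unit_vec a (i - m)"
      using square_solvable[OF Qc \<open>Determinant.det Q \<noteq> 0\<close>, of "unit_vec a (i - m)"] by auto
    have Zi: "vec_index (Z t0 *\<^sub>v c) p = (if p = i then 1 else 0)" if "p < l" for p
    proof (cases "p < m")
      case True
      then show ?thesis using Z12[OF c(1)] im by simp
    next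
      case False
      then have "p - m = i - m \<longleftrightarrow> p = i" using im(2) by auto
      then show ?thesis using False Q_vec[OF c(1), of "p - m"] c(2) that la im by (simp del: index_mult_mat_vec)
    qed
    have row: "vec_index (transpose_mat (A t0) *\<^sub>v (Z t0 *\<^sub>v c)) p = A t0 $$ (i, p)" if "p < n" for p
    proof -
      have "vec_index (transpose_mat (A t0) *\<^sub>v (Z t0 *\<^sub>v c)) p = (\<Sum>r<n. A t0 $$ (r, p) * vec_index (Z t0 *\<^sub>v c) r)"
        by (rule A_left_eq[OF t Zcc[OF c(1)] that])
      also have "\<dots> = (\<Sum>r<n. if r = i then A t0 $$ (r, p) else 0)"
      proof (intro sum.cong refl)
        fix r assume "r \<in> {..<n}"
        then show "A t0 $$ (r, p) * vec_index (Z t0 *\<^sub>v c) r = (if r = i then A t0 $$ (r, p) else 0)"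
          using Zi[of r] A_zero[OF t, of r p] that i by (cases "r < l") (auto simp del: index_mult_mat_vec)
      qed
      finally show ?thesis using im by simp
    qed
    have ZAc: "transpose_mat (Z t0) * A t0 \<in> carrier_mat a n" using Zc Ac by simp
    have "transpose_mat (transpose_mat (Z t0) * A t0 * Ta t0) *\<^sub>v c = transpose_mat (Ta t0) *\<^sub>v (transpose_mat (A t0) *\<^sub>v (Z t0 *\<^sub>v c))"
      using transpose_mult[OF ZAc Tac] assoc_mult_mat_vec[of "transpose_mat (Ta t0)" "n - a" n "transpose_mat (transpose_mat (Z t0) * A t0)" a c]
        tr[OF Ac c(1)] Tac ZAc c(1) by simp
    moreover have "transpose_mat (0\<^sub>m a (n - a)) *\<^sub>v c = 0\<^sub>v (n - a)" using c(1) by (intro eq_vecI) auto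
    ultimately have "transpose_mat (Ta t0) *\<^sub>v (transpose_mat (A t0) *\<^sub>v (Z t0 *\<^sub>v c)) = 0\<^sub>v (n - a)"
      using ZAT by simp
    moreover have "transpose_mat (A t0) *\<^sub>v (Z t0 *\<^sub>v c) \<in> carrier_vec n"
      by (rule mult_mat_vec_carrier[OF _ Zcc[OF c(1)]]) (use Ac in simp)
    ultimately have "(\<Sum>p<n. Ta t0 $$ (p, q) * vec_index (transpose_mat (A t0) *\<^sub>v (Z t0 *\<^sub>v c)) p) = 0"
      using q by (simp only: left_kernel_iff[OF Tac])
    then have "(\<Sum>p<n. A t0 $$ (i, p) * Ta t0 $$ (p, q)) = 0"
      by (simp add: row mult.commute del: index_mult_mat_vec)
    moreover have "(\<Sum>p<n. A t0 $$ (i, p) * Ta t0 $$ (p, q)) = (\<Sum>p<n1. A t0 $$ (i, p) * Ta t0 $$ (p, q))"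
      using i size_le A_zero[OF t] by (intro sum_lessThan_eq_sum) auto
    ultimately show "(\<Sum>p<n1. A t0 $$ (i, p) * Ta t0 $$ (p, q)) = 0" by simp
  qed
  define E2 where "E2 = Matrix.mat n n2 (\<lambda>(i, j). E t0 $$ (i, n1 + j))"
  define Ta2 where "Ta2 = Matrix.mat n2 (n - a) (\<lambda>(j, q). Ta t0 $$ (n1 + j, q))"
  have c2: "E2 \<in> carrier_mat n n2" "Ta2 \<in> carrier_mat n2 (n - a)" by (simp_all add: E2_def Ta2_def)
  have "E t0 * Ta t0 = E2 * Ta2"
  proof (rule eq_matI)
    fix i q assume "i < dim_row (E2 * Ta2)" "q < dim_col (E2 * Ta2)"
    then have iq: "i < n" "q < n - a" using c2 by auto
    have "(E t0 * Ta t0) $$ (i, q) = (\<Sum>j<n. E t0 $$ (i, j) * Ta t0 $$ (j, q))"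
      using iq Ec Tac by (simp add: scalar_prod_def atLeast0LessThan)
    also have "\<dots> = (\<Sum>j\<in>{n1..<n1 + n2}. E t0 $$ (i, j) * Ta t0 $$ (j, q))"
    proof (rule sum_lessThan_eq_sum)
      show "E t0 $$ (i, j) * Ta t0 $$ (j, q) = 0" if "j < n" "j \<notin> {n1..<n1 + n2}" for j
        using that Ta1[OF _ iq(2), of j] E_zero[OF t iq(1) that(1)] by (cases "j < n1") (auto simp: sizes)
    qed (auto simp: sizes)
    also have "\<dots> = (\<Sum>j<n2. E t0 $$ (i, n1 + j) * Ta t0 $$ (n1 + j, q))"
      by (rule sum_atLeastLessThan_shift)
    also have "\<dots> = (E2 * Ta2) $$ (i, q)"
      using iq c2 by (simp add: scalar_prod_def atLeast0LessThan E2_def Ta2_def)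
    finally show "(E t0 * Ta t0) $$ (i, q) = (E2 * Ta2) $$ (i, q)" .
  qed (use Ec Tac c2 in auto)
  then have "mat_rank (E t0 * Ta t0) \<le> n2"
    using mat_rank_mult_le[OF c2] mat_rank_le_cols[OF c2(1)] by simp
  moreover have "int (mat_rank (E t0 * Ta t0)) = int m"
    using hyp(7) t v la by (auto simp: sizes(4))
  ultimately show False using n1 by (simp add: sizes(1))
qed

subsection \<open>Order 1\<close>

lemma order1: "(1 + 1) * n = n + n" by simp

lemma infl_E_1_at:
  assumes "t \<in> T" "i < n" "j < n"
  shows "infl_E T n E A 1 t $$ (i, j) = E t $$ (i, j)"
    "infl_E T n E A 1 t $$ (i, n + j) = 0"
    "infl_E T n E A 1 t $$ (n + i, j) = mat_nderiv T 1 E t $$ (i, j) - A t $$ (i, j)"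
    "infl_E T n E A 1 t $$ (n + i, n + j) = E t $$ (i, j)"
  using infl_E_1_entry[of E t n A i j T] carriers[OF assms(1)] assms by auto

lemma infl_A_col_1_at:
  assumes "t \<in> T" "i < n" "j < n"
  shows "infl_A_col T n A 1 t $$ (i, j) = A t $$ (i, j)"
    "infl_A_col T n A 1 t $$ (n + i, j) = mat_nderiv T 1 A t $$ (i, j)"
  using infl_A_col_1_entry[of A t n i j T] carriers[OF assms(1)] assms by auto

lemma infl_E_1_left_kernel:
  assumes t: "t \<in> T" and x: "x \<in> carrier_vec (n + n)"
  shows "transpose_mat (infl_E T n E A 1 t) *\<^sub>v x = 0\<^sub>v (n + n) \<longleftrightarrow>
    block_pattern.left_kernel1 n (\<lambda>i j. E t $$ (i, j)) (\<lambda>i j. A t $$ (i, j)) (\<lambda>i j. mat_nderiv T 1 E t $$ (i, j))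
      (vec_index x) (\<lambda>i. vec_index x (n + i))"
proof -
  interpret block_pattern n1 n2 n3 n5 m s l n "\<lambda>i j. E t $$ (i, j)" "\<lambda>i j. A t $$ (i, j)"
    "\<lambda>i j. mat_nderiv T 1 E t $$ (i, j)" "\<lambda>i j. mat_nderiv T 1 A t $$ (i, j)"
    by (rule block_pattern_at[OF t])
  have c: "infl_E T n E A 1 t \<in> carrier_mat (n + n) (n + n)"
    using infl_E_carrier[of T n E A 1 t] unfolding order1 .
  note ent = infl_E_1_at[OF t]
  have "(\<Sum>i<n + n. infl_E T n E A 1 t $$ (i, j) * vec_index x i)
      = (\<Sum>i<n. E t $$ (i, j) * vec_index x i)
        + (\<Sum>i<n. (mat_nderiv T 1 E t $$ (i, j) - A t $$ (i, j)) * vec_index x (n + i))"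
    "(\<Sum>i<n + n. infl_E T n E A 1 t $$ (i, n + j) * vec_index x i)
      = (\<Sum>i<n. E t $$ (i, j) * vec_index x (n + i))" if "j < n" for j
    unfolding sum_lessThan_add using that by (simp_all add: ent)
  moreover have "(\<forall>j<n + n. P j) \<longleftrightarrow> (\<forall>j<n. P j) \<and> (\<forall>j<n. P (n + j))" for P
  proof (intro iffI allI impI; (elim conjE)?)
    fix j assume "\<forall>j<n. P j" "\<forall>j<n. P (n + j)" "j < n + n"
    then show "P j" by (cases "j < n") (auto dest: spec[of _ "j - n"])
  qed auto
  ultimately show ?thesis
    unfolding left_kernel_iff[OF c x] left_kernel1_def by simp
qed

lemma infl_A_col_1_left_kernel:
  assumes t: "t \<in> T" and x: "x \<in> carrier_vec (n + n)" and j: "j < n"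
  shows "vec_index (transpose_mat (infl_A_col T n A 1 t) *\<^sub>v x) j
    = (\<Sum>i<n. A t $$ (i, j) * vec_index x i) + (\<Sum>i<n. mat_nderiv T 1 A t $$ (i, j) * vec_index x (n + i))"
proof -
  have c: "infl_A_col T n A 1 t \<in> carrier_mat (n + n) n"
    using infl_A_col_carrier[of T n A 1 t] unfolding order1 .
  show ?thesis
    unfolding mult_transpose_vec_index_sum[OF c x j] sum_lessThan_add
    using j by (simp add: infl_A_col_1_at[OF t])
qed

text \<open>
  The left kernel of the inflated \<open>E\<close>: the first \<open>m\<close> columns determine \<open>y1\<close>, \<open>y2\<close> by all other
  coordinates. Column \<open>q\<close> of \<open>X\<close> has \<open>\<delta>\<close> in coordinate \<open>m + q\<close> and \<open>0\<close> in the other ones from \<open>m\<close> on.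
\<close>

lemma infl_E_1_left_kernel_basis:
  "\<exists>X \<delta>. Ck_mat (k - 1) T (n + n) (n + n - m) X \<and> (\<forall>t\<in>T. \<delta> t \<noteq> 0 \<and>
    (\<forall>i<n + n - m. \<forall>j<n + n - m. X t $$ (m + i, j) = (if i = j then \<delta> t else 0)) \<and>
    (\<forall>c\<in>carrier_vec (n + n - m). (\<forall>i<s. vec_index (X t *\<^sub>v c) (n + i) = 0) \<longrightarrow>
      transpose_mat (infl_E T n E A 1 t) *\<^sub>v (X t *\<^sub>v c) = 0\<^sub>v (n + n)))"
proof -
  define M where "M t = Matrix.mat m (n + n) (\<lambda>(i, j). infl_E T n E A 1 t $$ (j, i))" for t
  have Mc: "M t \<in> carrier_mat m (n + n)" for t by (simp add: M_def)
  have m_le: "m \<le> n + n" "m \<le> n" using size_le by auto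
  have smooth: "Ck_mat (k - 1) T m (n + n) M"
  proof (rule Ck_matI[where f = "\<lambda>i j t. if j < n then E t $$ (j, i)
      else nderiv T 1 (\<lambda>r. E r $$ (j - n, i)) t - A t $$ (j - n, i)"])
    fix t i j assume t: "t \<in> T" and ij: "i < m" "j < n + n"
    show "M t $$ (i, j) = (if j < n then E t $$ (j, i) else nderiv T 1 (\<lambda>r. E r $$ (j - n, i)) t - A t $$ (j - n, i))"
    proof (cases "j < n")
      case True
      then show ?thesis
        using ij m_le infl_E_1_at(1)[OF t, of j i] by (simp add: M_def)
    next
      case False
      then have "j - n < n" "i < n" "j = n + (j - n)" using ij m_le by auto
      then show ?thesis
        using ij False infl_E_1_at(3)[OF t, of "j - n" i]
          mat_nderiv_entry[where M = E, OF carriers(1)[OF t], of "j - n" i T 1] by (simp add: M_def)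
    qed
  next
    fix i j assume ij: "i < m" "j < n + n"
    have k1: "k - 1 \<le> k" by (cases k) (auto simp: one_enat_def)
    show "Ck_on (k - 1) T (\<lambda>t. if j < n then E t $$ (j, i)
      else nderiv T 1 (\<lambda>r. E r $$ (j - n, i)) t - A t $$ (j - n, i))"
    proof (cases "j < n")
      case True
      then show ?thesis
        using ij m_le Ck_on_mono[OF Ck_mat_entry[OF E_smooth, of j i] k1] by simp
    next
      case False
      then have "j - n < n" "i < n" using ij m_le by auto
      then have "Ck_on (k - 1) T (\<lambda>t. nderiv T 1 (\<lambda>r. E r $$ (j - n, i)) t - A t $$ (j - n, i))"
        by (intro Ck_on_diff Ck_on_nderiv[OF Ck_mat_entry[OF E_smooth] k] Ck_on_mono[OF Ck_mat_entry[OF A_smooth] k1])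
      then show ?thesis using False by simp
    qed
  qed (rule Mc)
  let ?basis = "\<lambda>X \<delta>. Ck_mat (k - 1) T (n + n) (n + n - m) X \<and> (\<forall>t\<in>T. M t * X t = 0\<^sub>m m (n + n - m) \<and> \<delta> t \<noteq> 0 \<and>
    (\<forall>i<n + n - m. \<forall>j<n + n - m. X t $$ (m + i, j) = (if i = j then \<delta> t else 0)) \<and>
    (\<forall>x\<in>carrier_vec (n + n). M t *\<^sub>v x = 0\<^sub>v m \<longrightarrow> (\<forall>i<n + n - m. vec_index x (m + i) = 0) \<longrightarrow> x = 0\<^sub>v (n + n)))"
  have "\<exists>X \<delta>. ?basis X \<delta>"
  proof (rule smooth_kernel_basis[OF smooth m_le(1)])
    show "c = 0\<^sub>v m" if t: "t \<in> T" and c: "c \<in> carrier_vec m" and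
      cols: "\<And>j. j < n + n \<Longrightarrow> j \<notin> (+) m ` {..<n + n - m} \<Longrightarrow> vec_index (transpose_mat (M t) *\<^sub>v c) j = 0" for t c
    proof -
      interpret block_pattern n1 n2 n3 n5 m s l n "\<lambda>i j. E t $$ (i, j)" "\<lambda>i j. A t $$ (i, j)"
        "\<lambda>i j. mat_nderiv T 1 E t $$ (i, j)" "\<lambda>i j. mat_nderiv T 1 A t $$ (i, j)"
        by (rule block_pattern_at[OF t])
      have "vec_index c i = 0" if "i < m" for i
      proof (rule e_definite[OF _ that])
        have "(\<Sum>i<m. E t $$ (j, i) * vec_index c i) = 0" if j: "j < m" for j
        proof -
          have "vec_index (transpose_mat (M t) *\<^sub>v c) j = 0"
            by (rule cols) (use j m_le in auto)
          then have "(\<Sum>i<m. M t $$ (i, j) * vec_index c i) = 0"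
            using mult_transpose_vec_index_sum[OF Mc c, of j t] j m_le by simp
          moreover have "M t $$ (i, j) = E t $$ (j, i)" if "i < m" for i
            using that j m_le infl_E_1_at(1)[OF t, of j i] by (simp add: M_def)
          ultimately show ?thesis by simp
        qed
        then show "(\<Sum>i<m. vec_index c i * (\<Sum>j<m. E t $$ (i, j) * vec_index c j)) = 0" by simp
      qed
      then show ?thesis using c by (intro eq_vecI) auto
    qed
  qed auto
  then obtain X \<delta> where "?basis X \<delta>" by blast
  then have X: "Ck_mat (k - 1) T (n + n) (n + n - m) X" "\<And>t. t \<in> T \<Longrightarrow> M t * X t = 0\<^sub>m m (n + n - m)"
      "\<And>t. t \<in> T \<Longrightarrow> \<delta> t \<noteq> 0"
      "\<And>t. t \<in> T \<Longrightarrow> \<forall>i<n + n - m. \<forall>j<n + n - m. X t $$ (m + i, j) = (if i = j then \<delta> t else 0)"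
    by blast+
  have "transpose_mat (infl_E T n E A 1 t) *\<^sub>v (X t *\<^sub>v c) = 0\<^sub>v (n + n)"
    if t: "t \<in> T" and c: "c \<in> carrier_vec (n + n - m)" and w: "\<forall>i<s. vec_index (X t *\<^sub>v c) (n + i) = 0" for t c
  proof -
    interpret block_pattern n1 n2 n3 n5 m s l n "\<lambda>i j. E t $$ (i, j)" "\<lambda>i j. A t $$ (i, j)"
      "\<lambda>i j. mat_nderiv T 1 E t $$ (i, j)" "\<lambda>i j. mat_nderiv T 1 A t $$ (i, j)"
      by (rule block_pattern_at[OF t])
    have Xc: "X t \<in> carrier_mat (n + n) (n + n - m)" by (rule Ck_mat_carrier[OF X(1) t])
    define x where "x = X t *\<^sub>v c"
    have x: "x \<in> carrier_vec (n + n)" using Xc c by (simp add: x_def)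
    have "M t *\<^sub>v x = 0\<^sub>m m (n + n - m) *\<^sub>v c"
      unfolding x_def assoc_mult_mat_vec[OF Mc Xc c, symmetric] X(2)[OF t] ..
    also have "\<dots> = 0\<^sub>v m" using c by (intro eq_vecI) auto
    finally have Mx: "(\<Sum>j<n + n. M t $$ (i, j) * vec_index x j) = 0" if "i < m" for i
      using that right_kernel_iff[OF Mc x] by blast
    note ent = infl_E_1_at[OF t]
    have "left_kernel1 (vec_index x) (\<lambda>i. vec_index x (n + i))"
    proof (rule left_kernel1I)
      fix j assume j: "j < m"
      have "(\<Sum>i<n. E t $$ (i, j) * vec_index x i)
          + (\<Sum>i<n. (mat_nderiv T 1 E t $$ (i, j) - A t $$ (i, j)) * vec_index x (n + i))
          = (\<Sum>i<n + n. M t $$ (j, i) * vec_index x i)"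
        unfolding sum_lessThan_add using j m_le by (simp add: M_def ent)
      then show "(\<Sum>i<n. E t $$ (i, j) * vec_index x i)
          + (\<Sum>i<n. (mat_nderiv T 1 E t $$ (i, j) - A t $$ (i, j)) * vec_index x (n + i)) = 0"
        using Mx[OF j] by simp
    qed (use w in \<open>simp add: x_def\<close>)
    then show ?thesis using infl_E_1_left_kernel[OF t x] by (simp only: x_def)
  qed
  with X show ?thesis by blast
qed

lemma rank_infl_EA_1:
  assumes t: "t \<in> T"
  shows "mat_rank (infl_EA T n E A 1 t) = l + l"
proof -
  interpret block_pattern n1 n2 n3 n5 m s l n "\<lambda>i j. E t $$ (i, j)" "\<lambda>i j. A t $$ (i, j)"
    "\<lambda>i j. mat_nderiv T 1 E t $$ (i, j)" "\<lambda>i j. mat_nderiv T 1 A t $$ (i, j)"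
    by (rule block_pattern_at[OF t])
  let ?S = "{l..<n} \<union> {n + l..<n + n}"
  have c: "infl_EA T n E A 1 t \<in> carrier_mat (n + n) (n + n + (n + n))"
    using infl_EA_carrier[of T n E A 1 t] unfolding order1 .
  have cA: "infl_A_col T n A 1 t \<in> carrier_mat (n + n) n"
    using infl_A_col_carrier[of T n A 1 t] unfolding order1 .
  have ker: "transpose_mat (infl_EA T n E A 1 t) *\<^sub>v x = 0\<^sub>v (n + n + (n + n)) \<longleftrightarrow>
      left_kernel1 (vec_index x) (\<lambda>i. vec_index x (n + i)) \<and>
      (\<forall>j<n. (\<Sum>i<n. A t $$ (i, j) * vec_index x i) + (\<Sum>i<n. mat_nderiv T 1 A t $$ (i, j) * vec_index x (n + i)) = 0)"
    if x: "x \<in> carrier_vec (n + n)" for x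
  proof -
    have "transpose_mat (infl_A_col T n A 1 t) *\<^sub>v x = 0\<^sub>v n
        \<longleftrightarrow> (\<forall>j<n. vec_index (transpose_mat (infl_A_col T n A 1 t) *\<^sub>v x) j = 0)"
      using cA by (auto simp: vec_eq_iff)
    then show ?thesis
      using infl_EA_left_kernel[of x 1 n T E A t, unfolded order1, OF x] infl_E_1_left_kernel[OF t x]
        infl_A_col_1_left_kernel[OF t x] by simp
  qed
  have "mat_rank (infl_EA T n E A 1 t) = n + n - card ?S"
  proof (rule mat_rank_left_free[OF c])
    fix x assume x: "x \<in> carrier_vec (n + n)" "transpose_mat (infl_EA T n E A 1 t) *\<^sub>v x = 0\<^sub>v (n + n + (n + n))"
      "\<And>i. i \<in> ?S \<Longrightarrow> vec_index x i = 0"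
    have low: "vec_index x i = 0" "vec_index x (n + i) = 0" if "i < l" for i
      using left_kernel1_zero[of "vec_index x" "\<lambda>i. vec_index x (n + i)" i] x(2) that size_le
      by (auto simp: ker[OF x(1)])
    have "vec_index x i = 0" if "i < n + n" for i
    proof (cases "i < n")
      case True
      then show ?thesis using low(1)[of i] x(3)[of i] by (cases "i < l") auto
    next
      case False
      then show ?thesis using low(2)[of "i - n"] x(3)[of i] that by (cases "i - n < l") auto
    qed
    then show "x = 0\<^sub>v (n + n)" using x(1) by (intro eq_vecI) auto
  next
    fix p assume p: "p \<in> ?S"
    show "\<exists>x\<in>carrier_vec (n + n). transpose_mat (infl_EA T n E A 1 t) *\<^sub>v x = 0\<^sub>v (n + n + (n + n))
        \<and> (\<forall>j\<in>?S. vec_index x j = (if j = p then 1 else 0))"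
    proof (intro bexI[of _ "unit_vec (n + n) p"] conjI)
      let ?u = "unit_vec (n + n) p :: real Matrix.vec"
      have u: "vec_index ?u i = 0" "vec_index ?u (n + i) = 0" if "i < l" for i
        using that p size_le by auto
      have row: "f i * vec_index ?u i = 0" "f i * vec_index ?u (n + i) = 0"
        if "i < n" "l \<le> i \<Longrightarrow> f i = 0" for f :: "nat \<Rightarrow> real" and i
        using u[of i] that by (cases "i < l"; simp)+
      have A0: "A t $$ (i, j) = 0" "mat_nderiv T 1 A t $$ (i, j) = 0"
        "E t $$ (i, j) = 0" "mat_nderiv T 1 E t $$ (i, j) = 0" if "l \<le> i" "i < n" "j < n" for i j
        using that size_le a_zero a'_zero e_zero e'_zero by auto
      have sums: "(\<Sum>i<n. E t $$ (i, j) * vec_index ?u i) = 0" "(\<Sum>i<n. E t $$ (i, j) * vec_index ?u (n + i)) = 0"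
        "(\<Sum>i<n. A t $$ (i, j) * vec_index ?u i) = 0" "(\<Sum>i<n. mat_nderiv T 1 A t $$ (i, j) * vec_index ?u (n + i)) = 0"
        "(\<Sum>i<n. (mat_nderiv T 1 E t $$ (i, j) - A t $$ (i, j)) * vec_index ?u (n + i)) = 0"
        if "j < n" for j
        by (intro sum.neutral ballI row; use that A0 in simp)+
      show "transpose_mat (infl_EA T n E A 1 t) *\<^sub>v ?u = 0\<^sub>v (n + n + (n + n))"
        unfolding ker[OF unit_vec_carrier] left_kernel1_def using sums by (simp del: index_unit_vec)
    qed (use p in auto)
  qed (use size_le in auto)
  moreover have "card ?S = (n - l) + (n - l)"
    by (subst card_Un_disjoint) auto
  ultimately show ?thesis using size_le by simp
qed

text \<open>
  The constraints of order 1 are the third and fourth block rows of the equation and the derivative of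
  the fourth one, from which the derivatives of \<open>z1\<close> and \<open>z2\<close> are eliminated. Accordingly, \<open>Z\<close> consists
  of the columns of the kernel basis \<open>X\<close> for \<open>y3\<close>, \<open>y4\<close> and \<open>w4\<close>.
\<close>

lemma strangeness_hyp_1: "strangeness_hyp k T n E A 1"
proof -
  let ?a = "(l - m) + n1"
  obtain X \<delta> where "Ck_mat (k - 1) T (n + n) (n + n - m) X \<and> (\<forall>t\<in>T. \<delta> t \<noteq> 0 \<and>
    (\<forall>i<n + n - m. \<forall>j<n + n - m. X t $$ (m + i, j) = (if i = j then \<delta> t else 0)) \<and>
    (\<forall>c\<in>carrier_vec (n + n - m). (\<forall>i<s. vec_index (X t *\<^sub>v c) (n + i) = 0) \<longrightarrow>
      transpose_mat (infl_E T n E A 1 t) *\<^sub>v (X t *\<^sub>v c) = 0\<^sub>v (n + n)))"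
    using infl_E_1_left_kernel_basis by blast
  then have X: "Ck_mat (k - 1) T (n + n) (n + n - m) X"
    "\<And>t. t \<in> T \<Longrightarrow> \<delta> t \<noteq> 0"
    "\<And>t i j. t \<in> T \<Longrightarrow> i < n + n - m \<Longrightarrow> j < n + n - m \<Longrightarrow> X t $$ (m + i, j) = (if i = j then \<delta> t else 0)"
    "\<And>t c. t \<in> T \<Longrightarrow> c \<in> carrier_vec (n + n - m) \<Longrightarrow> (\<And>i. i < s \<Longrightarrow> vec_index (X t *\<^sub>v c) (n + i) = 0)
      \<Longrightarrow> transpose_mat (infl_E T n E A 1 t) *\<^sub>v (X t *\<^sub>v c) = 0\<^sub>v (n + n)"
    by blast+
  have Xc: "X t \<in> carrier_mat (n + n) (n + n - m)" if "t \<in> T" for t by (rule Ck_mat_carrier[OF X(1) that])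
  have X_vec: "vec_index (X t *\<^sub>v c) (m + i) = \<delta> t * vec_index c i"
    if t: "t \<in> T" and c: "c \<in> carrier_vec (n + n - m)" and i: "i < n + n - m" for t c i
  proof -
    have "m + i < n + n" using i by simp
    have "vec_index (X t *\<^sub>v c) (m + i) = (\<Sum>j<n + n - m. X t $$ (m + i, j) * vec_index c j)"
      by (rule mult_mat_vec_index_sum[OF Xc[OF t] c \<open>m + i < n + n\<close>])
    also have "\<dots> = (\<Sum>j<n + n - m. if i = j then \<delta> t * vec_index c j else 0)"
      using X(3)[OF t i] by (intro sum.cong) auto
    finally show ?thesis using i by simp
  qed
  have rank_E1: "mat_rank (infl_E T n E A 1 t) = m + s" if t: "t \<in> T" for t
  proof -
    interpret block_pattern n1 n2 n3 n5 m s l n "\<lambda>i j. E t $$ (i, j)" "\<lambda>i j. A t $$ (i, j)"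
      "\<lambda>i j. mat_nderiv T 1 E t $$ (i, j)" "\<lambda>i j. mat_nderiv T 1 A t $$ (i, j)"
      by (rule block_pattern_at[OF t])
    let ?S = "{m..<n} \<union> {n + s..<n + n}"
    have c: "infl_E T n E A 1 t \<in> carrier_mat (n + n) (n + n)"
      using infl_E_carrier[of T n E A 1 t] unfolding order1 .
    have "mat_rank (infl_E T n E A 1 t) = n + n - card ?S"
    proof (rule mat_rank_left_free[OF c])
      fix x assume x: "x \<in> carrier_vec (n + n)" "transpose_mat (infl_E T n E A 1 t) *\<^sub>v x = 0\<^sub>v (n + n)"
        "\<And>i. i \<in> ?S \<Longrightarrow> vec_index x i = 0"
      have ker: "left_kernel1 (vec_index x) (\<lambda>i. vec_index x (n + i))"
        using infl_E_1_left_kernel[OF t x(1)] x(2) by simp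
      have w: "vec_index x (n + i) = 0" if "i < n" for i
        using left_kernel1_w_zero[OF ker, of i] x(3)[of "n + i"] that by (cases "i < s") auto
      have y: "vec_index x i = 0" if "i < m" for i
      proof (rule e_injective[OF _ that])
        fix j assume j: "j < m"
        then have "j < n" using size_le by simp
        then show "(\<Sum>i<n. E t $$ (i, j) * vec_index x i) = 0"
          using ker w unfolding left_kernel1_def by simp
      qed
      have "vec_index x i = 0" if i: "i < n + n" for i
      proof -
        consider "i < m" | "m \<le> i" "i < n" | "n \<le> i" by linarith
        then show ?thesis
        proof cases
          case 3
          then show ?thesis using w[of "i - n"] i by simp
        qed (use y x(3) in auto)
      qed
      then show "x = 0\<^sub>v (n + n)" using x(1) by (intro eq_vecI) auto
    next
      fix p assume p: "p \<in> ?S"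
      let ?u = "unit_vec (n + n - m) (p - m) :: real Matrix.vec"
      let ?x = "(1 / \<delta> t) \<cdot>\<^sub>v (X t *\<^sub>v ?u)"
      have pm: "m \<le> p" "p < n + n" using p size_le by auto
      have Xu: "X t *\<^sub>v ?u \<in> carrier_vec (n + n)" using Xc[OF t] by simp
      have ent: "vec_index (X t *\<^sub>v ?u) j = (if j = p then \<delta> t else 0)" if "m \<le> j" "j < n + n" for j
      proof -
        have "j - m < n + n - m" "p - m < n + n - m" "j - m = p - m \<longleftrightarrow> j = p" using that pm by auto
        then show ?thesis using X_vec[OF t unit_vec_carrier, of "j - m" "p - m"] that by simp
      qed
      show "\<exists>x\<in>carrier_vec (n + n). transpose_mat (infl_E T n E A 1 t) *\<^sub>v x = 0\<^sub>v (n + n)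
          \<and> (\<forall>j\<in>?S. vec_index x j = (if j = p then 1 else 0))"
      proof (intro bexI[of _ ?x] conjI)
        have "vec_index (X t *\<^sub>v ?u) (n + i) = 0" if "i < s" for i
          using ent[of "n + i"] p that size_le by auto
        then have "transpose_mat (infl_E T n E A 1 t) *\<^sub>v (X t *\<^sub>v ?u) = 0\<^sub>v (n + n)"
          using X(4)[OF t unit_vec_carrier] by blast
        moreover have "transpose_mat (infl_E T n E A 1 t) *\<^sub>v ?x
            = (1 / \<delta> t) \<cdot>\<^sub>v (transpose_mat (infl_E T n E A 1 t) *\<^sub>v (X t *\<^sub>v ?u))"
          by (rule mult_mat_vec[OF _ Xu]) (use c in simp)
        ultimately show "transpose_mat (infl_E T n E A 1 t) *\<^sub>v ?x = 0\<^sub>v (n + n)"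
          by (simp only:) (intro eq_vecI; simp)
        show "\<forall>j\<in>?S. vec_index ?x j = (if j = p then 1 else 0)"
        proof
          fix j assume "j \<in> ?S"
          then have "m \<le> j" "j < n + n" using size_le by auto
          then show "vec_index ?x j = (if j = p then 1 else 0)"
            using ent[of j] X(2)[OF t] carrier_vecD[OF Xu] by (simp del: index_mult_mat_vec)
        qed
      qed (use Xu in simp)
    qed (use size_le in auto)
    moreover have "card ?S = (n - m) + (n - s)" by (subst card_Un_disjoint) auto
    ultimately show ?thesis using size_le by simp
  qed
  \<comment> \<open>Column \<open>\<kappa> p\<close> of \<open>X\<close> belongs to coordinate \<open>m + \<kappa> p\<close>: from \<open>m\<close> to \<open>l - 1\<close> for \<open>y3\<close> and \<open>y4\<close>,
    then from \<open>n + s\<close> to \<open>n + l - 1\<close> for \<open>w4\<close>.\<close>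
  define \<kappa> where "\<kappa> p = (if p < l - m then p else (n + s - m) + (p - (l - m)))" for p
  have \<kappa>: "\<kappa> p < n + n - m" if "p < ?a" for p using that size_le by (auto simp: \<kappa>_def sizes(3))
  have \<kappa>_eq: "\<kappa> p = \<kappa> q \<longleftrightarrow> p = q" if "p < ?a" "q < ?a" for p q
    using that size_le unfolding \<kappa>_def by (simp split: if_splits) linarith
  define Q where "Q = Matrix.mat (n + n - m) ?a (\<lambda>(i, p). if i = \<kappa> p then 1 else 0 :: real)"
  define Z where "Z t = X t * Q" for t
  have Qc: "Q \<in> carrier_mat (n + n - m) ?a" by (simp add: Q_def)
  have Q_vec: "vec_index (Q *\<^sub>v c) i = (\<Sum>p<?a. if i = \<kappa> p then vec_index c p else 0)"
    if "c \<in> carrier_vec ?a" "i < n + n - m" for c i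
    unfolding mult_mat_vec_index_sum[OF Qc that] using that(2) by (intro sum.cong) (auto simp: Q_def)
  have Q_\<kappa>: "vec_index (Q *\<^sub>v c) (\<kappa> q) = vec_index c q" if "c \<in> carrier_vec ?a" "q < ?a" for c q
  proof -
    have "vec_index (Q *\<^sub>v c) (\<kappa> q) = (\<Sum>p<?a. if p = q then vec_index c p else 0)"
      unfolding Q_vec[OF that(1) \<kappa>[OF that(2)]] using \<kappa>_eq that(2) by (intro sum.cong) auto
    then show ?thesis using that(2) by simp
  qed
  have Q_zero: "vec_index (Q *\<^sub>v c) i = 0"
    if "c \<in> carrier_vec ?a" "i < n + n - m" "\<And>p. p < ?a \<Longrightarrow> i \<noteq> \<kappa> p" for c i
    unfolding Q_vec[OF that(1,2)] using that(3) by (intro sum.neutral) auto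
  have Zc: "Z t \<in> carrier_mat (n + n) ?a" if "t \<in> T" for t
    unfolding Z_def using Xc[OF that] Qc by simp
  have Z_eq: "Z t *\<^sub>v c = X t *\<^sub>v (Q *\<^sub>v c)" "Q *\<^sub>v c \<in> carrier_vec (n + n - m)" if "t \<in> T" "c \<in> carrier_vec ?a" for t c
    unfolding Z_def using assoc_mult_mat_vec[OF Xc[OF that(1)] Qc that(2)] Qc that(2) by simp_all
  have Z_ker: "transpose_mat (infl_E T n E A 1 t) *\<^sub>v (Z t *\<^sub>v c) = 0\<^sub>v (n + n)"
    if t: "t \<in> T" and c: "c \<in> carrier_vec ?a" for t c
    unfolding Z_eq(1)[OF t c]
  proof (rule X(4)[OF t Z_eq(2)[OF t c]])
    fix i assume i: "i < s"
    have "n + i - m < n + n - m" "\<And>p. p < ?a \<Longrightarrow> n + i - m \<noteq> \<kappa> p"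
      using i size_le by (auto simp: \<kappa>_def)
    then show "vec_index (X t *\<^sub>v (Q *\<^sub>v c)) (n + i) = 0"
      using X_vec[OF t Z_eq(2)[OF t c], of "n + i - m"] Q_zero[OF c, of "n + i - m"] size_le
      by (simp del: index_mult_mat_vec)
  qed
  have k1: "k - 1 \<le> k" by (cases k) (auto simp: one_enat_def)
  have one: "enat 1 = 1" by (simp add: one_enat_def)
  show ?thesis
  proof (rule strangeness_hypI[where \<mu> = 1 and n = n and a = ?a and b = "n2 + n5" and v = n5 and r = "int (l + l)" and \<rho> = free_coord
        and Z = Z, unfolded one order1])
    show "1 \<le> k" by (rule k)
    show "Ck_mat (k - 1) T (n + n) ?a Z"
      unfolding Z_def
      by (rule Ck_mat_mult[OF X(1)], rule Ck_matI[where f = "\<lambda>i j t. Q $$ (i, j)"]) (use Qc in auto)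
    show "Ck_mat (k - 1) T (n + n) n (infl_A_col T n A 1)"
    proof (rule Ck_matI[where f = "\<lambda>i j t. if i < n then A t $$ (i, j) else nderiv T 1 (\<lambda>r. A r $$ (i - n, j)) t"])
      show "infl_A_col T n A 1 t \<in> carrier_mat (n + n) n" for t
        using infl_A_col_carrier[of T n A 1 t] unfolding order1 .
      fix i j assume ij: "i < n + n" "j < n"
      show "infl_A_col T n A 1 t $$ (i, j) = (if i < n then A t $$ (i, j) else nderiv T 1 (\<lambda>r. A r $$ (i - n, j)) t)"
        if "t \<in> T" for t
      proof (cases "i < n")
        case True
        then show ?thesis using infl_A_col_1_at(1)[OF that True ij(2)] by simp
      next
        case False
        then have "i - n < n" "i = n + (i - n)" using ij by auto
        then show ?thesis
          using False infl_A_col_1_at(2)[OF that \<open>i - n < n\<close> ij(2)]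
            mat_nderiv_entry[where M = A, OF carriers(5)[OF that] \<open>i - n < n\<close> ij(2), of T 1] by simp
      qed
      show "Ck_on (k - 1) T (\<lambda>t. if i < n then A t $$ (i, j) else nderiv T 1 (\<lambda>r. A r $$ (i - n, j)) t)"
        using ij Ck_on_mono[OF Ck_mat_entry[OF A_smooth, of i j] k1]
          Ck_on_nderiv[OF Ck_mat_entry[OF A_smooth, of "i - n" j] k] by (cases "i < n") auto
    qed
    show "?a + (n2 + n5) = n" using size_le by (simp add: sizes)
    show "n5 \<le> n2 + n5" by simp
    show "inj_on free_coord {..<n2 + n5}" "free_coord ` {..<n2 + n5} \<subseteq> {..<n}" by (rule free_coord)+
    fix t assume t: "t \<in> T"
    interpret block_pattern n1 n2 n3 n5 m s l n "\<lambda>i j. E t $$ (i, j)" "\<lambda>i j. A t $$ (i, j)"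
      "\<lambda>i j. mat_nderiv T 1 E t $$ (i, j)" "\<lambda>i j. mat_nderiv T 1 A t $$ (i, j)"
      by (rule block_pattern_at[OF t])
    show "int (mat_rank (infl_EA T n E A 1 t)) = int (l + l)" by (simp add: rank_infl_EA_1[OF t])
    show "corank (infl_EA T n E A 1 t) - (if 1 = (0::nat) then 0 else corank (infl_EA T n E A (1 - 1) t)) = int n5"
    proof -
      have "dim_row (infl_EA T n E A 1 t) = n + n"
        using carrier_matD(1)[OF infl_EA_carrier[of T n E A 1 t]] unfolding order1 .
      then have "corank (infl_EA T n E A 1 t) = int (n + n) - int (l + l)"
        unfolding corank_def rank_infl_EA_1[OF t] by simp
      then show ?thesis using corank_infl_EA_0[OF t] by (simp add: sizes(4))
    qed
    show "int (mat_rank (infl_E T n E A 1 t)) = int (l + l) - int ?a"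
      unfolding rank_E1[OF t] using size_le by (simp add: sizes(3))
    show "transpose_mat (Z t) * infl_E T n E A 1 t = 0\<^sub>m ?a (n + n)"
    proof -
      have c: "infl_E T n E A 1 t \<in> carrier_mat (n + n) (n + n)"
        using infl_E_carrier[of T n E A 1 t] unfolding order1 .
      have "transpose_mat (infl_E T n E A 1 t) * Z t = 0\<^sub>m (n + n) ?a"
      proof (rule mat_col_eqI)
        fix p assume "p < dim_col (0\<^sub>m (n + n) ?a)"
        then have p: "p < ?a" by simp
        have "col (transpose_mat (infl_E T n E A 1 t) * Z t) p
            = transpose_mat (infl_E T n E A 1 t) *\<^sub>v (Z t *\<^sub>v unit_vec ?a p)"
          using col_mult2[OF _ Zc[OF t] p, of "transpose_mat (infl_E T n E A 1 t)" "n + n"] c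
          by (simp add: mult_mat_unit_vec[OF Zc[OF t] p])
        then show "col (transpose_mat (infl_E T n E A 1 t) * Z t) p = col (0\<^sub>m (n + n) ?a) p"
          using Z_ker[OF t unit_vec_carrier] p by simp
      qed (use c Zc[OF t] in auto)
      then have "transpose_mat (transpose_mat (infl_E T n E A 1 t) * Z t) = 0\<^sub>m ?a (n + n)" by simp
      then show ?thesis
        using transpose_mult[of "transpose_mat (infl_E T n E A 1 t)" "n + n" "n + n" "Z t" ?a] c Zc[OF t] by simp
    qed
    show "E t \<in> carrier_mat n n" by (rule carriers[OF t])
    show "vec_index x (free_coord i) = 0"
      if "x \<in> carrier_vec n" "E t *\<^sub>v x = 0\<^sub>v n" "i < n2 + n5 - n5" for x i
      using E_kernel[OF t that(1,2) free_coord_head] that(3) by simp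
    show "E t *\<^sub>v unit_vec n (free_coord i) = 0\<^sub>v n" if "n2 + n5 - n5 \<le> i" "i < n2 + n5" for i
      using that free_coord_tail[of i] E_zero[OF t] size_le by (intro zero_column[OF carriers(1)[OF t]]) auto
    show "infl_A_col T n A 1 t *\<^sub>v unit_vec n (free_coord i) = 0\<^sub>v (n + n)"
      if "n2 + n5 - n5 \<le> i" "i < n2 + n5" for i
    proof (rule zero_column)
      show "infl_A_col T n A 1 t \<in> carrier_mat (n + n) n"
        using infl_A_col_carrier[of T n A 1 t] unfolding order1 .
      have fc: "l \<le> free_coord i" "free_coord i < n" using that free_coord_tail[of i] by auto
      then show "free_coord i < n" by simp
      show "infl_A_col T n A 1 t $$ (p, free_coord i) = 0" if "p < n + n" for p
      proof (cases "p < n")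
        case True
        then show ?thesis
          using infl_A_col_1_at(1)[OF t True fc(2)] a_zero[OF True fc(2)] fc(1) by simp
      next
        case False
        then have "p - n < n" "p = n + (p - n)" using that by auto
        then show ?thesis
          using infl_A_col_1_at(2)[OF t \<open>p - n < n\<close> fc(2)] a'_zero[OF \<open>p - n < n\<close> fc(2)] fc(1) by simp
      qed
    qed
    show "c = 0\<^sub>v ?a" if c: "c \<in> carrier_vec ?a" and
      cols: "\<And>j. j < n \<Longrightarrow> j \<notin> free_coord ` {..<n2 + n5}
        \<Longrightarrow> vec_index (transpose_mat (infl_A_col T n A 1 t) *\<^sub>v (Z t *\<^sub>v c)) j = 0" for c
    proof -
      define x where "x = Z t *\<^sub>v c"
      have x: "x \<in> carrier_vec (n + n)" unfolding x_def using Zc[OF t] c by simp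
      have ker: "left_kernel1 (vec_index x) (\<lambda>i. vec_index x (n + i))"
        using Z_ker[OF t c] infl_E_1_left_kernel[OF t x] unfolding x_def by blast
      have zero: "vec_index x i = 0" "vec_index x (n + i) = 0" if "i < l" for i
      proof -
        have "(\<Sum>i<n. A t $$ (i, j) * vec_index x i) + (\<Sum>i<n. mat_nderiv T 1 A t $$ (i, j) * vec_index x (n + i)) = 0"
          if "j < l" "j < n1 \<or> m \<le> j" for j
          using cols[of j] free_coord(3)[of j] infl_A_col_1_left_kernel[OF t x, of j] that size_le
          by (simp add: x_def[symmetric] del: index_mult_mat_vec)
        from left_kernel1_zero[OF ker this that] show "vec_index x i = 0" "vec_index x (n + i) = 0" by auto
      qed
      have "vec_index c p = 0" if p: "p < ?a" for p
      proof -
        have "vec_index x (m + \<kappa> p) = 0"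
        proof (cases "p < l - m")
          case True
          then show ?thesis using zero(1)[of "m + p"] by (simp add: \<kappa>_def)
        next
          case False
          then have "m + \<kappa> p = n + (s + (p - (l - m)))" "s + (p - (l - m)) < l"
            using p size_le by (auto simp: \<kappa>_def sizes(3))
          then show ?thesis using zero(2)[of "s + (p - (l - m))"] by simp
        qed
        moreover have "vec_index x (m + \<kappa> p) = \<delta> t * vec_index c p"
          unfolding x_def Z_eq(1)[OF t c] X_vec[OF t Z_eq(2)[OF t c] \<kappa>[OF p]] Q_\<kappa>[OF c p] ..
        ultimately show ?thesis using X(2)[OF t] by simp
      qed
      then show ?thesis using c by (intro eq_vecI) auto
    qed
  qed
qed

end

theorem corollary7p2:
  fixes E J R K A :: "real \<Rightarrow> real mat"
    and t0 tf :: real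
    and n1 n2 n3 n4 n5 n :: nat
    and k :: enat
  defines "n \<equiv> n1 + n2 + n3 + n4 + n5"
    and "A \<equiv> sys_mat E J R K"
  assumes "t0 < tf"
    and smooth: "1 \<le> k"
      "Ck_mat k {t0..tf} n n E" "Ck_mat k {t0..tf} n n J"
      "Ck_mat k {t0..tf} n n R" "Ck_mat k {t0..tf} n n K"
    and "n4 = n1"
    and "dHDAE {t0..tf} n E J R K"
    and "block_normal_form {t0..tf} [n1, n2, n3, n4, n5] E J R K"
  shows
    "(\<forall>z0. consistent t0 tf n E A z0 \<longrightarrow> (uniquely_solvable t0 tf n E A z0 \<longleftrightarrow> n5 = 0)) \<and>
     (n5 \<noteq> 0 \<longrightarrow>
        (\<forall>z0 z w. solves_ivp t0 tf n E A z0 z \<longrightarrow> Ck_vec 1 {t0..tf} n5 w \<longrightarrow>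
           solves_ivp t0 tf n E A (replace_tail (n - n5) z0 (w t0))
             (\<lambda>t. replace_tail (n - n5) (z t) (w t)))) \<and>
     (\<forall>z0. consistent t0 tf n E A z0 \<longrightarrow>
        (\<not> solution_unique t0 tf n E A z0 \<longleftrightarrow>
           (\<forall>t\<in>{t0..tf}. common_kernel n (E t) (J t) (R t) (E t * K t) \<noteq> {0\<^sub>v n})) \<and>
        (\<not> solution_unique t0 tf n E A z0 \<longleftrightarrow>
           (\<Inter>t\<in>{t0..tf}. common_kernel n (E t) (J t) (R t) (E t * K t)) \<noteq> {0\<^sub>v n})) \<and>
     (is_strangeness_index k {t0..tf} n E A 0 \<longleftrightarrow> n1 = 0 \<and> n4 = 0) \<and>
     (is_strangeness_index k {t0..tf} n E A 1 \<longleftrightarrow> n1 = n4 \<and> n4 > 0)"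
proof -
  interpret normal_form_system t0 tf "{t0..tf}" E J R K A n1 n2 n3 n5
    "n1 + n2" "n1 + n2 + n3" "n1 + n2 + n3 + n1" n k
    by unfold_locales (use assms in \<open>simp_all add: n_def A_def\<close>)
  have tail: "n - n5 = n1 + n2 + n3 + n1" using \<open>n4 = n1\<close> by (simp add: n_def)
  have unique: "uniquely_solvable t0 tf n E A z0 \<longleftrightarrow> n5 = 0" if "consistent t0 tf n E A z0" for z0
    using that solution_unique_iff[OF that] by (simp add: uniquely_solvable_def consistent_def)
  have replace: "solves_ivp t0 tf n E A (replace_tail (n - n5) z0 (w t0)) (\<lambda>t. replace_tail (n - n5) (z t) (w t))"
    if "solves_ivp t0 tf n E A z0 z" "Ck_vec 1 {t0..tf} n5 w" for z0 z w
    using solves_replace_tail[of z0 z w] that unfolding tail solves_def by blast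
  have kernel: "\<not> solution_unique t0 tf n E A z0 \<longleftrightarrow>
      (\<forall>t\<in>{t0..tf}. common_kernel n (E t) (J t) (R t) (E t * K t) \<noteq> {0\<^sub>v n})"
    "\<not> solution_unique t0 tf n E A z0 \<longleftrightarrow>
      (\<Inter>t\<in>{t0..tf}. common_kernel n (E t) (J t) (R t) (E t * K t)) \<noteq> {0\<^sub>v n}"
    if "consistent t0 tf n E A z0" for z0
    unfolding solution_unique_iff[OF that] common_kernel_iff by (rule refl)+
  have index: "is_strangeness_index k {t0..tf} n E A 0 \<longleftrightarrow> n1 = 0 \<and> n4 = 0"
    "is_strangeness_index k {t0..tf} n E A 1 \<longleftrightarrow> n1 = n4 \<and> n4 > 0"
    using strangeness_hyp_0 not_strangeness_hyp_0 strangeness_hyp_1 \<open>n4 = n1\<close>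
    by (auto simp: is_strangeness_index_def)
  show ?thesis
    by (intro conjI allI impI) (rule unique replace kernel index; assumption)+
qed

end
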